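(* Let $u_{\mathsf I,h}(\boldsymbol{x};\boldsymbol{\xi})$ be the sample-wise finite element solution of model I and $u_{\mathsf{II},h}(\boldsymbol{x};\boldsymbol{\xi})$ the Wiener chaos finite element solution of model II (with $M$ Gaussian variables and maximum total polynomial degree $p\in\mathbb{N}_0$), with mean $u_{\mathsf{II},h,(\boldsymbol 0)}(\boldsymbol{x})$, all as defined in the context. Let $\boldsymbol{\xi}^{(1)},\ldots,\boldsymbol{\xi}^{(N_{\mathrm{mc}})}$ be independent samples of $\boldsymbol{\xi}$ and set $$\tilde u_{\mathsf I,h}(\boldsymbol{x},\boldsymbol{\xi}):=u_{\mathsf{II},h,(\boldsymbol 0)}(\boldsymbol{x})+\big(u_{\mathsf I,h}(\boldsymbol{x};\boldsymbol{\xi})-u_{\mathsf{II},h}(\boldsymbol{x};\boldsymbol{\xi})\big),\qquad \mathbb{E}_{\mathrm{IS}}[u_{\mathsf I,h}](\boldsymbol{x}):=\frac1{N_{\mathrm{mc}}}\sum_{i=1}^{N_{\mathrm{mc}}}\tilde u_{\mathsf I,h}(\boldsymbol{x};\boldsymbol{\xi}^{(i)}).$$ Then the following error estimate holds: $$\big\|\mathbb{E}_{\mathrm{IS}}[u_{\mathsf I,h}]-\mathbb{E}[u_{\mathsf I,h}]\big\|^2_{L_2(\mathbb{F};H_0^1(D))}=\int_D\operatorname{Var}\big(\mathbb{E}_{\mathrm{IS}}[u_{\mathsf I,h}]\big)(\boldsymbol{x})\,d\boldsymbol{x}=\mathcal{O}(\sigma^4)\,N_{\mathrm{mc}}^{-1},$$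 where $\mathcal{O}(\sigma^4)$ is with respect to $\sigma\to0$, uniformly in $N_{\mathrm{mc}}$.
   Context: $D\subset\mathbb{R}^d$ is the physical domain, $f(\boldsymbol{x})$ is a deterministic force term, and $\mathbb{F}=(\Omega,\mathcal F,P)$ is a complete probability space whose $\sigma$-algebra is generated by i.i.d. standard Gaussian random variables $\xi_1,\xi_2,\ldots$. $G(\boldsymbol{x},\omega)$ is a stationary Gaussian process with zero mean, unit variance and covariance kernel $K(\boldsymbol{x}_1,\boldsymbol{x}_2)$ depending only on $|\boldsymbol{x}_1-\boldsymbol{x}_2|$, with Karhunen-Loève expansion $G=\sum_{i\ge1}\sqrt{\lambda_i}\phi_i(\boldsymbol{x})\xi_i$, where $(\lambda_i,\phi_i)$ are the eigenpairs of $K$ with $\phi_i$ orthonormal in $L_2(D)$ and $\sum_i\lambda_i\phi_i^2(\boldsymbol{x})=1$ for all $\boldsymbol{x}\in D$. The log-normal coefficient is $a=e^{\sigma G-\sigma^2/2}$, where $\sigma>0$ is the standard deviation of the underlying Gaussian process $\sigma G$. For computation only the first $M$ variables $\boldsymbol{\xi}=(\xi_1,\ldots,\xi_M)$ are kept. With $\Phi_1(\boldsymbol{x})=(\sigma\sqrt{\lambda_1}\phi_1(\boldsymbol{x}),\ldots,\sigma\sqrt{\lambda_M}\phi_M(\boldsymbol{x}))$, the coefficient used is $a(\boldsymbol{x},\boldsymbol{\xi})=e^{\Phi_1(\boldsymbol{x})^{\mathsf T}\boldsymbol{\xi}-\frac12\sigma^2}$. $V_{h,q}\subset H_0^1(D)$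 is the finite element space of piecewise polynomials of degree at most $q$ on a regular triangulation of $D$, vanishing on $\partial D$. Model I is $-\nabla\cdot(a\nabla u_{\mathsf I})=f$ in $D$, $u_{\mathsf I}=0$ on $\partial D$. For each value of $\boldsymbol{\xi}$, $u_{\mathsf I,h}(\cdot;\boldsymbol{\xi})\in V_{h,q}$ is its finite element solution: $\int_D a(\boldsymbol{x},\boldsymbol{\xi})\nabla u_{\mathsf I,h}\cdot\nabla v\,d\boldsymbol{x}=\int_D fv\,d\boldsymbol{x}$ for all $v\in V_{h,q}$. Model II is $-\nabla\cdot((a^{-1})^{\diamond(-1)}\diamond\nabla u_{\mathsf{II}})=f$ in $D$, $u_{\mathsf{II}}=0$ on $\partial D$, where $\diamond$ is the Wick product, determined by $\mathrm{H}_{\boldsymbol\alpha}\diamond\mathrm{H}_{\boldsymbol\beta}=\mathrm{H}_{\boldsymbol\alpha+\boldsymbol\beta}$, and $(a^{-1})^{\diamond(-1)}$ is the Wick inverse of $a^{-1}$, i.e. $a^{-1}\diamond(a^{-1})^{\diamond(-1)}=1$. Here $\mathrm{H}_{\boldsymbol\alpha}(\boldsymbol\xi)=\prod_k\mathrm{H}_{\alpha_k}(\xi_k)$ with $\mathrm{H}_n$ the probabilistic Hermite polynomials. For $a=e^{\sigma G-\sigma^2/2}$, the Hermite coefficients of $(a^{-1})^{\diamond(-1)}$ with multi-index $\boldsymbol\alpha\in\mathbb{N}_0^M$ (only the first $M$ variables) are $\hat a_{\boldsymbol\alpha}(\boldsymbol{x})=e^{-\sigma^2}\Phi_1(\boldsymbol{x})^{\boldsymbol\alpha}/\boldsymbol\alpha!$.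 With $\mathcal{J}_{M,p}=\{\boldsymbol\alpha\in\mathbb{N}_0^M:|\boldsymbol\alpha|\le p\}$, $p\in\mathbb{N}_0$, the discrete solution is $u_{\mathsf{II},h}(\boldsymbol{x};\boldsymbol\xi)=\sum_{\boldsymbol\alpha\in\mathcal{J}_{M,p}}u_{\mathsf{II},h,\boldsymbol\alpha}(\boldsymbol{x})\mathrm{H}_{\boldsymbol\alpha}(\boldsymbol\xi)$, with $u_{\mathsf{II},h,\boldsymbol\alpha}\in V_{h,q}$ determined by $$\sum_{\boldsymbol\alpha\le\boldsymbol\gamma}\int_D\hat a_{\boldsymbol\gamma-\boldsymbol\alpha}\nabla u_{\mathsf{II},h,\boldsymbol\alpha}\cdot\nabla v\,d\boldsymbol{x}=\delta_{(\boldsymbol 0),\boldsymbol\gamma}\int_D fv\,d\boldsymbol{x}\qquad\forall v\in V_{h,q},\ \boldsymbol\gamma\in\mathcal{J}_{M,p}.$$ $L_2(\mathbb{F};H_0^1(D))$ is the space of square-integrable $H_0^1(D)$-valued random elements, with $\|w\|^2_{L_2(\mathbb{F};H_0^1(D))}=\mathbb{E}\|w\|^2_{H_0^1(D)}$; variance and expectation of functions of $\boldsymbol{x}$ are taken pointwise in $\boldsymbol{x}$.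
   Formalization: As written the first equality fails (gradient norm vs. variance of values): it is proved with the variance of the gradient, and for the L_2(D) norm with Var as stated; the O(σ^4) bound, false for p=0 (plain Monte Carlo gives order σ^2), is proved for p≥1, for both the H_0^1 error and ∫Var. *)

theory Defs
  imports "HOL-Probability.Probability"
begin

definition multi_indices :: "'i set \<Rightarrow> nat \<Rightarrow> ('i \<Rightarrow> nat) set" where
  "multi_indices I p = {\<alpha>. (\<forall>i. i \<notin> I \<longrightarrow> \<alpha> i = 0) \<and> (\<Sum>i\<in>I. \<alpha> i) \<le> p}"

definition square_integrable_on :: "'a::euclidean_space set \<Rightarrow> ('a \<Rightarrow> 'b::euclidean_space) \<Rightarrow> bool" where
  "square_integrable_on D u \<longleftrightarrow>
     u \<in> borel_measurable (lebesgue_on D) \<and> integrable (lebesgue_on D) (\<lambda>x. (norm (u x))\<^sup>2)"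

definition classical_grad :: "('a::euclidean_space \<Rightarrow> real) \<Rightarrow> 'a \<Rightarrow> 'a" where
  "classical_grad u x = (\<Sum>b\<in>Basis. frechet_derivative u (at x) b *\<^sub>R b)"

text \<open>Test functions are the $C^1$ functions with compact support in $D$; they yield the same weak
  gradients and the same space $H_0^1(D)$ as $C^\infty$ functions with compact support.\<close>

definition test_function :: "'a::euclidean_space set \<Rightarrow> ('a \<Rightarrow> real) \<Rightarrow> bool" where
  "test_function D \<psi> \<longleftrightarrow>
     (\<forall>x. \<psi> differentiable (at x)) \<and> continuous_on UNIV (classical_grad \<psi>) \<and>
     compact (closure {x. \<psi> x \<noteq> 0}) \<and> closure {x. \<psi> x \<noteq> 0} \<subseteq> D"

definition has_weak_grad :: "'a::euclidean_space set \<Rightarrow> ('a \<Rightarrow> real) \<Rightarrow> ('a \<Rightarrow> 'a) \<Rightarrow> bool" where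
  "has_weak_grad D u g \<longleftrightarrow>
     square_integrable_on D u \<and> square_integrable_on D g \<and>
     (\<forall>\<psi>. test_function D \<psi> \<longrightarrow>
        (\<integral>x. u x *\<^sub>R classical_grad \<psi> x \<partial>lebesgue_on D) = - (\<integral>x. \<psi> x *\<^sub>R g x \<partial>lebesgue_on D))"

definition H10 :: "'a::euclidean_space set \<Rightarrow> ('a \<Rightarrow> real) set" where
  "H10 D = {u. \<exists>g. has_weak_grad D u g \<and>
     (\<exists>\<psi> :: nat \<Rightarrow> 'a \<Rightarrow> real. (\<forall>n. test_function D (\<psi> n)) \<and>
        (\<lambda>n. \<integral>x. (u x - \<psi> n x)\<^sup>2 + (norm (g x - classical_grad (\<psi> n) x))\<^sup>2 \<partial>lebesgue_on D)
          \<longlonglongrightarrow> 0)}"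

text \<open>A weak gradient is determined only up to null sets. The classical gradient is used as its
  representative whenever it is one (as for finite element functions), so that the values of the
  gradients of a family of random functions at a fixed point are meaningful.\<close>

definition weak_grad :: "'a::euclidean_space set \<Rightarrow> ('a \<Rightarrow> real) \<Rightarrow> 'a \<Rightarrow> 'a" where
  "weak_grad D u =
     (if has_weak_grad D u (classical_grad u) then classical_grad u
      else (SOME g. has_weak_grad D u g))"

definition H10_norm :: "'a::euclidean_space set \<Rightarrow> ('a \<Rightarrow> real) \<Rightarrow> real" where
  "H10_norm D u = sqrt (\<integral>x. (norm (weak_grad D u x))\<^sup>2 \<partial>lebesgue_on D)"

definition L2_norm :: "'a::euclidean_space set \<Rightarrow> ('a \<Rightarrow> real) \<Rightarrow> real" where
  "L2_norm D u = sqrt (\<integral>x. (u x)\<^sup>2 \<partial>lebesgue_on D)"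

text \<open>Measurability of an $H_0^1(D)$-valued map is expressed weakly, which is equivalent to strong
  measurability because $H_0^1(D)$ is separable.\<close>

definition L2_H10 :: "'w measure \<Rightarrow> 'a::euclidean_space set \<Rightarrow> ('w \<Rightarrow> 'a \<Rightarrow> real) set" where
  "L2_H10 P D = {w. (\<forall>\<omega>\<in>space P. w \<omega> \<in> H10 D) \<and>
     (\<forall>v\<in>H10 D. (\<lambda>\<omega>. \<integral>x. weak_grad D (w \<omega>) x \<bullet> weak_grad D v x \<partial>lebesgue_on D)
                   \<in> borel_measurable P) \<and>
     integrable P (\<lambda>\<omega>. (H10_norm D (w \<omega>))\<^sup>2)}"

definition L2_H10_norm :: "'w measure \<Rightarrow> 'a::euclidean_space set \<Rightarrow> ('w \<Rightarrow> 'a \<Rightarrow> real) \<Rightarrow> real" where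
  "L2_H10_norm P D w = sqrt (\<integral>\<omega>. (H10_norm D (w \<omega>))\<^sup>2 \<partial>P)"

definition L2_L2_norm :: "'w measure \<Rightarrow> 'a::euclidean_space set \<Rightarrow> ('w \<Rightarrow> 'a \<Rightarrow> real) \<Rightarrow> real" where
  "L2_L2_norm P D w = sqrt (\<integral>\<omega>. (L2_norm D (w \<omega>))\<^sup>2 \<partial>P)"

definition polynomials_upto :: "nat \<Rightarrow> ('a::euclidean_space \<Rightarrow> real) set" where
  "polynomials_upto q =
     {f. \<exists>c. \<forall>x. f x = (\<Sum>\<alpha>\<in>multi_indices Basis q. c \<alpha> * (\<Prod>b\<in>Basis. (x \<bullet> b) ^ \<alpha> b))}"

text \<open>\<^const>\<open>triangulation\<close> is the library's notion: finitely many simplices, any two of which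
  meet in a common face.\<close>

definition regular_triangulation :: "'a::euclidean_space set \<Rightarrow> 'a set set \<Rightarrow> bool" where
  "regular_triangulation D \<T> \<longleftrightarrow>
     triangulation \<T> \<and> (\<forall>T\<in>\<T>. int DIM('a) simplex T) \<and> \<Union>\<T> = closure D"

text \<open>Polynomials are prescribed on closed simplices, which makes the functions continuous on the
  closure of $D$. They are extended by zero, so each is determined as a function and not just up to
  null sets.\<close>

definition fe_space :: "'a::euclidean_space set \<Rightarrow> 'a set set \<Rightarrow> nat \<Rightarrow> ('a \<Rightarrow> real) set" where
  "fe_space D \<T> q = {v \<in> H10 D.
     (\<forall>T\<in>\<T>. \<exists>f\<in>polynomials_upto q. \<forall>x\<in>T. v x = f x) \<and> (\<forall>x. x \<notin> D \<longrightarrow> v x = 0)}"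

definition gaussian_space :: "'w measure \<Rightarrow> (nat \<Rightarrow> 'w \<Rightarrow> real) \<Rightarrow> bool" where
  "gaussian_space P \<xi> \<longleftrightarrow>
     prob_space P \<and> prob_space.indep_vars P (\<lambda>_. borel) \<xi> UNIV \<and>
     (\<forall>k. distributed P lborel (\<xi> k) std_normal_density) \<and>
     P = completion (restr_to_subalg P
           (sigma (space P) {\<xi> k -` B \<inter> space P | k B. B \<in> sets borel}))"

definition centered_gaussian :: "'w measure \<Rightarrow> ('w \<Rightarrow> real) \<Rightarrow> bool" where
  "centered_gaussian P Y \<longleftrightarrow> Y \<in> borel_measurable P \<and>
     ((\<exists>s>0. distributed P lborel Y (normal_density 0 s)) \<or> (AE \<omega> in P. Y \<omega> = 0))"

definition stationary_gaussian_process ::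
  "'w measure \<Rightarrow> 'a::euclidean_space set \<Rightarrow> ('a \<Rightarrow> 'a \<Rightarrow> real) \<Rightarrow> ('a \<Rightarrow> 'w \<Rightarrow> real) \<Rightarrow> bool" where
  "stationary_gaussian_process P D K G \<longleftrightarrow>
     (\<forall>S c. finite S \<and> S \<subseteq> D \<longrightarrow> centered_gaussian P (\<lambda>\<omega>. \<Sum>x\<in>S. c x * G x \<omega>)) \<and>
     (\<forall>x\<in>D. \<forall>y\<in>D. (\<integral>\<omega>. G x \<omega> * G y \<omega> \<partial>P) = K x y) \<and>
     (\<forall>x\<in>D. K x x = 1) \<and>
     (\<exists>\<kappa>. \<forall>x\<in>D. \<forall>y\<in>D. K x y = \<kappa> (dist x y))"

definition karhunen_loeve ::
  "'w measure \<Rightarrow> (nat \<Rightarrow> 'w \<Rightarrow> real) \<Rightarrow> 'a::euclidean_space set \<Rightarrow> ('a \<Rightarrow> 'a \<Rightarrow> real) \<Rightarrow>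
   ('a \<Rightarrow> 'w \<Rightarrow> real) \<Rightarrow> (nat \<Rightarrow> real) \<Rightarrow> (nat \<Rightarrow> 'a \<Rightarrow> real) \<Rightarrow> bool" where
  "karhunen_loeve P \<xi> D K G lam \<phi> \<longleftrightarrow>
     (\<forall>i. 0 \<le> lam i) \<and>
     (\<forall>i. square_integrable_on D (\<phi> i)) \<and>
     (\<forall>i j. (\<integral>x. \<phi> i x * \<phi> j x \<partial>lebesgue_on D) = (if i = j then 1 else 0)) \<and>
     (\<forall>i. \<forall>x\<in>D. integrable (lebesgue_on D) (\<lambda>y. K x y * \<phi> i y) \<and>
                  (\<integral>y. K x y * \<phi> i y \<partial>lebesgue_on D) = lam i * \<phi> i x) \<and>
     (\<forall>x\<in>D. (\<lambda>i. lam i * (\<phi> i x)\<^sup>2) sums 1) \<and>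
     (\<forall>x\<in>D. (\<lambda>n. \<integral>\<omega>. (G x \<omega> - (\<Sum>i<n. sqrt (lam i) * \<phi> i x * \<xi> i \<omega>))\<^sup>2 \<partial>P) \<longlonglongrightarrow> 0)"

text \<open>Vectors in $\mathbb{R}^M$ are functions in \<^term>\<open>{..<M} \<rightarrow>\<^sub>E (UNIV :: real set)\<close>, the underlying
  set of the product space \<^term>\<open>Pi\<^sub>M {..<M} (\<lambda>_. borel :: real measure)\<close>.\<close>

definition gaussian_vector :: "nat \<Rightarrow> (nat \<Rightarrow> 'w \<Rightarrow> real) \<Rightarrow> 'w \<Rightarrow> nat \<Rightarrow> real" where
  "gaussian_vector M \<xi> \<omega> = (\<lambda>k\<in>{..<M}. \<xi> k \<omega>)"

definition independent_samples ::
  "'w measure \<Rightarrow> nat \<Rightarrow> (nat \<Rightarrow> 'w \<Rightarrow> real) \<Rightarrow> nat \<Rightarrow> (nat \<Rightarrow> 'w \<Rightarrow> nat \<Rightarrow> real) \<Rightarrow> bool" where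
  "independent_samples P M \<xi> N X \<longleftrightarrow>
     prob_space.indep_vars P (\<lambda>_. Pi\<^sub>M {..<M} (\<lambda>_. borel)) X {..<N} \<and>
     (\<forall>i<N. distr P (Pi\<^sub>M {..<M} (\<lambda>_. borel)) (X i) =
             distr P (Pi\<^sub>M {..<M} (\<lambda>_. borel)) (gaussian_vector M \<xi>))"

definition Phi1 :: "real \<Rightarrow> (nat \<Rightarrow> real) \<Rightarrow> (nat \<Rightarrow> 'a \<Rightarrow> real) \<Rightarrow> 'a \<Rightarrow> nat \<Rightarrow> real" where
  "Phi1 \<sigma> lam \<phi> x k = \<sigma> * sqrt (lam k) * \<phi> k x"

definition lognormal_coeff ::
  "nat \<Rightarrow> (nat \<Rightarrow> real) \<Rightarrow> (nat \<Rightarrow> 'a \<Rightarrow> real) \<Rightarrow> real \<Rightarrow> 'a \<Rightarrow> (nat \<Rightarrow> real) \<Rightarrow> real" where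
  "lognormal_coeff M lam \<phi> \<sigma> x y = exp ((\<Sum>k<M. Phi1 \<sigma> lam \<phi> x k * y k) - \<sigma>\<^sup>2 / 2)"

definition model_I_solution ::
  "'a::euclidean_space set \<Rightarrow> ('a \<Rightarrow> real) set \<Rightarrow> ('a \<Rightarrow> real) \<Rightarrow> nat \<Rightarrow> (nat \<Rightarrow> real) \<Rightarrow>
   (nat \<Rightarrow> 'a \<Rightarrow> real) \<Rightarrow> real \<Rightarrow> ((nat \<Rightarrow> real) \<Rightarrow> 'a \<Rightarrow> real) \<Rightarrow> bool" where
  "model_I_solution D V f M lam \<phi> \<sigma> u \<longleftrightarrow>
     (\<forall>y \<in> {..<M} \<rightarrow>\<^sub>E UNIV. u y \<in> V \<and>
        (\<forall>v\<in>V. (\<integral>x. lognormal_coeff M lam \<phi> \<sigma> x y * (weak_grad D (u y) x \<bullet> weak_grad D v x)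
                    \<partial>lebesgue_on D)
              = (\<integral>x. f x * v x \<partial>lebesgue_on D)))"

fun hermite :: "nat \<Rightarrow> real \<Rightarrow> real" where
  "hermite 0 t = 1"
| "hermite (Suc 0) t = t"
| "hermite (Suc (Suc n)) t = t * hermite (Suc n) t - real (Suc n) * hermite n t"

definition hermite_multi :: "nat \<Rightarrow> (nat \<Rightarrow> nat) \<Rightarrow> (nat \<Rightarrow> real) \<Rightarrow> real" where
  "hermite_multi M \<alpha> y = (\<Prod>k<M. hermite (\<alpha> k) (y k))"

text \<open>Hermite coefficients of the Wick inverse of $a^{-1}$ for $a = e^{\sigma G - \sigma^2/2}$.\<close>

definition wick_inverse_coeff ::
  "nat \<Rightarrow> (nat \<Rightarrow> real) \<Rightarrow> (nat \<Rightarrow> 'a \<Rightarrow> real) \<Rightarrow> real \<Rightarrow> 'a \<Rightarrow> (nat \<Rightarrow> nat) \<Rightarrow> real" where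
  "wick_inverse_coeff M lam \<phi> \<sigma> x \<alpha> =
     exp (- \<sigma>\<^sup>2) * (\<Prod>k<M. Phi1 \<sigma> lam \<phi> x k ^ \<alpha> k) / (\<Prod>k<M. fact (\<alpha> k))"

definition model_II_solution ::
  "'a::euclidean_space set \<Rightarrow> ('a \<Rightarrow> real) set \<Rightarrow> ('a \<Rightarrow> real) \<Rightarrow> nat \<Rightarrow> nat \<Rightarrow> (nat \<Rightarrow> real) \<Rightarrow>
   (nat \<Rightarrow> 'a \<Rightarrow> real) \<Rightarrow> real \<Rightarrow> ((nat \<Rightarrow> nat) \<Rightarrow> 'a \<Rightarrow> real) \<Rightarrow> bool" where
  "model_II_solution D V f M p lam \<phi> \<sigma> U \<longleftrightarrow>
     (\<forall>\<alpha> \<in> multi_indices {..<M} p. U \<alpha> \<in> V) \<and>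
     (\<forall>\<gamma> \<in> multi_indices {..<M} p. \<forall>v\<in>V.
        (\<Sum>\<alpha> | \<alpha> \<in> multi_indices {..<M} p \<and> (\<forall>k. \<alpha> k \<le> \<gamma> k).
            \<integral>x. wick_inverse_coeff M lam \<phi> \<sigma> x (\<lambda>k. \<gamma> k - \<alpha> k) *
                 (weak_grad D (U \<alpha>) x \<bullet> weak_grad D v x) \<partial>lebesgue_on D)
        = (if \<gamma> = (\<lambda>_. 0) then \<integral>x. f x * v x \<partial>lebesgue_on D else 0))"

definition chaos_sum ::
  "nat \<Rightarrow> nat \<Rightarrow> ((nat \<Rightarrow> nat) \<Rightarrow> 'a \<Rightarrow> real) \<Rightarrow> (nat \<Rightarrow> real) \<Rightarrow> 'a \<Rightarrow> real" where
  "chaos_sum M p U y x = (\<Sum>\<alpha>\<in>multi_indices {..<M} p. U \<alpha> x * hermite_multi M \<alpha> y)"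

definition u_tilde ::
  "nat \<Rightarrow> nat \<Rightarrow> ((nat \<Rightarrow> real) \<Rightarrow> 'a \<Rightarrow> real) \<Rightarrow> ((nat \<Rightarrow> nat) \<Rightarrow> 'a \<Rightarrow> real) \<Rightarrow>
   (nat \<Rightarrow> real) \<Rightarrow> 'a \<Rightarrow> real" where
  "u_tilde M p u U y x = U (\<lambda>_. 0) x + (u y x - chaos_sum M p U y x)"

definition E_IS ::
  "nat \<Rightarrow> nat \<Rightarrow> nat \<Rightarrow> (nat \<Rightarrow> 'w \<Rightarrow> nat \<Rightarrow> real) \<Rightarrow> ((nat \<Rightarrow> real) \<Rightarrow> 'a \<Rightarrow> real) \<Rightarrow>
   ((nat \<Rightarrow> nat) \<Rightarrow> 'a \<Rightarrow> real) \<Rightarrow> 'w \<Rightarrow> 'a \<Rightarrow> real" where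
  "E_IS M p N X u U \<omega> x = (\<Sum>i<N. u_tilde M p u U (X i \<omega>) x) / real N"

definition mean_field ::
  "'w measure \<Rightarrow> nat \<Rightarrow> (nat \<Rightarrow> 'w \<Rightarrow> real) \<Rightarrow> ((nat \<Rightarrow> real) \<Rightarrow> 'a \<Rightarrow> real) \<Rightarrow> 'a \<Rightarrow> real" where
  "mean_field P M \<xi> u x = (\<integral>\<omega>. u (gaussian_vector M \<xi> \<omega>) x \<partial>P)"

definition Var :: "'w measure \<Rightarrow> ('w \<Rightarrow> 'a \<Rightarrow> real) \<Rightarrow> 'a \<Rightarrow> real" where
  "Var P w x = (\<integral>\<omega>. (w \<omega> x - (\<integral>\<omega>'. w \<omega>' x \<partial>P))\<^sup>2 \<partial>P)"

text \<open>The pointwise variance of the gradient of a random field, i.e. the trace of its covariance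
  matrix.\<close>

definition Var_grad :: "'w measure \<Rightarrow> 'a::euclidean_space set \<Rightarrow> ('w \<Rightarrow> 'a \<Rightarrow> real) \<Rightarrow> 'a \<Rightarrow> real" where
  "Var_grad P D w x = (\<Sum>b\<in>Basis. Var P (\<lambda>\<omega> x. weak_grad D (w \<omega>) x \<bullet> b) x)"

end

theory Submission
  imports Defs
begin

text \<open>
  In a basis of the finite element space that is orthonormal for $(u, v) \mapsto \int_D \nabla u
  \cdot \nabla v$, a random finite element function is a random vector of coordinates. The chaos
  polynomials of positive degree have mean zero, so the estimator is unbiased and each of its
  coordinates is an average of $N$ independent copies of a coordinate of $\tilde u$; this gives the
  variance identities and the factor $1/N$.

  For the rate, let $u_0$ solve the problem with coefficient $1$, and let $w_k$ solve
  $(w_k, v) = -\int_D \sqrt{\lambda_k} \phi_k \nabla u_0 \cdot \nabla v$. Coercivity gives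
  $u_I = u_0 + \sigma \sum_k \xi_k w_k + O(\sigma^2 e^{c |\xi|})$, whereas the triangular system of
  model II yields $u_{II,0} = e^{\sigma^2} u_0$, first order coefficients
  $\sigma e^{\sigma^2} w_k$ and $u_{II,\alpha} = O(\sigma^{|\alpha|})$. So $\tilde u - u_0$ is
  $O(\sigma^2 e^{c |\xi|})$, and its variance is $O(\sigma^4)$ because the exponential has Gaussian moments.
\<close>

section \<open>Continuously differentiable functions\<close>

text \<open>Two obstacles shape the proof. Variances are pointwise in x, so expansions must hold at
  every point: a finite element function that vanishes almost everywhere must vanish identically,
  and gradients are handled as classical ones, which are additive only off the null set of element
  boundaries. Hence the identification of weak with classical gradients, and the Poincare
  inequality, which makes the gradient form definite. Second, the coefficient is unbounded in \<xi>.
  Every mode satisfies \<open>\<bar>sqrt (lam k) * \<phi> k x\<bar> \<le> 1\<close>, so for fixed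
  \<xi> the coefficient lies between bounds exponential in the l1 norm of \<xi>, and all estimates
  stay in that growth class. Measurability in \<xi> is not assumed for model I; it comes from
  continuity in the parameters. The first-order match holds up to the factor
  \<open>exp (\<sigma>\<^sup>2)\<close>, which costs \<sigma>^3, and needs the unit multi-indices,
  that is \<open>1 \<le> p\<close>: for \<open>p = 0\<close> the corrected variable is
  \<open>uI\<close> itself and the estimator is plain Monte Carlo.\<close>

definition C1 :: "('a::euclidean_space \<Rightarrow> real) \<Rightarrow> bool" where
  "C1 F \<longleftrightarrow> (\<forall>x. F differentiable (at x)) \<and> continuous_on UNIV (classical_grad F)"

lemma classical_grad_eqI:
  assumes "GDERIV F x :> g"
  shows "classical_grad F x = g"
proof -
  have "frechet_derivative F (at x) = (\<lambda>h. h \<bullet> g)"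
    using assms unfolding gderiv_def by (metis frechet_derivative_at)
  then have "classical_grad F x = (\<Sum>b\<in>Basis. (b \<bullet> g) *\<^sub>R b)"
    by (simp add: classical_grad_def)
  also have "\<dots> = g"
    by (subst inner_commute) (rule euclidean_representation)
  finally show ?thesis .
qed

lemma GDERIV_classical_grad:
  assumes "F differentiable (at x)"
  shows "GDERIV F x :> classical_grad F x"
proof -
  have d: "(F has_derivative frechet_derivative F (at x)) (at x)"
    using assms frechet_derivative_works by blast
  then have lin: "linear (frechet_derivative F (at x))"
    using has_derivative_linear by blast
  have "frechet_derivative F (at x) h = h \<bullet> classical_grad F x" for h
  proof -
    have "frechet_derivative F (at x) h = frechet_derivative F (at x) (\<Sum>b\<in>Basis. (h \<bullet> b) *\<^sub>R b)"
      by (simp add: euclidean_representation)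
    also have "\<dots> = (\<Sum>b\<in>Basis. (h \<bullet> b) * frechet_derivative F (at x) b)"
      by (simp add: linear_sum[OF lin] linear_scale[OF lin])
    finally show ?thesis by (simp add: classical_grad_def inner_sum_right mult.commute)
  qed
  then have "frechet_derivative F (at x) = (\<lambda>h. h \<bullet> classical_grad F x)" by auto
  with d show ?thesis by (simp add: gderiv_def)
qed

lemma GDERIV_imp_differentiable: "GDERIV F x :> g \<Longrightarrow> F differentiable (at x)"
  unfolding gderiv_def differentiable_def by blast

lemma C1I:
  assumes "\<And>x. GDERIV F x :> G x" "continuous_on UNIV G"
  shows "C1 F" "classical_grad F = G"
proof -
  show "classical_grad F = G" using assms(1) classical_grad_eqI by blast
  with assms show "C1 F" unfolding C1_def using GDERIV_imp_differentiable by auto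
qed

lemma C1_GDERIV: "C1 F \<Longrightarrow> GDERIV F x :> classical_grad F x"
  unfolding C1_def using GDERIV_classical_grad by auto

lemma C1_continuous_grad: "C1 F \<Longrightarrow> continuous_on UNIV (classical_grad F)"
  unfolding C1_def by auto

lemma C1_continuous: "C1 F \<Longrightarrow> continuous_on UNIV F"
  unfolding C1_def by (meson continuous_at_imp_continuous_on differentiable_imp_continuous_within)

lemma C1_const: "C1 (\<lambda>x. c)" "classical_grad (\<lambda>x. c) = (\<lambda>x. 0)"
  using C1I[of "\<lambda>x. c" "\<lambda>x. 0"] by (auto simp: GDERIV_const)

lemma C1_inner: "C1 (\<lambda>x. x \<bullet> b)" "classical_grad (\<lambda>x. x \<bullet> b) = (\<lambda>x. b)"
proof -
  have "GDERIV (\<lambda>x. x \<bullet> b) x :> b" for x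
    unfolding gderiv_def by (intro derivative_intros)
  from C1I[OF this] show "C1 (\<lambda>x. x \<bullet> b)" "classical_grad (\<lambda>x. x \<bullet> b) = (\<lambda>x. b)" by auto
qed

lemma C1_mult:
  assumes "C1 F" "C1 G"
  shows "C1 (\<lambda>x. F x * G x)"
    "classical_grad (\<lambda>x. F x * G x) = (\<lambda>x. F x *\<^sub>R classical_grad G x + G x *\<^sub>R classical_grad F x)"
proof -
  have "GDERIV (\<lambda>x. F x * G x) x :> F x *\<^sub>R classical_grad G x + G x *\<^sub>R classical_grad F x" for x
    using GDERIV_mult C1_GDERIV assms by blast
  moreover have "continuous_on UNIV (\<lambda>x. F x *\<^sub>R classical_grad G x + G x *\<^sub>R classical_grad F x)"
    by (intro continuous_intros C1_continuous C1_continuous_grad assms)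
  ultimately show "C1 (\<lambda>x. F x * G x)"
    "classical_grad (\<lambda>x. F x * G x) = (\<lambda>x. F x *\<^sub>R classical_grad G x + G x *\<^sub>R classical_grad F x)"
    by (rule C1I)+
qed

lemma C1_add:
  assumes "C1 F" "C1 G"
  shows "C1 (\<lambda>x. F x + G x)" "classical_grad (\<lambda>x. F x + G x) = (\<lambda>x. classical_grad F x + classical_grad G x)"
proof -
  have "GDERIV (\<lambda>x. F x + G x) x :> classical_grad F x + classical_grad G x" for x
    using GDERIV_add C1_GDERIV assms by blast
  moreover have "continuous_on UNIV (\<lambda>x. classical_grad F x + classical_grad G x)"
    by (intro continuous_intros C1_continuous C1_continuous_grad assms)
  ultimately show "C1 (\<lambda>x. F x + G x)" "classical_grad (\<lambda>x. F x + G x) = (\<lambda>x. classical_grad F x + classical_grad G x)"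
    by (rule C1I)+
qed

lemma C1_cmult:
  assumes "C1 F"
  shows "C1 (\<lambda>x. c * F x)" "classical_grad (\<lambda>x. c * F x) = (\<lambda>x. c *\<^sub>R classical_grad F x)"
  using C1_mult[OF C1_const(1) assms, of c] by (auto simp: C1_const(2))

lemma C1_compose:
  assumes "C1 F" "\<And>x. (h has_real_derivative h' (F x)) (at (F x))" "continuous_on (range F) h'"
  shows "C1 (\<lambda>x. h (F x))"
proof -
  have "GDERIV (\<lambda>x. h (F x)) x :> h' (F x) *\<^sub>R classical_grad F x" for x
    using GDERIV_DERIV_compose[OF C1_GDERIV[OF assms(1)] assms(2)] .
  moreover have "continuous_on UNIV (\<lambda>x. h' (F x) *\<^sub>R classical_grad F x)"
    by (intro continuous_intros C1_continuous_grad assms continuous_on_compose2[OF assms(3)] C1_continuous) auto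
  ultimately show ?thesis by (rule C1I)
qed

lemma C1_prod: "finite I \<Longrightarrow> (\<And>i. i \<in> I \<Longrightarrow> C1 (F i)) \<Longrightarrow> C1 (\<lambda>x. \<Prod>i\<in>I. F i x)"
  by (induction I rule: finite_induct) (auto simp: C1_const intro: C1_mult)

lemma C1_sum: "(\<And>i. i \<in> I \<Longrightarrow> C1 (F i)) \<Longrightarrow> C1 (\<lambda>x. \<Sum>i\<in>I. F i x)"
  by (induction I rule: infinite_finite_induct) (auto simp: C1_const intro: C1_add)

lemma C1_power: "C1 F \<Longrightarrow> C1 (\<lambda>x. F x ^ n)"
  by (induction n) (auto simp: C1_const intro: C1_mult)

text \<open>The complement of the closed support is an open neighbourhood of \<open>x\<close> on
  which \<open>F\<close> agrees with 0.\<close>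

lemma classical_grad_outside_support:
  assumes "x \<notin> closure {x. F x \<noteq> 0}"
  shows "classical_grad F x = 0"
proof -
  have "GDERIV F x :> 0"
    unfolding gderiv_def
  proof (rule has_derivative_transform_within_open[where f="\<lambda>_. 0"])
    show "x \<in> - closure {x. F x \<noteq> 0}" using assms by auto
    show "\<And>y. y \<in> - closure {x. F x \<noteq> 0} \<Longrightarrow> 0 = F y" using closure_subset[of "{x. F x \<noteq> 0}"] by (metis (mono_tags, lifting) ComplD mem_Collect_eq subsetD)
  qed auto
  then show ?thesis by (rule classical_grad_eqI)
qed

section \<open>Integration of compactly supported functions\<close>

lemma compact_support_bounded:
  fixes f :: "'a::euclidean_space \<Rightarrow> 'b::real_normed_vector"
  assumes "continuous_on UNIV f" "compact S" "\<And>x. x \<notin> S \<Longrightarrow> f x = 0"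
  obtains B where "B > 0" "\<And>x. norm (f x) \<le> B"
proof -
  have "bounded (f ` S)"
    using assms by (meson compact_continuous_image compact_imp_bounded continuous_on_subset subset_UNIV)
  then obtain B where "B > 0" "\<And>x. x \<in> S \<Longrightarrow> norm (f x) \<le> B" by (auto simp: bounded_pos)
  then show ?thesis using that[of B] assms(3) by (metis less_imp_le norm_zero)
qed

lemma compact_support_integrable:
  fixes f :: "'a::euclidean_space \<Rightarrow> 'b::euclidean_space"
  assumes "continuous_on UNIV f" "compact S" "\<And>x. x \<notin> S \<Longrightarrow> f x = 0"
  shows "integrable lborel f"
proof -
  have "integrable lborel (\<lambda>x. indicator S x *\<^sub>R f x)"
    by (rule borel_integrable_compact) (auto intro: continuous_on_subset[OF assms(1)] assms(2))
  also have "(\<lambda>x. indicator S x *\<^sub>R f x) = f" using assms(3) by (auto simp: indicator_def fun_eq_iff)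
  finally show ?thesis .
qed

lemma lborel_integral_translate:
  fixes f :: "'a::euclidean_space \<Rightarrow> 'b::euclidean_space"
  assumes "f \<in> borel_measurable borel"
  shows "(\<integral>x. f (c + x) \<partial>lborel) = (\<integral>x. f x \<partial>lborel)"
proof -
  have "(\<integral>x. f x \<partial>lborel) = (\<integral>x. f x \<partial>(distr lborel borel ((+) c)))" by (simp add: lborel_distr_plus)
  also have "\<dots> = (\<integral>x. f (c + x) \<partial>lborel)" by (rule integral_distr) (use assms in auto)
  finally show ?thesis by simp
qed

lemma lborel_integrable_translate:
  fixes f :: "'a::euclidean_space \<Rightarrow> 'b::euclidean_space"
  assumes "f \<in> borel_measurable borel" "integrable lborel f"
  shows "integrable lborel (\<lambda>x. f (c + x))"
proof -
  have "integrable (distr lborel borel ((+) c)) f" using assms by (simp add: lborel_distr_plus)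
  then show ?thesis by (subst (asm) integrable_distr_eq) (use assms in auto)
qed

text \<open>Difference quotients integrate to zero by translation invariance.\<close>

lemma integral_classical_grad_zero:
  fixes F :: "'a::euclidean_space \<Rightarrow> real"
  assumes F: "C1 F" and S: "compact S" "\<And>x. x \<notin> S \<Longrightarrow> F x = 0"
  shows "(\<integral>x. classical_grad F x \<partial>lborel) = 0"
proof -
  have sub: "closure {x. F x \<noteq> 0} \<subseteq> S"
    using S by (intro closure_minimal) (auto simp: compact_imp_closed)
  have gS: "classical_grad F x = 0" if "x \<notin> S" for x
    using sub that classical_grad_outside_support by blast
  note cg = C1_continuous_grad[OF F] and cF = C1_continuous[OF F]
  obtain B where B: "B > 0" "\<And>x. norm (classical_grad F x) \<le> B"
    using compact_support_bounded[OF cg S(1) gS] by blast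
  obtain R where R: "R > 0" "S \<subseteq> cball 0 R"
    using compact_imp_bounded[OF S(1)] by (auto simp: bounded_pos subset_eq)
  have mF [measurable]: "F \<in> borel_measurable borel" using cF by (simp add: borel_measurable_continuous_onI)
  have mG [measurable]: "classical_grad F \<in> borel_measurable borel" using cg by (simp add: borel_measurable_continuous_onI)
  have iF: "integrable lborel F" using compact_support_integrable[OF cF S] .
  have iG: "integrable lborel (classical_grad F)" using compact_support_integrable[OF cg S(1) gS] .
  have "(\<integral>x. classical_grad F x \<partial>lborel) \<bullet> b = 0" if b: "b \<in> Basis" for b
  proof -
    define t where "t n = inverse (real (Suc n))" for n
    have t: "t n > 0" "t n \<le> 1" "t n \<noteq> 0" for n by (auto simp: t_def field_simps)
    define Q where "Q n x = (F (t n *\<^sub>R b + x) - F x) / t n" for n x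
    have Q0: "(\<integral>x. Q n x \<partial>lborel) = 0" for n
    proof -
      have "(\<integral>x. Q n x \<partial>lborel) = ((\<integral>x. F (t n *\<^sub>R b + x) \<partial>lborel) - (\<integral>x. F x \<partial>lborel)) / t n"
        unfolding Q_def by (simp add: iF lborel_integrable_translate)
      then show ?thesis by (simp add: lborel_integral_translate)
    qed
    have lim: "(\<lambda>n. Q n x) \<longlonglongrightarrow> classical_grad F x \<bullet> b" for x
    proof -
      have d: "(F has_derivative (\<lambda>h. h \<bullet> classical_grad F x)) (at x)"
        using C1_GDERIV[OF F] by (simp add: gderiv_def)
      have "((\<lambda>s. F (x + s *\<^sub>R b)) has_derivative (\<lambda>s. (s *\<^sub>R b) \<bullet> classical_grad F x)) (at 0)"
      proof (rule has_derivative_compose[where g=F])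
        show "((\<lambda>s. x + s *\<^sub>R b) has_derivative (\<lambda>s. s *\<^sub>R b)) (at 0)"
          using has_derivative_add[OF has_derivative_const[of x "at 0"] bounded_linear_imp_has_derivative[OF bounded_linear_scaleR_left[of b], of "at 0"]] by simp
      qed (use d in simp)
      then have "((\<lambda>s. F (x + s *\<^sub>R b)) has_real_derivative (classical_grad F x \<bullet> b)) (at 0)"
        unfolding has_field_derivative_def
        by (rule has_derivative_eq_rhs) (simp add: fun_eq_iff inner_commute[of b])
      then have "((\<lambda>s. (F (x + s *\<^sub>R b) - F x) / s) \<longlongrightarrow> classical_grad F x \<bullet> b) (at 0)"
        by (simp add: has_field_derivative_iff)
      moreover have "filterlim t (at 0) sequentially"
        unfolding t_def filterlim_at using LIMSEQ_inverse_real_of_nat by auto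
      ultimately have "(\<lambda>n. (F (x + t n *\<^sub>R b) - F x) / t n) \<longlonglongrightarrow> classical_grad F x \<bullet> b"
        by (rule filterlim_compose)
      then show ?thesis by (simp add: Q_def add.commute)
    qed
    have lip: "\<bar>F y - F x\<bar> \<le> B * norm (y - x)" for x y
    proof -
      have "norm (F y - F x) \<le> B * norm (y - x)"
      proof (rule differentiable_bound[where S=UNIV and f'="\<lambda>x h. h \<bullet> classical_grad F x"])
        show "(F has_derivative (\<lambda>h. h \<bullet> classical_grad F x)) (at x within UNIV)" for x
          using C1_GDERIV[OF F] by (simp add: gderiv_def)
        show "onorm (\<lambda>h. h \<bullet> classical_grad F x) \<le> B" for x
        proof (rule onorm_bound)
          fix h
          have "\<bar>h \<bullet> classical_grad F x\<bar> \<le> norm h * norm (classical_grad F x)"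
            by (rule Cauchy_Schwarz_ineq2)
          also have "\<dots> \<le> norm h * B" by (intro mult_left_mono B norm_ge_zero)
          finally show "norm (h \<bullet> classical_grad F x) \<le> B * norm h" by (simp add: mult.commute)
        qed (use B in simp)
      qed auto
      then show ?thesis by simp
    qed
    \<comment> \<open>The Lipschitz bound dominates the quotients by \<open>B\<close>; a shift of
      length at most 1 keeps their supports in the ball of radius \<open>R + 1\<close>.\<close>
    have bd: "norm (Q n x) \<le> B * indicator (cball 0 (R+1)) x" for n x
    proof (cases "x \<in> cball 0 (R+1)")
      case True
      have "\<bar>F (t n *\<^sub>R b + x) - F x\<bar> \<le> B * norm (t n *\<^sub>R b + x - x)" by (rule lip)
      also have "\<dots> = B * t n" using b t(1)[of n] by simp
      finally show ?thesis using True t(1)[of n] by (simp add: Q_def abs_divide divide_le_eq)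
    next
      case False
      have "norm x \<le> norm (t n *\<^sub>R b + x) + norm (t n *\<^sub>R b)"
        by (metis add_diff_cancel_left' norm_triangle_ineq4)
      then have "norm (t n *\<^sub>R b + x) > R" using False b t(1,2)[of n] by auto
      then have "t n *\<^sub>R b + x \<notin> S" "x \<notin> S" using False R by auto
      then show ?thesis using S B by (simp add: Q_def)
    qed
    have "(\<lambda>n. \<integral>x. Q n x \<partial>lborel) \<longlonglongrightarrow> (\<integral>x. classical_grad F x \<bullet> b \<partial>lborel)"
    proof (rule integral_dominated_convergence)
      show "integrable lborel (\<lambda>x::'a. B * indicat_real (cball 0 (R+1)) x)"
        using emeasure_bounded_finite[OF bounded_cball, of "0::'a" "R+1"]
        by (intro integrable_mult_right integrable_real_indicator) auto
      show "(\<lambda>x. classical_grad F x \<bullet> b) \<in> borel_measurable lborel" by simp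
      show "Q n \<in> borel_measurable lborel" for n unfolding Q_def[abs_def] by measurable
      show "AE x in lborel. (\<lambda>n. Q n x) \<longlonglongrightarrow> classical_grad F x \<bullet> b" using lim by (intro AE_I2)
      show "AE x in lborel. norm (Q n x) \<le> B * indicat_real (cball 0 (R + 1)) x" for n using bd by (intro AE_I2)
    qed
    then have "(\<integral>x. classical_grad F x \<bullet> b \<partial>lborel) = 0"
      using Q0 by (simp add: LIMSEQ_const_iff)
    then show ?thesis by (simp only: integral_inner_left[OF iG])
  qed
  then show ?thesis using euclidean_all_zero_iff by blast
qed

section \<open>Test functions and bump functions\<close>

lemma test_function_iff:
  "test_function D \<psi> \<longleftrightarrow> C1 \<psi> \<and> compact (closure {x. \<psi> x \<noteq> 0}) \<and> closure {x. \<psi> x \<noteq> 0} \<subseteq> D"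
  by (auto simp: test_function_def C1_def)

text \<open>Squaring removes the kink of the positive part: at 0 the difference quotient is at most
  \<open>\<bar>h\<bar>\<close>. This is the profile of the bump functions below, which have to be
  \<open>C1\<close>.\<close>

lemma DERIV_max_0_square: "((\<lambda>t. (max 0 t)\<^sup>2) has_real_derivative 2 * max 0 t) (at (t::real))"
proof -
  consider "t > 0" | "t < 0" | "t = 0" by linarith
  then show ?thesis
  proof cases
    case 1
    have "((\<lambda>t. t\<^sup>2) has_real_derivative 2 * t) (at t)"
      by (auto intro!: derivative_eq_intros)
    then have "((\<lambda>t. (max 0 t)\<^sup>2) has_real_derivative 2 * t) (at t)"
      by (rule has_field_derivative_transform_within_open[where S="{0<..}"]) (use 1 in auto)
    then show ?thesis using 1 by simp
  next
    case 2
    have "((\<lambda>t. 0) has_real_derivative 0) (at t)" by simp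
    then have "((\<lambda>t. (max 0 t)\<^sup>2) has_real_derivative 0) (at t)"
      by (rule has_field_derivative_transform_within_open[where S="{..<0}"]) (use 2 in auto)
    then show ?thesis using 2 by simp
  next
    case 3
    have "((\<lambda>h::real. (max 0 h)\<^sup>2 / h) \<longlongrightarrow> 0) (at 0)"
    proof (rule tendsto_rabs_zero_cancel, rule tendsto_sandwich[where f="\<lambda>_. 0" and h="\<lambda>h. \<bar>h\<bar>"])
      show "\<forall>\<^sub>F h::real in at 0. \<bar>(max 0 h)\<^sup>2 / h\<bar> \<le> \<bar>h\<bar>"
        by (intro always_eventually allI) (auto simp: max_def power2_eq_square)
      show "((\<lambda>h::real. \<bar>h\<bar>) \<longlongrightarrow> 0) (at 0)" by (rule tendsto_rabs_zero) simp
    qed auto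
    then show ?thesis using 3 by (simp add: has_field_derivative_iff)
  qed
qed

text \<open>Each coordinate contributes the squared positive parts of the signed distances to its
  two faces, so the product is positive exactly on the open box.\<close>

lemma C1_box_bump:
  fixes a b :: "'a::euclidean_space"
  obtains \<theta> where "C1 \<theta>" "\<And>x. \<theta> x \<ge> 0" "\<And>x. \<theta> x > 0 \<longleftrightarrow> x \<in> box a b"
proof -
  define \<theta> where "\<theta> x = (\<Prod>i\<in>Basis. (max 0 (x \<bullet> i + (- (a \<bullet> i))))\<^sup>2 * (max 0 (b \<bullet> i + (-1) * (x \<bullet> i)))\<^sup>2)" for x :: 'a
  have sq: "C1 (\<lambda>x. (max 0 (F x))\<^sup>2)" if "C1 F" for F :: "'a \<Rightarrow> real"
    by (rule C1_compose[OF that DERIV_max_0_square]) (intro continuous_intros)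
  have c: "C1 \<theta>" unfolding \<theta>_def[abs_def]
  proof (rule C1_prod[OF finite_Basis])
    fix i :: 'a
    have "C1 (\<lambda>x. x \<bullet> i + (- (a \<bullet> i)))" "C1 (\<lambda>x. b \<bullet> i + (-1) * (x \<bullet> i))"
      by (rule C1_add(1)[OF C1_inner(1) C1_const(1)] C1_add(1)[OF C1_const(1) C1_cmult(1)[OF C1_inner(1)]])+
    then show "C1 (\<lambda>x. (max 0 (x \<bullet> i + (- (a \<bullet> i))))\<^sup>2 * (max 0 (b \<bullet> i + (-1) * (x \<bullet> i)))\<^sup>2)"
      by (intro C1_mult(1) sq)
  qed
  have nn: "\<theta> x \<ge> 0" for x unfolding \<theta>_def by (rule prod_nonneg) simp
  have pos: "\<theta> x > 0 \<longleftrightarrow> x \<in> box a b" for x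
  proof
    assume p: "\<theta> x > 0"
    have ne: "(max 0 (x \<bullet> i + (- (a \<bullet> i))))\<^sup>2 * (max 0 (b \<bullet> i + (-1) * (x \<bullet> i)))\<^sup>2 \<noteq> 0" if "i \<in> Basis" for i
    proof
      assume "(max 0 (x \<bullet> i + (- (a \<bullet> i))))\<^sup>2 * (max 0 (b \<bullet> i + (-1) * (x \<bullet> i)))\<^sup>2 = 0"
      then have "\<theta> x = 0" unfolding \<theta>_def using that by (intro prod_zero[OF finite_Basis] bexI)
      then show False using p by simp
    qed
    show "x \<in> box a b" unfolding mem_box
    proof
      fix i :: 'a assume "i \<in> Basis"
      with ne have "(max 0 (x \<bullet> i + (- (a \<bullet> i))))\<^sup>2 * (max 0 (b \<bullet> i + (-1) * (x \<bullet> i)))\<^sup>2 \<noteq> 0" by blast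
      then have "max 0 (x \<bullet> i + (- (a \<bullet> i))) \<noteq> 0" "max 0 (b \<bullet> i + (-1) * (x \<bullet> i)) \<noteq> 0"
        by (metis mult_eq_0_iff power_zero_numeral)+
      then show "a \<bullet> i < x \<bullet> i \<and> x \<bullet> i < b \<bullet> i" by (auto simp: max_def split: if_splits)
    qed
  next
    assume x: "x \<in> box a b"
    show "\<theta> x > 0" unfolding \<theta>_def
    proof (rule prod_pos)
      fix i :: 'a assume "i \<in> Basis"
      then have "a \<bullet> i < x \<bullet> i" "x \<bullet> i < b \<bullet> i" using x by (auto simp: mem_box)
      then have "max 0 (x \<bullet> i + (- (a \<bullet> i))) > 0" "max 0 (b \<bullet> i + (-1) * (x \<bullet> i)) > 0" by (simp_all add: max_def)
      then show "0 < (max 0 (x \<bullet> i + (- (a \<bullet> i))))\<^sup>2 * (max 0 (b \<bullet> i + (-1) * (x \<bullet> i)))\<^sup>2"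
        by (intro mult_pos_pos zero_less_power)
    qed
  qed
  show ?thesis by (rule that[OF c nn pos])
qed

section \<open>Square-integrable functions\<close>

lemma square_integrable_onD:
  assumes "square_integrable_on D u"
  shows "u \<in> borel_measurable (lebesgue_on D)" "integrable (lebesgue_on D) (\<lambda>x. (norm (u x))\<^sup>2)"
  using assms by (auto simp: square_integrable_on_def)

lemma square_integrable_on_add:
  assumes "square_integrable_on D u" "square_integrable_on D v"
  shows "square_integrable_on D (\<lambda>x. u x + v x)"
proof -
  note [measurable] = square_integrable_onD(1)[OF assms(1)] square_integrable_onD(1)[OF assms(2)]
  have "integrable (lebesgue_on D) (\<lambda>x. (norm (u x + v x))\<^sup>2)"
  proof (rule Bochner_Integration.integrable_bound)
    show "integrable (lebesgue_on D) (\<lambda>x. 2 * (norm (u x))\<^sup>2 + 2 * (norm (v x))\<^sup>2)"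
      by (intro Bochner_Integration.integrable_add integrable_mult_right square_integrable_onD assms)
    have "(norm (u x + v x))\<^sup>2 \<le> 2 * (norm (u x))\<^sup>2 + 2 * (norm (v x))\<^sup>2" for x
    proof -
      have "(norm (u x + v x))\<^sup>2 \<le> (norm (u x) + norm (v x))\<^sup>2"
        by (intro power_mono norm_triangle_ineq) auto
      also have "\<dots> \<le> 2 * (norm (u x))\<^sup>2 + 2 * (norm (v x))\<^sup>2"
        using zero_le_power2[of "norm (u x) - norm (v x)"] by (simp add: power2_eq_square algebra_simps)
      finally show ?thesis .
    qed
    then show "AE x in lebesgue_on D. norm ((norm (u x + v x))\<^sup>2) \<le> norm (2 * (norm (u x))\<^sup>2 + 2 * (norm (v x))\<^sup>2)"
      by (intro AE_I2) (auto intro: order_trans)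
  qed measurable
  then show ?thesis by (simp add: square_integrable_on_def)
qed

lemma square_integrable_on_scaleR:
  assumes "square_integrable_on D u"
  shows "square_integrable_on D (\<lambda>x. c *\<^sub>R u x)"
  using square_integrable_onD[OF assms] by (auto simp: square_integrable_on_def power_mult_distrib)

text \<open>Up to the factor \<open>\<bar>H\<bar>\<close> the integrand is dominated by the sum of
  the two squared norms.\<close>

lemma square_integrable_on_weighted_inner:
  assumes u: "square_integrable_on D u" and v: "square_integrable_on D v"
    and h: "h \<in> borel_measurable (lebesgue_on D)" "\<And>x. x \<in> D \<Longrightarrow> \<bar>h x\<bar> \<le> H"
  shows "integrable (lebesgue_on D) (\<lambda>x. h x * (u x \<bullet> v x))"
proof (rule Bochner_Integration.integrable_bound)
  note [measurable] = square_integrable_onD(1)[OF u] square_integrable_onD(1)[OF v] h(1)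
  show "(\<lambda>x. h x * (u x \<bullet> v x)) \<in> borel_measurable (lebesgue_on D)" by measurable
  show "integrable (lebesgue_on D) (\<lambda>x. \<bar>H\<bar> * ((norm (u x))\<^sup>2 + (norm (v x))\<^sup>2))"
    by (intro Bochner_Integration.integrable_add integrable_mult_right square_integrable_onD assms)
  show "AE x in lebesgue_on D. norm (h x * (u x \<bullet> v x)) \<le> norm (\<bar>H\<bar> * ((norm (u x))\<^sup>2 + (norm (v x))\<^sup>2))"
  proof (rule AE_I2)
    fix x assume "x \<in> space (lebesgue_on D)"
    then have "x \<in> D" by simp
    have "\<bar>u x \<bullet> v x\<bar> \<le> norm (u x) * norm (v x)" by (rule Cauchy_Schwarz_ineq2)
    also have "\<dots> \<le> (norm (u x))\<^sup>2 + (norm (v x))\<^sup>2"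
      using zero_le_power2[of "norm (u x) - norm (v x)"] zero_le_power2[of "norm (u x)"] zero_le_power2[of "norm (v x)"]
      unfolding power2_diff by linarith
    finally have "\<bar>h x\<bar> * \<bar>u x \<bullet> v x\<bar> \<le> \<bar>H\<bar> * ((norm (u x))\<^sup>2 + (norm (v x))\<^sup>2)"
      using h(2)[OF \<open>x \<in> D\<close>] by (intro mult_mono) auto
    then show "norm (h x * (u x \<bullet> v x)) \<le> norm (\<bar>H\<bar> * ((norm (u x))\<^sup>2 + (norm (v x))\<^sup>2))"
      by (simp add: abs_mult)
  qed
qed

lemma square_integrable_on_inner:
  assumes "square_integrable_on D u" "square_integrable_on D v"
  shows "integrable (lebesgue_on D) (\<lambda>x. u x \<bullet> v x)"
  using square_integrable_on_weighted_inner[OF assms, of "\<lambda>_. 1" 1] by simp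

section \<open>Integration over a bounded open domain\<close>

locale bounded_domain =
  fixes D :: "'a::euclidean_space set"
  assumes open_D: "open D" and bounded_D: "bounded D"
begin

lemma D_lebesgue: "D \<in> sets lebesgue"
  using open_D borel_open sets_completionI_sets by (metis sets_lborel)

lemma D_lmeasurable: "D \<in> lmeasurable"
  using bounded_D open_D lmeasurable_open by blast

lemma finite_measure_D: "finite_measure (lebesgue_on D)"
  by (rule finite_measure_lebesgue_on[OF D_lmeasurable])

lemma integrable_const_D: "integrable (lebesgue_on D) (\<lambda>x. c)" for c :: "'b::{banach,second_countable_topology}"
  using finite_measure.integrable_const[OF finite_measure_D] .

lemma AE_D_iff: "(AE x in lebesgue_on D. Q x) \<longleftrightarrow> (AE x in lebesgue. x \<in> D \<longrightarrow> Q x)"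
  by (rule AE_restrict_space_iff) (simp add: D_lebesgue)

text \<open>Lebesgue measure is complete, so a change on a null set keeps measurability. This is
  needed for \<open>Var_grad\<close>, whose formula is known only off the element
  boundaries.\<close>

lemma measurable_AE_eq:
  fixes f g :: "'a \<Rightarrow> 'b::euclidean_space"
  assumes f: "f \<in> borel_measurable (lebesgue_on D)" and ae: "AE x in lebesgue_on D. f x = g x"
  shows "g \<in> borel_measurable (lebesgue_on D)"
proof -
  have "(\<lambda>x. indicat_real D x *\<^sub>R f x) \<in> borel_measurable lebesgue"
    using f by (subst (asm) borel_measurable_restrict_space_iff) (simp_all add: D_lebesgue)
  moreover have "AE x in lebesgue. indicat_real D x *\<^sub>R f x = indicat_real D x *\<^sub>R g x"
    using ae unfolding AE_D_iff by eventually_elim (auto simp: indicator_def)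
  ultimately have "(\<lambda>x. indicat_real D x *\<^sub>R g x) \<in> borel_measurable lebesgue"
    by (rule borel_measurable_AE)
  then show ?thesis by (subst borel_measurable_restrict_space_iff) (simp_all add: D_lebesgue)
qed

lemma square_integrable_AE_eq:
  fixes f g :: "'a \<Rightarrow> 'b::euclidean_space"
  assumes f: "square_integrable_on D f" and ae: "AE x in lebesgue_on D. f x = g x"
  shows "square_integrable_on D g"
proof -
  have m: "g \<in> borel_measurable (lebesgue_on D)"
    using measurable_AE_eq square_integrable_onD(1)[OF f] ae by blast
  moreover have "integrable (lebesgue_on D) (\<lambda>x. (norm (g x))\<^sup>2)"
  proof (rule integrable_cong_AE_imp[OF square_integrable_onD(2)[OF f]])
    show "(\<lambda>x. (norm (g x))\<^sup>2) \<in> borel_measurable (lebesgue_on D)" using m by measurable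
    show "AE x in lebesgue_on D. (norm (f x))\<^sup>2 = (norm (g x))\<^sup>2"
      using ae by eventually_elim simp
  qed
  ultimately show ?thesis by (simp add: square_integrable_on_def)
qed

lemma square_integrable_on_bounded:
  fixes f :: "'a \<Rightarrow> 'b::euclidean_space"
  assumes f: "f \<in> borel_measurable (lebesgue_on D)" and B: "\<And>x. x \<in> D \<Longrightarrow> norm (f x) \<le> B"
  shows "square_integrable_on D f"
proof -
  have "integrable (lebesgue_on D) (\<lambda>x. (norm (f x))\<^sup>2)"
  proof (rule Bochner_Integration.integrable_bound[OF integrable_const_D[of "B\<^sup>2"]])
    show "(\<lambda>x. (norm (f x))\<^sup>2) \<in> borel_measurable (lebesgue_on D)" using f by measurable
    show "AE x in lebesgue_on D. norm ((norm (f x))\<^sup>2) \<le> norm (B\<^sup>2)"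
      by (rule AE_I2) (auto intro!: power_mono B)
  qed
  with f show ?thesis by (simp add: square_integrable_on_def)
qed

text \<open>The domain has finite measure, and \<open>t \<le> 1 + t\<^sup>2\<close>.\<close>

lemma square_integrable_on_integrable:
  fixes f :: "'a \<Rightarrow> 'b::euclidean_space"
  assumes f: "square_integrable_on D f"
  shows "integrable (lebesgue_on D) f"
proof (rule Bochner_Integration.integrable_bound)
  show "integrable (lebesgue_on D) (\<lambda>x. 1 + (norm (f x))\<^sup>2)"
    by (intro Bochner_Integration.integrable_add integrable_const_D square_integrable_onD f)
  show "f \<in> borel_measurable (lebesgue_on D)" using square_integrable_onD f by blast
  have "t \<le> 1 + t\<^sup>2" for t :: real
    using zero_le_power2[of "t - 1/2"] unfolding power2_diff by (simp add: field_simps)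
  then show "AE x in lebesgue_on D. norm (f x) \<le> norm (1 + (norm (f x))\<^sup>2)"
    by (intro AE_I2) (auto intro: order_trans)
qed

text \<open>The bridge from \<open>lebesgue_on D\<close>, in which weak gradients are defined, to
  \<open>lborel\<close>, where translation invariance is available; nothing is lost because
  \<open>f\<close> vanishes off \<open>D\<close>.\<close>

lemma lebesgue_on_eq_lborel:
  fixes f :: "'a \<Rightarrow> 'b::euclidean_space"
  assumes f: "f \<in> borel_measurable borel" and zero: "\<And>x. x \<notin> D \<Longrightarrow> f x = 0"
  shows "(\<integral>x. f x \<partial>lebesgue_on D) = (\<integral>x. f x \<partial>lborel)"
    "integrable (lebesgue_on D) f \<longleftrightarrow> integrable lborel f"
proof -
  have eq: "(\<lambda>x. indicat_real D x *\<^sub>R f x) = f" using zero by (auto simp: indicator_def)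
  show "(\<integral>x. f x \<partial>lebesgue_on D) = (\<integral>x. f x \<partial>lborel)"
    by (subst integral_restrict_space) (use f in \<open>auto simp: eq D_lebesgue integral_completion\<close>)
  show "integrable (lebesgue_on D) f \<longleftrightarrow> integrable lborel f"
    by (subst integrable_restrict_space) (use f in \<open>auto simp: eq D_lebesgue integrable_completion\<close>)
qed

section \<open>Test functions on the domain and the fundamental lemma\<close>

lemma test_functionD:
  assumes "test_function D \<psi>"
  shows "C1 \<psi>" "compact (closure {x. \<psi> x \<noteq> 0})" "closure {x. \<psi> x \<noteq> 0} \<subseteq> D"
    "x \<notin> D \<Longrightarrow> \<psi> x = 0" "x \<notin> D \<Longrightarrow> classical_grad \<psi> x = 0"
    "x \<notin> closure {x. \<psi> x \<noteq> 0} \<Longrightarrow> \<psi> x = 0"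
    "\<psi> \<in> borel_measurable borel" "classical_grad \<psi> \<in> borel_measurable borel"
proof -
  show *: "C1 \<psi>" "compact (closure {x. \<psi> x \<noteq> 0})" "closure {x. \<psi> x \<noteq> 0} \<subseteq> D"
    using assms by (auto simp: test_function_iff)
  show "x \<notin> closure {x. \<psi> x \<noteq> 0} \<Longrightarrow> \<psi> x = 0" using closure_subset[of "{x. \<psi> x \<noteq> 0}"] by blast
  then show "x \<notin> D \<Longrightarrow> \<psi> x = 0" using * by blast
  show "x \<notin> D \<Longrightarrow> classical_grad \<psi> x = 0" using * classical_grad_outside_support by blast
  show "\<psi> \<in> borel_measurable borel" "classical_grad \<psi> \<in> borel_measurable borel"
    using C1_continuous[OF *(1)] C1_continuous_grad[OF *(1)] by (auto simp: borel_measurable_continuous_onI)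
qed

lemma borel_imp_lebesgue_on: "f \<in> borel_measurable borel \<Longrightarrow> f \<in> borel_measurable (lebesgue_on D)"
  by (intro measurable_restrict_space1) (simp add: measurable_completion)

lemma test_function_bounds:
  assumes "test_function D \<psi>"
  obtains B where "B > 0" "\<And>x. \<bar>\<psi> x\<bar> \<le> B" "\<And>x. norm (classical_grad \<psi> x) \<le> B"
proof -
  note t = test_functionD[OF assms]
  obtain B1 where B1: "B1 > 0" "\<And>x. norm (\<psi> x) \<le> B1"
    using compact_support_bounded[OF C1_continuous[OF t(1)] t(2) t(6)] by blast
  obtain B2 where B2: "B2 > 0" "\<And>x. norm (classical_grad \<psi> x) \<le> B2"
    using compact_support_bounded[OF C1_continuous_grad[OF t(1)] t(2) classical_grad_outside_support] by blast
  show ?thesis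
    by (rule that[of "max B1 B2"]) (use B1 B2 in \<open>auto simp: le_max_iff_disj\<close>)
qed

lemma test_function_square_integrable:
  assumes "test_function D \<psi>"
  shows "square_integrable_on D \<psi>" "square_integrable_on D (classical_grad \<psi>)"
proof -
  obtain B where B: "B > 0" "\<And>x. \<bar>\<psi> x\<bar> \<le> B" "\<And>x. norm (classical_grad \<psi> x) \<le> B"
    using test_function_bounds[OF assms] by blast
  show "square_integrable_on D \<psi>" "square_integrable_on D (classical_grad \<psi>)"
    using B test_functionD(7,8)[OF assms] by (auto intro!: square_integrable_on_bounded[of _ B] borel_imp_lebesgue_on)
qed

lemma integrable_test_scaleR:
  fixes g :: "'a \<Rightarrow> 'b::euclidean_space"
  assumes "test_function D \<psi>" "integrable (lebesgue_on D) g"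
  shows "integrable (lebesgue_on D) (\<lambda>x. \<psi> x *\<^sub>R g x)"
proof -
  obtain B where B: "B > 0" "\<And>x. \<bar>\<psi> x\<bar> \<le> B" using test_function_bounds[OF assms(1)] by blast
  show ?thesis
  proof (rule Bochner_Integration.integrable_bound)
    show "integrable (lebesgue_on D) (\<lambda>x. B *\<^sub>R g x)" using assms by simp
    show "(\<lambda>x. \<psi> x *\<^sub>R g x) \<in> borel_measurable (lebesgue_on D)"
      using borel_imp_lebesgue_on[OF test_functionD(7)[OF assms(1)]] assms(2) by (intro borel_measurable_scaleR) auto
    show "AE x in lebesgue_on D. norm (\<psi> x *\<^sub>R g x) \<le> norm (B *\<^sub>R g x)"
      using B by (intro AE_I2) (auto intro!: mult_right_mono)
  qed
qed

lemma integrable_scaleR_test_grad: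
  assumes "test_function D \<psi>" "integrable (lebesgue_on D) u"
  shows "integrable (lebesgue_on D) (\<lambda>x. u x *\<^sub>R classical_grad \<psi> x)"
proof -
  obtain B where B: "B > 0" "\<And>x. norm (classical_grad \<psi> x) \<le> B" using test_function_bounds[OF assms(1)] by blast
  show ?thesis
  proof (rule Bochner_Integration.integrable_bound)
    show "integrable (lebesgue_on D) (\<lambda>x. B *\<^sub>R u x)" using assms by simp
    show "(\<lambda>x. u x *\<^sub>R classical_grad \<psi> x) \<in> borel_measurable (lebesgue_on D)"
      using borel_imp_lebesgue_on[OF test_functionD(8)[OF assms(1)]] assms(2) by (intro borel_measurable_scaleR) auto
    show "AE x in lebesgue_on D. norm (u x *\<^sub>R classical_grad \<psi> x) \<le> norm (B *\<^sub>R u x)"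
      using B by (intro AE_I2) (auto intro!: mult_left_mono simp: abs_mult mult.commute[of B])
  qed
qed

text \<open>Smoothed indicators show that \<open>g\<close> has integral zero over every box inside
  \<open>U\<close>; Lebesgue differentiation then gives \<open>g = 0\<close> off a null set. The
  open set \<open>U\<close> is a parameter because the lemma is used on single mesh elements, and
  the exceptional set is explicit so that finitely many of them can be united.\<close>

lemma fundamental_lemma:
  fixes g :: "'a \<Rightarrow> 'a"
  assumes g: "integrable (lebesgue_on D) g"
    and U: "open U" "U \<subseteq> D"
    and zero: "\<And>\<psi>. test_function D \<psi> \<Longrightarrow> closure {x. \<psi> x \<noteq> 0} \<subseteq> U \<Longrightarrow> (\<integral>x. \<psi> x *\<^sub>R g x \<partial>lebesgue_on D) = 0"
  obtains N where "negligible N" "\<And>x. x \<in> U - N \<Longrightarrow> g x = 0"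
proof -
  define h where "h x = indicat_real D x *\<^sub>R g x" for x
  have h: "integrable lebesgue h"
    using g unfolding h_def by (subst (asm) integrable_restrict_space) (simp_all add: D_lebesgue)
  have ai: "set_integrable lebesgue S h" if "S \<in> sets lebesgue" for S
    unfolding set_integrable_def using h that by (rule integrable_mult_indicator[rotated])
  have box0: "integral (cbox a b) h = 0" if ab: "cbox a b \<subseteq> U" for a b
  proof -
    obtain \<theta> :: "'a \<Rightarrow> real" where \<theta>: "C1 \<theta>" "\<And>x. \<theta> x \<ge> 0" "\<And>x. \<theta> x > 0 \<longleftrightarrow> x \<in> box a b"
      using C1_box_bump by blast
    define \<epsilon> where "\<epsilon> n = inverse (real (Suc n))" for n
    have \<epsilon>: "\<epsilon> n > 0" for n by (simp add: \<epsilon>_def)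
    \<comment> \<open>The quotient tends to 1 where \<open>\<theta> x > 0\<close> and is 0
      elsewhere, so it converges to the indicator of the open box; its support is that of
      \<theta>.\<close>
    define \<psi> where "\<psi> n x = \<theta> x / (\<theta> x + \<epsilon> n)" for n x
    have nz: "\<theta> x + \<epsilon> n > 0" for n x using \<theta>(2)[of x] \<epsilon>[of n] by linarith
    have test: "test_function D (\<psi> n)" and supp: "closure {x. \<psi> n x \<noteq> 0} \<subseteq> U" for n
    proof -
      have "closure {x. \<psi> n x \<noteq> 0} \<subseteq> cbox a b"
      proof (rule closure_minimal)
        show "{x. \<psi> n x \<noteq> 0} \<subseteq> cbox a b"
        proof safe
          fix x assume "\<psi> n x \<noteq> 0"
          then have "\<theta> x \<noteq> 0" by (auto simp: \<psi>_def)
          then have "\<theta> x > 0" using \<theta>(2)[of x] by simp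
          then show "x \<in> cbox a b" using \<theta>(3) box_subset_cbox by blast
        qed
      qed (rule closed_cbox)
      moreover from this have "compact (closure {x. \<psi> n x \<noteq> 0})"
        by (meson bounded_cbox bounded_subset closed_closure compact_eq_bounded_closed)
      moreover have "C1 (\<psi> n)"
      proof -
        have "C1 (\<lambda>x. (\<lambda>t. t / (t + \<epsilon> n)) (\<theta> x))"
        proof (rule C1_compose[OF \<theta>(1), where h'="\<lambda>t. \<epsilon> n / (t + \<epsilon> n)\<^sup>2"])
          show "((\<lambda>t. t / (t + \<epsilon> n)) has_real_derivative \<epsilon> n / (\<theta> x + \<epsilon> n)\<^sup>2) (at (\<theta> x))" for x
            using nz[of x n] by (auto intro!: derivative_eq_intros simp: power2_eq_square)
          show "continuous_on (range \<theta>) (\<lambda>t. \<epsilon> n / (t + \<epsilon> n)\<^sup>2)"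
            using nz by (intro continuous_intros) (auto simp: less_le)
        qed
        then show ?thesis by (simp add: \<psi>_def[abs_def])
      qed
      ultimately show "test_function D (\<psi> n)" "closure {x. \<psi> n x \<noteq> 0} \<subseteq> U"
        using ab U by (auto simp: test_function_iff)
    qed
    have lim: "(\<lambda>n. \<psi> n x) \<longlonglongrightarrow> indicat_real (box a b) x" for x
    proof (cases "x \<in> box a b")
      case True
      then have "\<theta> x > 0" using \<theta> by auto
      then have "(\<lambda>n. \<theta> x / (\<theta> x + \<epsilon> n)) \<longlonglongrightarrow> \<theta> x / (\<theta> x + 0)"
        unfolding \<epsilon>_def by (intro tendsto_intros LIMSEQ_inverse_real_of_nat) auto
      with True \<open>\<theta> x > 0\<close> show ?thesis by (simp add: \<psi>_def)
    next
      case False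
      then have "\<theta> x = 0" using \<theta>(2,3)[of x] by (simp add: less_le)
      then show ?thesis using False by (simp add: \<psi>_def)
    qed
    have bd: "\<bar>\<psi> n x\<bar> \<le> 1" for n x
    proof -
      have "0 \<le> \<psi> n x" "\<psi> n x \<le> 1"
        using \<theta>(2)[of x] \<epsilon>[of n] nz[of x n] by (simp_all add: \<psi>_def)
      then show ?thesis by simp
    qed
    have "(\<lambda>n. \<integral>x. \<psi> n x *\<^sub>R g x \<partial>lebesgue_on D) \<longlonglongrightarrow> (\<integral>x. indicat_real (box a b) x *\<^sub>R g x \<partial>lebesgue_on D)"
    proof (rule integral_dominated_convergence)
      show "integrable (lebesgue_on D) (\<lambda>x. norm (g x))" using g by simp
      show "(\<lambda>x. indicat_real (box a b) x *\<^sub>R g x) \<in> borel_measurable (lebesgue_on D)"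
        by (intro borel_measurable_scaleR borel_imp_lebesgue_on borel_measurable_integrable[OF g]) simp
      show "(\<lambda>x. \<psi> n x *\<^sub>R g x) \<in> borel_measurable (lebesgue_on D)" for n
        using integrable_test_scaleR[OF test g] by auto
      show "AE x in lebesgue_on D. (\<lambda>n. \<psi> n x *\<^sub>R g x) \<longlonglongrightarrow> indicat_real (box a b) x *\<^sub>R g x"
        using lim by (intro AE_I2 tendsto_scaleR tendsto_const)
      show "AE x in lebesgue_on D. norm (\<psi> n x *\<^sub>R g x) \<le> norm (g x)" for n
        using bd by (intro AE_I2) (auto intro: mult_left_le_one_le)
    qed
    then have "(\<integral>x. indicat_real (box a b) x *\<^sub>R g x \<partial>lebesgue_on D) = 0"
      using zero[OF test supp] by (simp add: LIMSEQ_const_iff)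
    then have "(\<integral>x. indicat_real (box a b) x *\<^sub>R h x \<partial>lebesgue) = 0"
      by (subst (asm) integral_restrict_space) (simp_all add: D_lebesgue h_def mult.commute)
    then have "integral (box a b) h = 0"
      using set_lebesgue_integral_eq_integral(2)[OF ai[of "box a b"]] by (simp add: set_lebesgue_integral_def)
    then show ?thesis by (simp add: integral_open_interval)
  qed
  have "h integrable_on cbox a b" for a b
    using ai[of "cbox a b"] set_lebesgue_integral_eq_integral(1) by auto
  \<comment> \<open>Lebesgue differentiation over cubes with lower corner \<open>x\<close>.\<close>
  then obtain N where N: "negligible N" "\<And>x e. \<lbrakk>x \<notin> N; 0 < e\<rbrakk> \<Longrightarrow>
      \<exists>d>0. \<forall>t. 0 < t \<and> t < d \<longrightarrow> norm (integral (cbox x (x + t *\<^sub>R One)) h /\<^sub>R t ^ DIM('a) - h x) < e"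
    using integrable_ccontinuous_explicit[of h] by blast
  show ?thesis
  proof (rule that[OF N(1)])
    fix x assume x: "x \<in> U - N"
    obtain r where r: "r > 0" "cball x r \<subseteq> U" using x U(1) open_contains_cball by blast
    have "norm (h x) < e" if e: "e > 0" for e
    proof -
      obtain d where d: "d > 0" "\<And>t. 0 < t \<Longrightarrow> t < d \<Longrightarrow> norm (integral (cbox x (x + t *\<^sub>R One)) h /\<^sub>R t ^ DIM('a) - h x) < e"
        using N(2)[of x e] x e by blast
      \<comment> \<open>The bound \<open>t * DIM('a) \<le> r\<close> puts the cube of side
        \<open>t\<close> into the ball of radius \<open>r\<close>, the norm being at most the sum of
        the coordinates; halving \<open>d\<close> keeps \<open>t < d\<close> strict.\<close>
      define t where "t = min (d/2) (r / DIM('a))"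
      have t: "0 < t" "t < d" "t * DIM('a) \<le> r" using d r by (auto simp: t_def min_def field_simps)
      have "cbox x (x + t *\<^sub>R One) \<subseteq> cball x r"
      proof
        fix y assume y: "y \<in> cbox x (x + t *\<^sub>R One)"
        have "norm (y - x) \<le> (\<Sum>i\<in>Basis. \<bar>(y - x) \<bullet> i\<bar>)" by (rule norm_le_l1)
        also have "\<dots> \<le> (\<Sum>i\<in>(Basis::'a set). t)"
          using y by (intro sum_mono) (auto simp: mem_box algebra_simps inner_diff_left)
        also have "\<dots> \<le> r" using t by (simp add: mult.commute)
        finally show "y \<in> cball x r" by (simp add: dist_norm norm_minus_commute)
      qed
      then have "integral (cbox x (x + t *\<^sub>R One)) h = 0" using box0 r by blast
      then show ?thesis using d(2)[OF t(1,2)] by simp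
    qed
    then have "h x = 0" by (metis less_irrefl norm_eq_zero norm_ge_zero order_less_le)
    then show "g x = 0" using x U by (auto simp: h_def)
  qed
qed

end

section \<open>Weak gradients and the Poincare inequality\<close>

lemma integral_scaleR_lincomb:
  fixes f g :: "'b \<Rightarrow> 'c::{banach, second_countable_topology}"
  assumes "integrable M f" "integrable M g"
  shows "(\<integral>x. a *\<^sub>R f x + c *\<^sub>R g x \<partial>M) = a *\<^sub>R (\<integral>x. f x \<partial>M) + c *\<^sub>R (\<integral>x. g x \<partial>M)"
  using assms by simp

context bounded_domain
begin

text \<open>Testing the vanishing integral of the gradient of \<open>(x \<bullet> b) \<psi>\<^sup>2\<close> in direction \<open>b\<close> bounds
  \<open>\<integral>\<psi>\<^sup>2\<close> by \<open>- 2 \<integral>(x \<bullet> b) \<psi> (\<nabla>\<psi> \<bullet> b)\<close>.\<close>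

lemma poincare_test_function:
  assumes \<psi>: "test_function D \<psi>" and R: "D \<subseteq> cball 0 R" "R > 0"
  shows "(\<integral>x. (\<psi> x)\<^sup>2 \<partial>lebesgue_on D) \<le> 4 * R\<^sup>2 * (\<integral>x. (norm (classical_grad \<psi> x))\<^sup>2 \<partial>lebesgue_on D)"
proof -
  note t = test_functionD[OF \<psi>]
  obtain b :: 'a where b: "b \<in> Basis" using nonempty_Basis by blast
  define F where "F x = (x \<bullet> b) * (\<psi> x * \<psi> x)" for x
  have CF: "C1 F" unfolding F_def[abs_def] by (intro C1_mult(1) C1_inner(1) t)
  have gF: "classical_grad F x = (x \<bullet> b) *\<^sub>R (\<psi> x *\<^sub>R classical_grad \<psi> x + \<psi> x *\<^sub>R classical_grad \<psi> x) + (\<psi> x * \<psi> x) *\<^sub>R b" for x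
    unfolding F_def[abs_def] by (simp only: C1_mult(2)[OF C1_inner(1) C1_mult(1)[OF t(1) t(1)]] C1_mult(2)[OF t(1) t(1)] C1_inner(2))
  have F0: "F x = 0" if "x \<notin> closure {x. \<psi> x \<noteq> 0}" for x using t(6)[OF that] by (simp add: F_def)
  have "(\<integral>x. classical_grad F x \<partial>lborel) = 0"
    by (rule integral_classical_grad_zero[OF CF t(2) F0])
  moreover have mF: "classical_grad F \<in> borel_measurable borel"
    using C1_continuous_grad[OF CF] by (simp add: borel_measurable_continuous_onI)
  moreover have zF: "classical_grad F x = 0" if "x \<notin> D" for x using t(4,5)[OF that] by (simp add: gF)
  ultimately have z: "(\<integral>x. classical_grad F x \<partial>lebesgue_on D) = 0"
    using lebesgue_on_eq_lborel(1)[OF mF] by simp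
  have "closure {x. F x \<noteq> 0} \<subseteq> closure {x. \<psi> x \<noteq> 0}"
    by (intro closure_mono) (auto simp: F_def)
  then have F0': "classical_grad F x = 0" if "x \<notin> closure {x. \<psi> x \<noteq> 0}" for x
    using classical_grad_outside_support that by blast
  have iF: "integrable (lebesgue_on D) (classical_grad F)"
    using compact_support_integrable[OF C1_continuous_grad[OF CF] t(2) F0'] lebesgue_on_eq_lborel(2)[OF mF] zF by blast
  note sq = test_function_square_integrable[OF \<psi>]
  have i1: "integrable (lebesgue_on D) (\<lambda>x. (\<psi> x)\<^sup>2)" using square_integrable_onD(2)[OF sq(1)] by simp
  note i2 = square_integrable_onD(2)[OF sq(2)]
  \<comment> \<open>Young's inequality with \<open>\<bar>x \<bullet> b\<bar> \<le> R\<close> absorbs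
    half of \<open>(\<psi> x)\<^sup>2\<close>; the other half against \<open>2 * R\<^sup>2\<close>
    gives the constant \<open>4 * R\<^sup>2\<close>.\<close>
  have "(\<integral>x. (1/2) * (\<psi> x)\<^sup>2 - 2 * R\<^sup>2 * (norm (classical_grad \<psi> x))\<^sup>2 \<partial>lebesgue_on D) \<le> (\<integral>x. classical_grad F x \<bullet> b \<partial>lebesgue_on D)"
  proof (rule integral_mono)
    show "integrable (lebesgue_on D) (\<lambda>x. (1/2) * (\<psi> x)\<^sup>2 - 2 * R\<^sup>2 * (norm (classical_grad \<psi> x))\<^sup>2)"
      by (intro Bochner_Integration.integrable_diff integrable_mult_right i1 i2)
    show "integrable (lebesgue_on D) (\<lambda>x. classical_grad F x \<bullet> b)" using iF by simp
    fix x assume "x \<in> space (lebesgue_on D)"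
    then have "norm x \<le> R" using R by auto
    then have xb: "\<bar>x \<bullet> b\<bar> \<le> R" using Basis_le_norm[OF b, of x] by linarith
    have gb: "\<bar>classical_grad \<psi> x \<bullet> b\<bar> \<le> norm (classical_grad \<psi> x)" using Basis_le_norm[OF b] by blast
    define A B where "A = \<bar>\<psi> x\<bar>" and "B = norm (classical_grad \<psi> x)"
    have "\<bar>(x \<bullet> b) * (\<psi> x * (classical_grad \<psi> x \<bullet> b))\<bar> \<le> R * (A * B)"
      unfolding abs_mult A_def B_def using xb gb by (intro mult_mono) auto
    moreover have "2 * (R * (A * B)) \<le> (1/2) * A\<^sup>2 + 2 * R\<^sup>2 * B\<^sup>2"
      using zero_le_power2[of "A - 2 * R * B"] by (simp add: power2_eq_square algebra_simps)
    moreover have "classical_grad F x \<bullet> b = 2 * ((x \<bullet> b) * (\<psi> x * (classical_grad \<psi> x \<bullet> b))) + (\<psi> x)\<^sup>2"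
      using b by (simp add: gF inner_add_left power2_eq_square algebra_simps)
    moreover have "A\<^sup>2 = (\<psi> x)\<^sup>2" by (simp add: A_def)
    ultimately show "(1/2) * (\<psi> x)\<^sup>2 - 2 * R\<^sup>2 * (norm (classical_grad \<psi> x))\<^sup>2 \<le> classical_grad F x \<bullet> b"
      unfolding B_def by linarith
  qed
  also have "\<dots> = 0" using z integral_inner_left[OF iF, of b] by simp
  finally have "(1/2) * (\<integral>x. (\<psi> x)\<^sup>2 \<partial>lebesgue_on D) - 2 * R\<^sup>2 * (\<integral>x. (norm (classical_grad \<psi> x))\<^sup>2 \<partial>lebesgue_on D) \<le> 0"
    using i1 i2 by simp
  then show ?thesis by simp
qed

section \<open>Linearity and uniqueness of weak gradients\<close>

lemma has_weak_gradD:
  assumes "has_weak_grad D u g"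
  shows "square_integrable_on D u" "square_integrable_on D g"
    "test_function D \<psi> \<Longrightarrow>
        (\<integral>x. u x *\<^sub>R classical_grad \<psi> x \<partial>lebesgue_on D) = - (\<integral>x. \<psi> x *\<^sub>R g x \<partial>lebesgue_on D)"
  using assms by (auto simp: has_weak_grad_def)

text \<open>A single two-coefficient rule covers sums, differences and multiples; this is why later
  functions are written as \<open>1 * u x + (-1) * v x\<close>.\<close>

lemma has_weak_grad_lincomb:
  assumes u: "has_weak_grad D u g" and v: "has_weak_grad D v k"
  shows "has_weak_grad D (\<lambda>x. a * u x + c * v x) (\<lambda>x. a *\<^sub>R g x + c *\<^sub>R k x)"
  unfolding has_weak_grad_def
proof (intro conjI allI impI)
  show "square_integrable_on D (\<lambda>x. a * u x + c * v x)"
    using square_integrable_on_add[OF square_integrable_on_scaleR square_integrable_on_scaleR, OF has_weak_gradD(1) has_weak_gradD(1), OF u v]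
    by simp
  show "square_integrable_on D (\<lambda>x. a *\<^sub>R g x + c *\<^sub>R k x)"
    by (intro square_integrable_on_add square_integrable_on_scaleR has_weak_gradD(2)[OF u] has_weak_gradD(2)[OF v])
  fix \<psi> assume \<psi>: "test_function D \<psi>"
  note iu = integrable_scaleR_test_grad[OF \<psi> square_integrable_on_integrable[OF has_weak_gradD(1)[OF u]]]
  note iv = integrable_scaleR_test_grad[OF \<psi> square_integrable_on_integrable[OF has_weak_gradD(1)[OF v]]]
  note ig = integrable_test_scaleR[OF \<psi> square_integrable_on_integrable[OF has_weak_gradD(2)[OF u]]]
  note ik = integrable_test_scaleR[OF \<psi> square_integrable_on_integrable[OF has_weak_gradD(2)[OF v]]]
  have "(\<integral>x. (a * u x + c * v x) *\<^sub>R classical_grad \<psi> x \<partial>lebesgue_on D)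
    = (\<integral>x. a *\<^sub>R (u x *\<^sub>R classical_grad \<psi> x) + c *\<^sub>R (v x *\<^sub>R classical_grad \<psi> x) \<partial>lebesgue_on D)"
    by (simp add: scaleR_add_left)
  also have "\<dots> = a *\<^sub>R (\<integral>x. u x *\<^sub>R classical_grad \<psi> x \<partial>lebesgue_on D) + c *\<^sub>R (\<integral>x. v x *\<^sub>R classical_grad \<psi> x \<partial>lebesgue_on D)"
    by (rule integral_scaleR_lincomb[OF iu iv])
  also have "\<dots> = - (a *\<^sub>R (\<integral>x. \<psi> x *\<^sub>R g x \<partial>lebesgue_on D) + c *\<^sub>R (\<integral>x. \<psi> x *\<^sub>R k x \<partial>lebesgue_on D))"
    using has_weak_gradD(3)[OF u \<psi>] has_weak_gradD(3)[OF v \<psi>] by simp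
  also have "a *\<^sub>R (\<integral>x. \<psi> x *\<^sub>R g x \<partial>lebesgue_on D) + c *\<^sub>R (\<integral>x. \<psi> x *\<^sub>R k x \<partial>lebesgue_on D)
    = (\<integral>x. a *\<^sub>R (\<psi> x *\<^sub>R g x) + c *\<^sub>R (\<psi> x *\<^sub>R k x) \<partial>lebesgue_on D)"
    by (rule integral_scaleR_lincomb[OF ig ik, symmetric])
  also have "\<dots> = (\<integral>x. \<psi> x *\<^sub>R (a *\<^sub>R g x + c *\<^sub>R k x) \<partial>lebesgue_on D)"
    by (simp add: scaleR_add_right mult.commute)
  finally show "(\<integral>x. (a * u x + c * v x) *\<^sub>R classical_grad \<psi> x \<partial>lebesgue_on D)
      = - (\<integral>x. \<psi> x *\<^sub>R (a *\<^sub>R g x + c *\<^sub>R k x) \<partial>lebesgue_on D)" .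
qed

lemma has_weak_grad_AE_cong:
  assumes "has_weak_grad D u g" "AE x in lebesgue_on D. g x = k x"
  shows "has_weak_grad D u k"
  unfolding has_weak_grad_def
proof (intro conjI allI impI)
  show "square_integrable_on D u" using has_weak_gradD assms by blast
  show k: "square_integrable_on D k" using square_integrable_AE_eq[OF has_weak_gradD(2)] assms by blast
  fix \<psi> assume \<psi>: "test_function D \<psi>"
  have "(\<integral>x. \<psi> x *\<^sub>R g x \<partial>lebesgue_on D) = (\<integral>x. \<psi> x *\<^sub>R k x \<partial>lebesgue_on D)"
  proof (rule integral_cong_AE)
    show "(\<lambda>x. \<psi> x *\<^sub>R g x) \<in> borel_measurable (lebesgue_on D)" "(\<lambda>x. \<psi> x *\<^sub>R k x) \<in> borel_measurable (lebesgue_on D)"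
      using integrable_test_scaleR[OF \<psi> square_integrable_on_integrable] k has_weak_gradD(2)[OF assms(1)]
      by (blast intro: borel_measurable_integrable)+
    show "AE x in lebesgue_on D. \<psi> x *\<^sub>R g x = \<psi> x *\<^sub>R k x"
      using assms(2) by eventually_elim simp
  qed
  then show "(\<integral>x. u x *\<^sub>R classical_grad \<psi> x \<partial>lebesgue_on D) = - (\<integral>x. \<psi> x *\<^sub>R k x \<partial>lebesgue_on D)"
    using has_weak_gradD(3)[OF assms(1) \<psi>] by simp
qed

lemma AE_D_negligibleI:
  assumes "negligible N" "\<And>x. x \<in> D - N \<Longrightarrow> Q x"
  shows "AE x in lebesgue_on D. Q x"
  unfolding AE_D_iff
proof (rule AE_I'[of N])
  show "N \<in> null_sets lebesgue" using assms(1) by (simp add: negligible_iff_null_sets)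
  show "{x \<in> space lebesgue. \<not> (x \<in> D \<longrightarrow> Q x)} \<subseteq> N" using assms(2) by auto
qed

text \<open>The difference of two weak gradients is a weak gradient of the zero function, hence
  orthogonal to every test function.\<close>

lemma has_weak_grad_unique:
  assumes u: "has_weak_grad D u g" and k: "has_weak_grad D u k"
  shows "AE x in lebesgue_on D. g x = k x"
proof -
  have w: "has_weak_grad D (\<lambda>x. 1 * u x + (-1) * u x) (\<lambda>x. 1 *\<^sub>R g x + (-1) *\<^sub>R k x)"
    by (rule has_weak_grad_lincomb[OF u k])
  obtain N where "negligible N" "\<And>x. x \<in> D - N \<Longrightarrow> 1 *\<^sub>R g x + (-1) *\<^sub>R k x = 0"
  proof (rule fundamental_lemma[OF square_integrable_on_integrable[OF has_weak_gradD(2)[OF w]] open_D subset_refl])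
    fix \<psi> assume "test_function D \<psi>"
    from has_weak_gradD(3)[OF w this]
    show "(\<integral>x. \<psi> x *\<^sub>R (1 *\<^sub>R g x + (-1) *\<^sub>R k x) \<partial>lebesgue_on D) = 0" by simp
  qed blast
  then show ?thesis by (intro AE_D_negligibleI) auto
qed

text \<open>The same combination of the two approximating sequences works: since a squared sum is at
  most twice the sum of the squares, its squared distance is at most \<open>2 * a\<^sup>2\<close>
  times the first plus \<open>2 * c\<^sup>2\<close> times the second.\<close>

lemma H10_lincomb:
  assumes "u \<in> H10 D" "v \<in> H10 D"
  shows "(\<lambda>x. a * u x + c * v x) \<in> H10 D"
proof -
  define E where "E w g \<psi> = (\<integral>x. (w x - \<psi> x)\<^sup>2 + (norm (g x - classical_grad \<psi> x))\<^sup>2 \<partial>lebesgue_on D)"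
    for w :: "'a \<Rightarrow> real" and g \<psi>
  obtain g \<psi> where g: "has_weak_grad D u g" "\<And>n::nat. test_function D (\<psi> n)" "(\<lambda>n. E u g (\<psi> n)) \<longlonglongrightarrow> 0"
    using assms(1) unfolding H10_def E_def by blast
  obtain k \<rho> where k: "has_weak_grad D v k" "\<And>n::nat. test_function D (\<rho> n)" "(\<lambda>n. E v k (\<rho> n)) \<longlonglongrightarrow> 0"
    using assms(2) unfolding H10_def E_def by blast
  define \<eta> where "\<eta> n x = a * \<psi> n x + c * \<rho> n x" for n x
  define G where "G x = a *\<^sub>R g x + c *\<^sub>R k x" for x
  define w where "w x = a * u x + c * v x" for x
  have gw: "has_weak_grad D w G" unfolding w_def[abs_def] G_def[abs_def] by (rule has_weak_grad_lincomb[OF g(1) k(1)])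
  have \<eta>C: "C1 (\<eta> n)" "classical_grad (\<eta> n) = (\<lambda>x. a *\<^sub>R classical_grad (\<psi> n) x + c *\<^sub>R classical_grad (\<rho> n) x)" for n
    unfolding \<eta>_def[abs_def]
    using C1_add[OF C1_cmult(1) C1_cmult(1), OF test_functionD(1) test_functionD(1), OF g(2) k(2), of a n c n]
    by (simp_all add: C1_cmult(2)[OF test_functionD(1)] g(2) k(2))
  have \<eta>t: "test_function D (\<eta> n)" for n
  proof -
    let ?K = "closure {x. \<psi> n x \<noteq> 0} \<union> closure {x. \<rho> n x \<noteq> 0}"
    have K: "compact ?K" "?K \<subseteq> D" using test_functionD(2,3) g(2) k(2) by blast+
    have "closure {x. \<eta> n x \<noteq> 0} \<subseteq> ?K"
    proof (rule closure_minimal)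
      show "{x. \<eta> n x \<noteq> 0} \<subseteq> ?K"
      proof
        fix x assume "x \<in> {x. \<eta> n x \<noteq> 0}"
        then have "\<psi> n x \<noteq> 0 \<or> \<rho> n x \<noteq> 0" by (auto simp: \<eta>_def)
        then show "x \<in> ?K"
          using closure_subset[of "{x. \<psi> n x \<noteq> 0}"] closure_subset[of "{x. \<rho> n x \<noteq> 0}"] by blast
      qed
    qed auto
    with K have "compact (closure {x. \<eta> n x \<noteq> 0})" "closure {x. \<eta> n x \<noteq> 0} \<subseteq> D"
      using compact_Int_closed[of ?K "closure {x. \<eta> n x \<noteq> 0}"] by (auto simp: inf_absorb2)
    then show ?thesis using \<eta>C(1)[of n] by (simp add: test_function_iff)
  qed
  have int: "integrable (lebesgue_on D) (\<lambda>x. (w x - \<psi> x)\<^sup>2 + (norm (g x - classical_grad \<psi> x))\<^sup>2)"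
    if "has_weak_grad D w g" "test_function D \<psi>" for w g \<psi>
  proof -
    have "square_integrable_on D (\<lambda>x. w x + (-1) *\<^sub>R \<psi> x)" "square_integrable_on D (\<lambda>x. g x + (-1) *\<^sub>R classical_grad \<psi> x)"
      by (intro square_integrable_on_add square_integrable_on_scaleR has_weak_gradD[OF that(1)] test_function_square_integrable[OF that(2)])+
    from square_integrable_onD(2)[OF this(1)] square_integrable_onD(2)[OF this(2)] show ?thesis
      by (intro Bochner_Integration.integrable_add) simp_all
  qed
  have E_le: "E w G (\<eta> n) \<le> 2 * a\<^sup>2 * E u g (\<psi> n) + 2 * c\<^sup>2 * E v k (\<rho> n)" for n
  proof -
    have "E w G (\<eta> n) \<le> (\<integral>x. 2 * a\<^sup>2 * ((u x - \<psi> n x)\<^sup>2 + (norm (g x - classical_grad (\<psi> n) x))\<^sup>2)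
       + 2 * c\<^sup>2 * ((v x - \<rho> n x)\<^sup>2 + (norm (k x - classical_grad (\<rho> n) x))\<^sup>2) \<partial>lebesgue_on D)"
      unfolding E_def
    proof (rule integral_mono)
      show "integrable (lebesgue_on D) (\<lambda>x. (w x - \<eta> n x)\<^sup>2 + (norm (G x - classical_grad (\<eta> n) x))\<^sup>2)"
        by (rule int[OF gw \<eta>t])
      show "integrable (lebesgue_on D) (\<lambda>x. 2 * a\<^sup>2 * ((u x - \<psi> n x)\<^sup>2 + (norm (g x - classical_grad (\<psi> n) x))\<^sup>2)
       + 2 * c\<^sup>2 * ((v x - \<rho> n x)\<^sup>2 + (norm (k x - classical_grad (\<rho> n) x))\<^sup>2))"
        by (intro Bochner_Integration.integrable_add[OF integrable_mult_right integrable_mult_right] int g k)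
      fix x
      have par: "(norm (p + q))\<^sup>2 \<le> 2 * (norm p)\<^sup>2 + 2 * (norm q)\<^sup>2" for p q :: "'c::real_inner"
        using zero_le_power2[of "norm (p - q)"] by (simp add: power2_norm_eq_inner inner_add_left inner_add_right inner_diff_left inner_diff_right inner_commute)
      have 1: "w x - \<eta> n x = a * (u x - \<psi> n x) + c * (v x - \<rho> n x)"
        by (simp add: w_def \<eta>_def algebra_simps)
      have 2: "G x - classical_grad (\<eta> n) x = a *\<^sub>R (g x - classical_grad (\<psi> n) x) + c *\<^sub>R (k x - classical_grad (\<rho> n) x)"
        by (simp add: G_def \<eta>C algebra_simps)
      have "(w x - \<eta> n x)\<^sup>2 \<le> 2 * (a * (u x - \<psi> n x))\<^sup>2 + 2 * (c * (v x - \<rho> n x))\<^sup>2"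
        using par[of "a * (u x - \<psi> n x)" "c * (v x - \<rho> n x)"] unfolding 1 by simp
      moreover have "(norm (G x - classical_grad (\<eta> n) x))\<^sup>2
          \<le> 2 * (norm (a *\<^sub>R (g x - classical_grad (\<psi> n) x)))\<^sup>2 + 2 * (norm (c *\<^sub>R (k x - classical_grad (\<rho> n) x)))\<^sup>2"
        unfolding 2 by (rule par)
      ultimately show "(w x - \<eta> n x)\<^sup>2 + (norm (G x - classical_grad (\<eta> n) x))\<^sup>2
          \<le> 2 * a\<^sup>2 * ((u x - \<psi> n x)\<^sup>2 + (norm (g x - classical_grad (\<psi> n) x))\<^sup>2)
       + 2 * c\<^sup>2 * ((v x - \<rho> n x)\<^sup>2 + (norm (k x - classical_grad (\<rho> n) x))\<^sup>2)"
        unfolding norm_scaleR power_mult_distrib power2_abs distrib_left mult.assoc by linarith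
    qed
    also have "\<dots> = 2 * a\<^sup>2 * E u g (\<psi> n) + 2 * c\<^sup>2 * E v k (\<rho> n)"
      unfolding E_def
      by (subst Bochner_Integration.integral_add[OF integrable_mult_right integrable_mult_right])
        (auto intro!: int g k)
    finally show ?thesis .
  qed
  have "(\<lambda>n. E w G (\<eta> n)) \<longlonglongrightarrow> 0"
  proof (rule tendsto_sandwich[where f="\<lambda>_. 0"])
    have "(\<lambda>n. 2 * a\<^sup>2 * E u g (\<psi> n) + 2 * c\<^sup>2 * E v k (\<rho> n)) \<longlonglongrightarrow> 2 * a\<^sup>2 * 0 + 2 * c\<^sup>2 * 0"
      by (intro tendsto_intros g k)
    then show "(\<lambda>n. 2 * a\<^sup>2 * E u g (\<psi> n) + 2 * c\<^sup>2 * E v k (\<rho> n)) \<longlonglongrightarrow> 0" by simp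
    show "\<forall>\<^sub>F n in sequentially. 0 \<le> E w G (\<eta> n)"
      unfolding E_def by (intro always_eventually allI integral_nonneg_AE AE_I2) auto
  qed (use E_le in auto)
  then have "w \<in> H10 D" unfolding H10_def E_def using gw \<eta>t by blast
  then show ?thesis by (simp add: w_def[abs_def])
qed

text \<open>The inequality for test functions passes to the limit. Going from \<open>u\<close> to
  \<open>\<psi> n\<close> and from its gradient back to that of \<open>u\<close> doubles the squares
  twice, which turns 4 into 16.\<close>

lemma H10_poincare:
  assumes u: "u \<in> H10 D" "has_weak_grad D u g" and R: "D \<subseteq> cball 0 R" "R > 0"
  shows "(\<integral>x. (u x)\<^sup>2 \<partial>lebesgue_on D) \<le> 16 * R\<^sup>2 * (\<integral>x. (norm (g x))\<^sup>2 \<partial>lebesgue_on D)"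
proof -
  obtain k \<psi> where k: "has_weak_grad D u k" "\<And>n::nat. test_function D (\<psi> n)"
    "(\<lambda>n. \<integral>x. (u x - \<psi> n x)\<^sup>2 + (norm (k x - classical_grad (\<psi> n) x))\<^sup>2 \<partial>lebesgue_on D) \<longlonglongrightarrow> 0"
    using u(1) unfolding H10_def by blast
  define E where "E n = (\<integral>x. (u x - \<psi> n x)\<^sup>2 + (norm (k x - classical_grad (\<psi> n) x))\<^sup>2 \<partial>lebesgue_on D)" for n
  have iu: "integrable (lebesgue_on D) (\<lambda>x. (u x)\<^sup>2)" using square_integrable_onD(2)[OF has_weak_gradD(1)[OF k(1)]] by simp
  note ik = square_integrable_onD(2)[OF has_weak_gradD(2)[OF k(1)]]
  have le: "(\<integral>x. (u x)\<^sup>2 \<partial>lebesgue_on D) \<le> (2 + 16 * R\<^sup>2) * E n + 16 * R\<^sup>2 * (\<integral>x. (norm (k x))\<^sup>2 \<partial>lebesgue_on D)" for n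
  proof -
    have sq: "square_integrable_on D (\<lambda>x. u x + (-1) *\<^sub>R \<psi> n x)" "square_integrable_on D (\<lambda>x. k x + (-1) *\<^sub>R classical_grad (\<psi> n) x)"
      by (intro square_integrable_on_add square_integrable_on_scaleR has_weak_gradD[OF k(1)] test_function_square_integrable[OF k(2)])+
    have i1: "integrable (lebesgue_on D) (\<lambda>x. (u x - \<psi> n x)\<^sup>2)" using square_integrable_onD(2)[OF sq(1)] by simp
    have i2: "integrable (lebesgue_on D) (\<lambda>x. (norm (k x - classical_grad (\<psi> n) x))\<^sup>2)" using square_integrable_onD(2)[OF sq(2)] by simp
    have i3: "integrable (lebesgue_on D) (\<lambda>x. (\<psi> n x)\<^sup>2)" using square_integrable_onD(2)[OF test_function_square_integrable(1)[OF k(2)]] by simp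
    note i4 = square_integrable_onD(2)[OF test_function_square_integrable(2)[OF k(2)]]
    have E: "E n = (\<integral>x. (u x - \<psi> n x)\<^sup>2 \<partial>lebesgue_on D) + (\<integral>x. (norm (k x - classical_grad (\<psi> n) x))\<^sup>2 \<partial>lebesgue_on D)"
      unfolding E_def by (rule Bochner_Integration.integral_add[OF i1 i2])
    have par: "(norm p)\<^sup>2 \<le> 2 * (norm (q - p))\<^sup>2 + 2 * (norm q)\<^sup>2" for p q :: "'c::real_inner"
      using zero_le_power2[of "norm (2 *\<^sub>R q - p)"]
      by (simp add: power2_norm_eq_inner inner_add_left inner_add_right inner_diff_left inner_diff_right inner_commute algebra_simps)
    have "(\<integral>x. (u x)\<^sup>2 \<partial>lebesgue_on D) \<le> (\<integral>x. 2 * (u x - \<psi> n x)\<^sup>2 + 2 * (\<psi> n x)\<^sup>2 \<partial>lebesgue_on D)"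
    proof (rule integral_mono[OF iu])
      show "integrable (lebesgue_on D) (\<lambda>x. 2 * (u x - \<psi> n x)\<^sup>2 + 2 * (\<psi> n x)\<^sup>2)"
        by (intro Bochner_Integration.integrable_add integrable_mult_right i1 i3)
      show "(u x)\<^sup>2 \<le> 2 * (u x - \<psi> n x)\<^sup>2 + 2 * (\<psi> n x)\<^sup>2" for x
        using par[of "u x" "\<psi> n x"] by (simp add: power2_commute)
    qed
    also have "\<dots> = 2 * (\<integral>x. (u x - \<psi> n x)\<^sup>2 \<partial>lebesgue_on D) + 2 * (\<integral>x. (\<psi> n x)\<^sup>2 \<partial>lebesgue_on D)"
      using i1 i3 by simp
    finally have 1: "(\<integral>x. (u x)\<^sup>2 \<partial>lebesgue_on D) \<le> 2 * (\<integral>x. (u x - \<psi> n x)\<^sup>2 \<partial>lebesgue_on D) + 2 * (\<integral>x. (\<psi> n x)\<^sup>2 \<partial>lebesgue_on D)" .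
    have "(\<integral>x. (norm (classical_grad (\<psi> n) x))\<^sup>2 \<partial>lebesgue_on D)
       \<le> (\<integral>x. 2 * (norm (k x - classical_grad (\<psi> n) x))\<^sup>2 + 2 * (norm (k x))\<^sup>2 \<partial>lebesgue_on D)"
    proof (rule integral_mono[OF i4])
      show "integrable (lebesgue_on D) (\<lambda>x. 2 * (norm (k x - classical_grad (\<psi> n) x))\<^sup>2 + 2 * (norm (k x))\<^sup>2)"
        by (intro Bochner_Integration.integrable_add integrable_mult_right i2 ik)
    qed (rule par)
    also have "\<dots> = 2 * (\<integral>x. (norm (k x - classical_grad (\<psi> n) x))\<^sup>2 \<partial>lebesgue_on D) + 2 * (\<integral>x. (norm (k x))\<^sup>2 \<partial>lebesgue_on D)"
      using i2 ik by simp
    finally have 2: "(\<integral>x. (norm (classical_grad (\<psi> n) x))\<^sup>2 \<partial>lebesgue_on D)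
      \<le> 2 * (\<integral>x. (norm (k x - classical_grad (\<psi> n) x))\<^sup>2 \<partial>lebesgue_on D) + 2 * (\<integral>x. (norm (k x))\<^sup>2 \<partial>lebesgue_on D)" .
    define p1 p2 p3 where "p1 = (\<integral>x. (u x - \<psi> n x)\<^sup>2 \<partial>lebesgue_on D)"
      and "p2 = (\<integral>x. (norm (k x - classical_grad (\<psi> n) x))\<^sup>2 \<partial>lebesgue_on D)"
      and "p3 = (\<integral>x. (norm (k x))\<^sup>2 \<partial>lebesgue_on D)"
    have nn: "p1 \<ge> 0" "p2 \<ge> 0" unfolding p1_def p2_def by (intro integral_nonneg_AE AE_I2; simp)+
    have "4 * R\<^sup>2 * (\<integral>x. (norm (classical_grad (\<psi> n) x))\<^sup>2 \<partial>lebesgue_on D) \<le> 4 * R\<^sup>2 * (2 * p2 + 2 * p3)"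
      unfolding p2_def p3_def by (intro mult_left_mono 2) simp
    with poincare_test_function[OF k(2) R, of n] 1
    have "(\<integral>x. (u x)\<^sup>2 \<partial>lebesgue_on D) \<le> 2 * p1 + 2 * (4 * R\<^sup>2 * (2 * p2 + 2 * p3))"
      unfolding p1_def by linarith
    also have "\<dots> \<le> (2 + 16 * R\<^sup>2) * (p1 + p2) + 16 * R\<^sup>2 * p3"
      using mult_nonneg_nonneg[OF zero_le_power2[of R] nn(1)] nn(2) by (simp add: algebra_simps)
    finally show ?thesis unfolding E p1_def p2_def p3_def .
  qed
  have "(\<lambda>n. (2 + 16 * R\<^sup>2) * E n + 16 * R\<^sup>2 * (\<integral>x. (norm (k x))\<^sup>2 \<partial>lebesgue_on D))
      \<longlonglongrightarrow> (2 + 16 * R\<^sup>2) * 0 + 16 * R\<^sup>2 * (\<integral>x. (norm (k x))\<^sup>2 \<partial>lebesgue_on D)"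
    using k(3) unfolding E_def[symmetric] by (intro tendsto_intros)
  then have "(\<integral>x. (u x)\<^sup>2 \<partial>lebesgue_on D) \<le> 16 * R\<^sup>2 * (\<integral>x. (norm (k x))\<^sup>2 \<partial>lebesgue_on D)"
    using le by (intro LIMSEQ_le_const[where X="\<lambda>n. (2 + 16 * R\<^sup>2) * E n + 16 * R\<^sup>2 * (\<integral>x. (norm (k x))\<^sup>2 \<partial>lebesgue_on D)"]) auto
  \<comment> \<open>The gradient \<open>k\<close> that comes with the approximation agrees with the
    given \<open>g\<close> almost everywhere.\<close>
  also have "(\<integral>x. (norm (k x))\<^sup>2 \<partial>lebesgue_on D) = (\<integral>x. (norm (g x))\<^sup>2 \<partial>lebesgue_on D)"
  proof (rule integral_cong_AE)
    show "AE x in lebesgue_on D. (norm (k x))\<^sup>2 = (norm (g x))\<^sup>2"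
      using has_weak_grad_unique[OF k(1) u(2)] by eventually_elim simp
  qed (use ik square_integrable_onD(2)[OF has_weak_gradD(2)[OF u(2)]] in auto)
  finally show ?thesis .
qed

end

section \<open>Finite element functions\<close>

text \<open>Definiteness is demanded as equality of functions at every point. Expansions in an
  orthonormal basis then hold pointwise, as pointwise means and variances require.\<close>

locale inner_function_space =
  fixes V :: "('a \<Rightarrow> real) set" and ip :: "('a \<Rightarrow> real) \<Rightarrow> ('a \<Rightarrow> real) \<Rightarrow> real"
  assumes zero_mem: "(\<lambda>x. 0) \<in> V"
    and lincomb_mem: "u \<in> V \<Longrightarrow> v \<in> V \<Longrightarrow> (\<lambda>x. a * u x + c * v x) \<in> V"
    and ip_lincomb_left: "u \<in> V \<Longrightarrow> v \<in> V \<Longrightarrow> w \<in> V \<Longrightarrow> ip (\<lambda>x. a * u x + c * v x) w = a * ip u w + c * ip v w"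
    and ip_commute: "u \<in> V \<Longrightarrow> v \<in> V \<Longrightarrow> ip u v = ip v u"
    and ip_nonneg: "u \<in> V \<Longrightarrow> ip u u \<ge> 0"
    and ip_eq_0: "u \<in> V \<Longrightarrow> ip u u = 0 \<Longrightarrow> u = (\<lambda>x. 0)"
begin

lemma ip_zero_left: "w \<in> V \<Longrightarrow> ip (\<lambda>x. 0) w = 0"
  using ip_lincomb_left[of "\<lambda>x. 0" "\<lambda>x. 0" w 0 0] zero_mem by simp

lemma sum_mem: "(\<And>i. i \<in> I \<Longrightarrow> e i \<in> V) \<Longrightarrow> (\<lambda>x. \<Sum>i\<in>I. d i * e i x) \<in> V"
proof (induction I rule: infinite_finite_induct)
  case (insert i I)
  then have "(\<lambda>x. d i * e i x + 1 * (\<Sum>i\<in>I. d i * e i x)) \<in> V" by (intro lincomb_mem) auto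
  then show ?case using insert by simp
qed (auto simp: zero_mem)

lemma ip_sum_left:
  assumes "\<And>i. i \<in> I \<Longrightarrow> e i \<in> V" "w \<in> V"
  shows "ip (\<lambda>x. \<Sum>i\<in>I. d i * e i x) w = (\<Sum>i\<in>I. d i * ip (e i) w)"
proof (cases "finite I")
  case True
  then show ?thesis using assms(1)
  proof (induction I rule: finite_induct)
    case (insert i I)
    have "ip (\<lambda>x. d i * e i x + 1 * (\<Sum>i\<in>I. d i * e i x)) w = d i * ip (e i) w + 1 * ip (\<lambda>x. \<Sum>i\<in>I. d i * e i x) w"
      using insert assms(2) by (intro ip_lincomb_left sum_mem) auto
    then show ?case using insert by simp
  qed (use assms(2) in \<open>simp add: ip_zero_left\<close>)
qed (use assms(2) in \<open>simp add: ip_zero_left\<close>)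

end

lemma (in inner_function_space) inner_function_space_subset:
  assumes "W \<subseteq> V" "(\<lambda>x. 0) \<in> W" "\<And>u v a c. u \<in> W \<Longrightarrow> v \<in> W \<Longrightarrow> (\<lambda>x. a * u x + c * v x) \<in> W"
  shows "inner_function_space W ip"
  using assms by unfold_locales (auto intro: ip_lincomb_left ip_commute ip_nonneg ip_eq_0)

text \<open>Gram-Schmidt, by induction on the length of a spanning list \<open>b\<close>. The
  \<open>b k\<close> need not belong to \<open>V\<close>: in the application they are polynomials
  cut off to single simplices, in general discontinuous. So the step compares \<open>V\<close> with
  those of its functions that avoid the last \<open>b N\<close>, a subspace of codimension at most
  one.\<close>

lemma orthonormal_basis_exists:
  fixes N :: nat and b :: "nat \<Rightarrow> 'a \<Rightarrow> real"
  assumes "inner_function_space V ip"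
    and "\<And>v. v \<in> V \<Longrightarrow> \<exists>c. \<forall>x. v x = (\<Sum>k<N. c k * b k x)"
  shows "\<exists>(n::nat) e. (\<forall>i<n. e i \<in> V) \<and> (\<forall>i<n. \<forall>j<n. ip (e i) (e j) = (if i = j then 1 else 0)) \<and>
    (\<forall>v\<in>V. \<forall>x. v x = (\<Sum>i<n. ip v (e i) * e i x))"
  using assms
proof (induction N arbitrary: V)
  case 0
  then have "\<forall>v\<in>V. \<forall>x. v x = 0" by auto
  then show ?case by (intro exI[of _ "0::nat"]) auto
next
  case (Suc N)
  interpret inner_function_space V ip by fact
  define W where "W = {v \<in> V. \<exists>c. \<forall>x. v x = (\<Sum>k<N. c k * b k x)}"
  have WI: "inner_function_space W ip"
  proof (rule inner_function_space_subset)
    show "W \<subseteq> V" by (auto simp: W_def)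
    have "\<forall>x. (0::real) = (\<Sum>k<N. 0 * b k x)" by simp
    then have "\<exists>c. \<forall>x. 0 = (\<Sum>k<N. c k * b k x)" by (intro exI[of _ "\<lambda>_. 0"]) simp
    then show "(\<lambda>x. 0) \<in> W" using zero_mem by (auto simp: W_def)
    fix u v a c assume "u \<in> W" "v \<in> W"
    then obtain cu cv where cuv: "\<forall>x. u x = (\<Sum>k<N. cu k * b k x)" "\<forall>x. v x = (\<Sum>k<N. cv k * b k x)" "u \<in> V" "v \<in> V"
      by (auto simp: W_def)
    have "\<forall>x. a * u x + c * v x = (\<Sum>k<N. (a * cu k + c * cv k) * b k x)"
      using cuv by (simp add: sum_distrib_left sum.distrib algebra_simps)
    then have "\<exists>d. \<forall>x. a * u x + c * v x = (\<Sum>k<N. d k * b k x)"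
      by (intro exI[of _ "\<lambda>k. a * cu k + c * cv k"])
    moreover have "(\<lambda>x. a * u x + c * v x) \<in> V" using cuv(3,4) by (rule lincomb_mem)
    ultimately show "(\<lambda>x. a * u x + c * v x) \<in> W" unfolding W_def by blast
  qed
  obtain n :: nat and e where e: "\<forall>i<n. e i \<in> W" "\<forall>i<n. \<forall>j<n. ip (e i) (e j) = (if i = j then 1 else 0)"
    "\<forall>v\<in>W. \<forall>x. v x = (\<Sum>i<n. ip v (e i) * e i x)"
    using Suc.IH[OF WI] unfolding W_def by blast
  then have eV: "e i \<in> V" if "i < n" for i using that by (auto simp: W_def)
  show ?case
  proof (cases "V \<subseteq> W")
    case True
    then show ?thesis using e eV by (intro exI[of _ n] exI[of _ e]) auto
  next
    case False
    then obtain w where w: "w \<in> V" "w \<notin> W" by auto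
    obtain cw where cw: "\<forall>x. w x = (\<Sum>k<Suc N. cw k * b k x)" using Suc.prems(2)[OF w(1)] by auto
    have cN: "cw N \<noteq> 0"
    proof
      assume "cw N = 0"
      then have "\<forall>x. w x = (\<Sum>k<N. cw k * b k x)" using cw by simp
      then show False using w by (auto simp: W_def)
    qed
    define s where "s x = (\<Sum>i<n. ip w (e i) * e i x)" for x
    have sW: "s \<in> W" unfolding s_def[abs_def]
      by (rule inner_function_space.sum_mem[OF WI]) (use e in auto)
    then have sV: "s \<in> V" by (simp add: W_def)
    \<comment> \<open>The part of \<open>w\<close> orthogonal to \<open>W\<close>; it is not zero,
      since \<open>s\<close> lies in \<open>W\<close> and \<open>w\<close> does not.\<close>
    define w' where "w' x = 1 * w x + (-1) * s x" for x
    have w'V: "w' \<in> V" unfolding w'_def[abs_def] by (intro lincomb_mem w sV)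
    have w'e: "ip w' (e j) = 0" if j: "j < n" for j
    proof -
      have "ip s (e j) = (\<Sum>i<n. ip w (e i) * ip (e i) (e j))"
        unfolding s_def[abs_def] by (rule ip_sum_left) (use eV j in auto)
      also have "\<dots> = (\<Sum>i<n. if i = j then ip w (e j) else 0)"
        using e(2) j by (intro sum.cong) auto
      also have "\<dots> = ip w (e j)" using j by simp
      finally show ?thesis
        unfolding w'_def[abs_def] by (subst ip_lincomb_left) (use w sV eV j in auto)
    qed
    have "ip w' w' \<noteq> 0"
    proof
      assume "ip w' w' = 0"
      then have "w' = (\<lambda>x. 0)" using ip_eq_0 w'V by blast
      then have "w' x = 0" for x by simp
      then have "w x = s x" for x using w'_def[of x] by simp
      then have "w = s" by auto
      then show False using sW w by simp
    qed
    then have pos: "ip w' w' > 0" using ip_nonneg[OF w'V] by simp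
    define r where "r = sqrt (ip w' w')"
    have r: "r > 0" "r * r = ip w' w'" using pos by (auto simp: r_def)
    define f where "f x = (1/r) * w' x + 0 * w' x" for x
    have fV: "f \<in> V" unfolding f_def[abs_def] by (intro lincomb_mem w'V)
    have ipf: "ip f v = ip w' v / r" if "v \<in> V" for v
      unfolding f_def[abs_def] using ip_lincomb_left[OF w'V w'V that, of "1/r" 0] by simp
    have ff: "ip f f = 1"
      using ipf[OF fV] ip_commute[OF w'V fV] ipf[OF w'V] r pos by (simp add: field_simps)
    have fe: "ip f (e j) = 0" if "j < n" for j using ipf[OF eV[OF that]] w'e[OF that] by simp
    define E where "E i = (if i < n then e i else f)" for i
    have EV: "E i \<in> V" for i using eV fV by (auto simp: E_def)
    have Eorth: "ip (E i) (E j) = (if i = j then 1 else 0)" if ij: "i < Suc n" "j < Suc n" for i j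
    proof -
      consider "i < n" "j < n" | "i = n" "j < n" | "i < n" "j = n" | "i = n" "j = n" using ij by linarith
      then show ?thesis
        by cases (use e(2) ff fe ip_commute[OF fV eV] in \<open>auto simp: E_def\<close>)
    qed
    have "v x = (\<Sum>i<Suc n. ip v (E i) * E i x)" if v: "v \<in> V" for v x
    proof -
      obtain cv where cv: "\<forall>x. v x = (\<Sum>k<Suc N. cv k * b k x)" using Suc.prems(2)[OF v] by auto
      \<comment> \<open>This multiple of \<open>w\<close> cancels the coefficient of
        \<open>b N\<close>, so that the difference \<open>z\<close> falls into
        \<open>W\<close>.\<close>
      define t where "t = cv N / cw N"
      define z where "z x = 1 * v x + (-t) * w x" for x
      have "\<forall>x. z x = (\<Sum>k<N. (cv k - t * cw k) * b k x)"
        using cv cw cN by (simp add: z_def t_def sum_distrib_left sum_subtractf sum_negf algebra_simps)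
      moreover have "z \<in> V" unfolding z_def[abs_def] by (intro lincomb_mem v w)
      ultimately have zW: "z \<in> W"
        unfolding W_def by (intro CollectI conjI exI[of _ "\<lambda>k. cv k - t * cw k"])
      define d where "d i = (if i < n then ip z (e i) + t * ip w (e i) else t * r)" for i
      have vd: "v y = (\<Sum>i<Suc n. d i * E i y)" for y
      proof -
        have "v y = z y + t * w y" by (simp add: z_def)
        also have "w y = s y + w' y" by (simp add: w'_def)
        also have "w' y = r * f y" using r by (simp add: f_def)
        also have "z y = (\<Sum>i<n. ip z (e i) * e i y)" using e(3) zW by blast
        also have "(\<Sum>i<n. ip z (e i) * e i y) + t * (s y + r * f y) = (\<Sum>i<n. d i * E i y) + d n * E n y"
          by (simp add: d_def E_def s_def sum_distrib_left sum.distrib algebra_simps)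
        finally show ?thesis by simp
      qed
      then have veq: "v = (\<lambda>y. \<Sum>i<Suc n. d i * E i y)" by (rule ext)
      have "ip v (E j) = d j" if j: "j < Suc n" for j
      proof -
        have "ip v (E j) = (\<Sum>i<Suc n. d i * ip (E i) (E j))"
          by (subst veq, rule ip_sum_left) (use EV in auto)
        also have "\<dots> = (\<Sum>i<Suc n. if i = j then d j else 0)"
          using Eorth j by (intro sum.cong) auto
        also have "\<dots> = d j" using j by simp
        finally show ?thesis .
      qed
      then show ?thesis using vd by simp
    qed
    then show ?thesis using EV Eorth by (intro exI[of _ "Suc n"] exI[of _ E]) auto
  qed
qed

section \<open>Polynomials and local identification of weak gradients\<close>

lemma C1_polynomial:
  assumes "f \<in> polynomials_upto q"
  shows "C1 f"
proof -
  obtain c where "\<And>x. f x = (\<Sum>\<alpha>\<in>multi_indices Basis q. c \<alpha> * (\<Prod>b\<in>Basis. (x \<bullet> b) ^ \<alpha> b))"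
    using assms by (auto simp: polynomials_upto_def)
  then have "f = (\<lambda>x. \<Sum>\<alpha>\<in>multi_indices Basis q. c \<alpha> * (\<Prod>b\<in>Basis. (x \<bullet> b) ^ \<alpha> b))" by auto
  then show ?thesis by (auto intro!: C1_sum C1_cmult(1) C1_prod C1_power C1_inner(1))
qed

lemma polynomials_lincomb:
  assumes "f \<in> polynomials_upto q" "g \<in> polynomials_upto q"
  shows "(\<lambda>x. a * f x + c * g x) \<in> polynomials_upto q"
proof -
  obtain cf where cf: "\<And>x. f x = (\<Sum>\<alpha>\<in>multi_indices Basis q. cf \<alpha> * (\<Prod>b\<in>Basis. (x \<bullet> b) ^ \<alpha> b))"
    using assms(1) unfolding polynomials_upto_def by auto
  obtain cg where cg: "\<And>x. g x = (\<Sum>\<alpha>\<in>multi_indices Basis q. cg \<alpha> * (\<Prod>b\<in>Basis. (x \<bullet> b) ^ \<alpha> b))"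
    using assms(2) unfolding polynomials_upto_def by auto
  have "\<forall>x. a * f x + c * g x = (\<Sum>\<alpha>\<in>multi_indices Basis q. (a * cf \<alpha> + c * cg \<alpha>) * (\<Prod>b\<in>Basis. (x \<bullet> b) ^ \<alpha> b))"
    by (simp add: cf cg sum_distrib_left sum.distrib algebra_simps)
  then show ?thesis unfolding polynomials_upto_def by (intro CollectI exI[of _ "\<lambda>\<alpha>. a * cf \<alpha> + c * cg \<alpha>"])
qed

lemma finite_multi_indices:
  assumes "finite I"
  shows "finite (multi_indices I p)"
proof (rule finite_subset)
  show "finite {f. (\<forall>x. (x \<in> I \<longrightarrow> f x \<in> {..p}) \<and> (x \<notin> I \<longrightarrow> f x = 0))}"
    by (rule finite_set_of_finite_funs) (use assms in auto)
  have "\<alpha> i \<le> p" if "(\<Sum>i\<in>I. \<alpha> i) \<le> p" "i \<in> I" for \<alpha> i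
    using member_le_sum[of i I \<alpha>] that assms by simp
  then show "multi_indices I p \<subseteq> {f. (\<forall>x. (x \<in> I \<longrightarrow> f x \<in> {..p}) \<and> (x \<notin> I \<longrightarrow> f x = 0))}"
    by (auto simp: multi_indices_def)
qed

context bounded_domain
begin

text \<open>For a test function supported in \<open>W\<close> the product of \<open>F\<close> and
  \<psi> is \<open>C1\<close> with compact support, so its gradient integrates to zero. That is
  integration by parts for \<open>F\<close>, which equals \<open>u\<close> there; comparison with
  the weak gradient makes \<open>g x - classical_grad F x\<close> orthogonal to all such
  \<psi>.\<close>

lemma weak_grad_local_C1:
  assumes u: "has_weak_grad D u g" and W: "open W" "W \<subseteq> D" and F: "C1 F" "\<And>x. x \<in> W \<Longrightarrow> u x = F x"
  obtains N where "negligible N" "\<And>x. x \<in> W - N \<Longrightarrow> g x = classical_grad u x"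
proof -
  have cF: "square_integrable_on D (classical_grad F)"
  proof -
    have "compact (closure D)" using bounded_D by simp
    then have "bounded (classical_grad F ` closure D)"
      using C1_continuous_grad[OF F(1)] by (intro compact_imp_bounded compact_continuous_image) (auto intro: continuous_on_subset)
    then obtain B where "\<And>x. x \<in> closure D \<Longrightarrow> norm (classical_grad F x) \<le> B" unfolding bounded_iff by blast
    then show ?thesis
      using closure_subset[of D] C1_continuous_grad[OF F(1)]
      by (intro square_integrable_on_bounded[of _ B] borel_imp_lebesgue_on borel_measurable_continuous_onI) auto
  qed
  note iF = square_integrable_on_integrable[OF cF]
  note ig = square_integrable_on_integrable[OF has_weak_gradD(2)[OF u]]
  have i: "integrable (lebesgue_on D) (\<lambda>x. g x - classical_grad F x)"
    using iF ig by simp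
  obtain N where N: "negligible N" "\<And>x. x \<in> W - N \<Longrightarrow> g x - classical_grad F x = 0"
  proof (rule fundamental_lemma[OF i W])
    fix \<psi> assume \<psi>: "test_function D \<psi>" and sub: "closure {x. \<psi> x \<noteq> 0} \<subseteq> W"
    note t = test_functionD[OF \<psi>]
    have C: "C1 (\<lambda>x. F x * \<psi> x)" by (intro C1_mult(1) F t)
    have gr: "classical_grad (\<lambda>x. F x * \<psi> x) = (\<lambda>x. u x *\<^sub>R classical_grad \<psi> x + \<psi> x *\<^sub>R classical_grad F x)"
    proof
      fix x
      have "F x *\<^sub>R classical_grad \<psi> x = u x *\<^sub>R classical_grad \<psi> x"
      proof (cases "x \<in> W")
        case True
        then show ?thesis using F(2) by simp
      next
        case False
        then have "x \<notin> closure {x. \<psi> x \<noteq> 0}" using sub by blast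
        then show ?thesis by (simp add: classical_grad_outside_support)
      qed
      then show "classical_grad (\<lambda>x. F x * \<psi> x) x = u x *\<^sub>R classical_grad \<psi> x + \<psi> x *\<^sub>R classical_grad F x"
        by (simp add: C1_mult(2)[OF F(1) t(1)])
    qed
    have "(\<integral>x. classical_grad (\<lambda>x. F x * \<psi> x) x \<partial>lborel) = 0"
    proof (rule integral_classical_grad_zero[OF C t(2)])
      show "F x * \<psi> x = 0" if "x \<notin> closure {x. \<psi> x \<noteq> 0}" for x
        unfolding t(6)[OF that] by (rule mult_zero_right)
    qed
    moreover have "classical_grad (\<lambda>x. F x * \<psi> x) \<in> borel_measurable borel"
      using C1_continuous_grad[OF C] by (simp add: borel_measurable_continuous_onI)
    ultimately have "(\<integral>x. u x *\<^sub>R classical_grad \<psi> x + \<psi> x *\<^sub>R classical_grad F x \<partial>lebesgue_on D) = 0"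
      using lebesgue_on_eq_lborel(1)[of "classical_grad (\<lambda>x. F x * \<psi> x)"]
      unfolding gr by (simp add: t(4,5))
    moreover have i1: "integrable (lebesgue_on D) (\<lambda>x. u x *\<^sub>R classical_grad \<psi> x)"
      by (rule integrable_scaleR_test_grad[OF \<psi> square_integrable_on_integrable[OF has_weak_gradD(1)[OF u]]])
    moreover have i2: "integrable (lebesgue_on D) (\<lambda>x. \<psi> x *\<^sub>R classical_grad F x)"
      by (rule integrable_test_scaleR[OF \<psi> iF])
    moreover have i3: "integrable (lebesgue_on D) (\<lambda>x. \<psi> x *\<^sub>R g x)"
      by (rule integrable_test_scaleR[OF \<psi> ig])
    ultimately have "(\<integral>x. \<psi> x *\<^sub>R classical_grad F x \<partial>lebesgue_on D) = (\<integral>x. \<psi> x *\<^sub>R g x \<partial>lebesgue_on D)"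
      using has_weak_gradD(3)[OF u \<psi>] by simp
    then show "(\<integral>x. \<psi> x *\<^sub>R (g x - classical_grad F x) \<partial>lebesgue_on D) = 0"
      using i2 i3 by (simp add: scaleR_diff_right)
  qed blast
  have "classical_grad u x = classical_grad F x" if "x \<in> W" for x
  proof (rule classical_grad_eqI)
    show "GDERIV u x :> classical_grad F x"
      using C1_GDERIV[OF F(1), of x] unfolding gderiv_def
      by (rule has_derivative_transform_within_open[OF _ W(1) that]) (use F(2) in auto)
  qed
  then show ?thesis using that[OF N(1)] N(2) by auto
qed

end

section \<open>Mesh, skeleton and finite element space\<close>

locale finite_elements = bounded_domain D for D :: "'a::euclidean_space set" +
  fixes \<T> :: "'a set set" and q :: nat
  assumes mesh: "regular_triangulation D \<T>"
begin

abbreviation "V \<equiv> fe_space D \<T> q"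

text \<open>The null set that pointwise statements about gradients avoid: off it a finite element
  function is locally a polynomial.\<close>

definition skeleton :: "'a set" where "skeleton = (\<Union>T\<in>\<T>. frontier T)"

lemma mesh_finite: "finite \<T>" and mesh_simplex: "T \<in> \<T> \<Longrightarrow> int DIM('a) simplex T" and mesh_cover: "D \<subseteq> \<Union>\<T>"
  using mesh closure_subset[of D] by (auto simp: regular_triangulation_def triangulation_def)

lemma mesh_closed: "T \<in> \<T> \<Longrightarrow> closed T"
  using mesh_simplex compact_imp_closed compact_simplex by blast

lemma mesh_convex: "T \<in> \<T> \<Longrightarrow> convex T"
  using mesh_simplex convex_simplex by blast

text \<open>Full dimension makes the affine hull the whole space, hence the interior nonempty, and a
  closed convex set with nonempty interior is the closure of that interior. Values at boundary
  points of a simplex can thus be seen from inside.\<close>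

lemma mesh_closure_interior: "T \<in> \<T> \<Longrightarrow> closure (interior T) = T"
proof -
  assume T: "T \<in> \<T>"
  have "aff_dim T = int DIM('a)" using aff_dim_simplex[OF mesh_simplex[OF T]] .
  then have hull: "affine hull T = UNIV" by (simp add: aff_dim_eq_full)
  then have "T \<noteq> {}" by auto
  then have "interior T \<noteq> {}"
    using rel_interior_interior[OF hull] rel_interior_eq_empty[OF mesh_convex[OF T]] by simp
  then show ?thesis
    using convex_closure_interior[OF mesh_convex[OF T]] mesh_closed[OF T] by simp
qed

lemma negligible_skeleton: "negligible skeleton"
  unfolding skeleton_def
  by (rule negligible_Union) (use mesh_finite mesh_convex in \<open>auto intro: negligible_convex_frontier\<close>)

lemma off_skeleton:
  assumes "x \<in> D - skeleton"
  obtains T where "T \<in> \<T>" "x \<in> interior T"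
proof -
  obtain T where "T \<in> \<T>" "x \<in> T" using mesh_cover assms by auto
  moreover from this have "x \<notin> frontier T" using assms by (auto simp: skeleton_def)
  ultimately show ?thesis using that closure_subset by (auto simp: frontier_def)
qed

lemma fe_poly:
  assumes "v \<in> V" "T \<in> \<T>"
  obtains F where "F \<in> polynomials_upto q" "\<And>x. x \<in> T \<Longrightarrow> v x = F x"
  using assms unfolding fe_space_def by blast

lemma fe_H10: "v \<in> V \<Longrightarrow> v \<in> H10 D" and fe_outside: "v \<in> V \<Longrightarrow> x \<notin> D \<Longrightarrow> v x = 0"
  by (auto simp: fe_space_def)

lemma fe_differentiable:
  assumes "v \<in> V" "x \<in> D - skeleton"
  shows "v differentiable (at x)"
proof -
  obtain T where T: "T \<in> \<T>" "x \<in> interior T" using off_skeleton assms by blast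
  obtain F where F: "F \<in> polynomials_upto q" "\<And>x. x \<in> T \<Longrightarrow> v x = F x" using fe_poly assms T by blast
  have "GDERIV F x :> classical_grad F x" using C1_GDERIV C1_polynomial F by blast
  then have "GDERIV v x :> classical_grad F x"
    unfolding gderiv_def
    by (rule has_derivative_transform_within_open[OF _ open_interior T(2)]) (use F interior_subset in \<open>metis subsetD\<close>)
  then show ?thesis by (rule GDERIV_imp_differentiable)
qed

text \<open>Membership in \<open>H10 D\<close> already supplies a weak gradient \<open>g\<close>; it
  remains to identify it. On each simplex \<open>weak_grad_local_C1\<close> does so up to a null
  set, and these finitely many sets together with the skeleton are negligible. Hence
  \<open>weak_grad\<close> is the classical gradient on the whole finite element space.\<close>

lemma fe_has_weak_grad:
  assumes v: "v \<in> V"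
  shows "has_weak_grad D v (classical_grad v)"
proof -
  obtain g where g: "has_weak_grad D v g" using fe_H10[OF v] by (auto simp: H10_def)
  have "\<exists>N. negligible N \<and> (\<forall>x\<in>(interior T \<inter> D) - N. g x = classical_grad v x)" if T: "T \<in> \<T>" for T
  proof -
    obtain F where F: "F \<in> polynomials_upto q" "\<And>x. x \<in> T \<Longrightarrow> v x = F x" using fe_poly v T by blast
    have "v x = F x" if "x \<in> interior T \<inter> D" for x using F that interior_subset by blast
    then obtain N where "negligible N" "\<And>x. x \<in> (interior T \<inter> D) - N \<Longrightarrow> g x = classical_grad v x"
      using weak_grad_local_C1[OF g _ _ C1_polynomial[OF F(1)], of "interior T \<inter> D"] open_D by blast
    then show ?thesis by blast
  qed
  then obtain N where N: "\<And>T. T \<in> \<T> \<Longrightarrow> negligible (N T)"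
    "\<And>T x. T \<in> \<T> \<Longrightarrow> x \<in> (interior T \<inter> D) - N T \<Longrightarrow> g x = classical_grad v x" by metis
  have "AE x in lebesgue_on D. g x = classical_grad v x"
  proof (rule AE_D_negligibleI)
    show "negligible (skeleton \<union> \<Union>(N ` \<T>))"
      by (intro negligible_Un negligible_skeleton negligible_Union) (use mesh_finite N in auto)
    fix x assume x: "x \<in> D - (skeleton \<union> \<Union>(N ` \<T>))"
    then obtain T where "T \<in> \<T>" "x \<in> interior T" using off_skeleton by blast
    then show "g x = classical_grad v x" using N(2) x by auto
  qed
  then show ?thesis by (rule has_weak_grad_AE_cong[OF g])
qed

lemma fe_weak_grad: "v \<in> V \<Longrightarrow> weak_grad D v = classical_grad v"
  using fe_has_weak_grad by (simp add: weak_grad_def)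

lemma fe_lincomb:
  assumes "u \<in> V" "v \<in> V"
  shows "(\<lambda>x. a * u x + c * v x) \<in> V"
  unfolding fe_space_def
proof (intro CollectI conjI ballI allI impI)
  show "(\<lambda>x. a * u x + c * v x) \<in> H10 D" using H10_lincomb fe_H10 assms by blast
  show "a * u x + c * v x = 0" if "x \<notin> D" for x using fe_outside[OF assms(1) that] fe_outside[OF assms(2) that] by simp
  fix T assume T: "T \<in> \<T>"
  obtain F where "F \<in> polynomials_upto q" "\<And>x. x \<in> T \<Longrightarrow> u x = F x" using fe_poly assms T by blast
  moreover obtain G where "G \<in> polynomials_upto q" "\<And>x. x \<in> T \<Longrightarrow> v x = G x" using fe_poly assms T by blast
  ultimately show "\<exists>f\<in>polynomials_upto q. \<forall>x\<in>T. a * u x + c * v x = f x"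
    by (intro bexI[of _ "\<lambda>x. a * F x + c * G x"] polynomials_lincomb) auto
qed

text \<open>The value at any point, even on an element boundary, is that of a polynomial on a closed
  simplex. If nonzero, it stays nonzero on an open set meeting the interior of that simplex, hence
  on a set of positive measure.\<close>

lemma fe_AE_zero:
  assumes v: "v \<in> V" and ae: "AE x in lebesgue_on D. v x = 0"
  shows "v = (\<lambda>x. 0)"
proof (rule ccontr)
  assume "v \<noteq> (\<lambda>x. 0)"
  then obtain x where "v x \<noteq> 0" by auto
  then have x: "x \<in> D" "v x \<noteq> 0" using fe_outside[OF v] by auto
  obtain T where T: "T \<in> \<T>" "x \<in> T" using mesh_cover x by blast
  obtain F where F: "F \<in> polynomials_upto q" "\<And>x. x \<in> T \<Longrightarrow> v x = F x" using fe_poly v T by blast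
  define S where "S = {y. F y \<noteq> 0} \<inter> D"
  have "open {y. F y \<noteq> 0}"
    using C1_continuous[OF C1_polynomial[OF F(1)]] by (intro open_Collect_neq) auto
  then have S: "open S" "x \<in> S" using open_D x F(2)[OF T(2)] by (auto simp: S_def)
  have "x \<in> closure (interior T)" using mesh_closure_interior T by simp
  then have "S \<inter> interior T \<noteq> {}" using S open_Int_closure_eq_empty[OF S(1), of "interior T"] by blast
  then have "\<not> negligible (S \<inter> interior T)" using open_not_negligible[OF open_Int[OF S(1) open_interior]] by blast
  moreover have "negligible (S \<inter> interior T)"
  proof -
    have "AE y in lebesgue. y \<notin> S \<inter> interior T"
      using ae unfolding AE_D_iff
    proof eventually_elim
      case (elim y)
      show ?case
      proof
        assume y: "y \<in> S \<inter> interior T"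
        then have "v y = F y" using F(2) interior_subset by blast
        then show False using elim y by (auto simp: S_def)
      qed
    qed
    moreover have "S \<inter> interior T \<in> sets lebesgue" using S(1) by (intro sets_completionI_sets) (auto intro: borel_open)
    ultimately show ?thesis by (simp add: negligible_iff_null_sets AE_iff_null_sets)
  qed
  ultimately show False by blast
qed

text \<open>On \<open>D\<close> a function of \<open>V\<close> is a combination of monomials cut off
  to single simplices. These span \<open>V\<close> without having to lie in it, which is what
  \<open>orthonormal_basis_exists\<close> asks for.\<close>

lemma fe_finite_span:
  obtains N :: nat and b where "\<And>v. v \<in> V \<Longrightarrow> \<exists>c. \<forall>x. v x = (\<Sum>k<N. c k * b k x)"
proof -
  let ?M = "multi_indices (Basis :: 'a set) q"
  let ?I = "\<T> \<times> ?M"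
  \<comment> \<open>One simplex is chosen for each point, so that points on shared faces are not
    counted twice.\<close>
  define sel where "sel x = (SOME T. T \<in> \<T> \<and> x \<in> T)" for x
  have sel: "sel x \<in> \<T>" "x \<in> sel x" if "x \<in> D" for x
  proof -
    have "\<exists>T. T \<in> \<T> \<and> x \<in> T" using mesh_cover that by blast
    from someI_ex[OF this] show "sel x \<in> \<T>" "x \<in> sel x" by (auto simp: sel_def)
  qed
  define \<beta> where "\<beta> i x = (if x \<in> D \<and> sel x = fst i then (\<Prod>b\<in>Basis. (x \<bullet> b) ^ (snd i b)) else 0)"
    for i :: "'a set \<times> ('a \<Rightarrow> nat)" and x
  have fin: "finite ?I" using mesh_finite finite_multi_indices[OF finite_Basis] by blast
  obtain h where h: "bij_betw h {..<card ?I} ?I"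
    using ex_bij_betw_nat_finite[OF fin] by (metis atLeast0LessThan)
  show ?thesis
  proof (rule that[of "\<lambda>k. \<beta> (h k)" "card ?I"])
    fix v assume v: "v \<in> V"
    have "\<forall>T\<in>\<T>. \<exists>c. \<forall>x\<in>T. v x = (\<Sum>\<alpha>\<in>?M. c \<alpha> * (\<Prod>b\<in>Basis. (x \<bullet> b) ^ \<alpha> b))"
      using v unfolding fe_space_def polynomials_upto_def by fastforce
    then obtain C where C: "\<And>T x. T \<in> \<T> \<Longrightarrow> x \<in> T \<Longrightarrow> v x = (\<Sum>\<alpha>\<in>?M. C T \<alpha> * (\<Prod>b\<in>Basis. (x \<bullet> b) ^ \<alpha> b))"
      by metis
    have "v x = (\<Sum>k<card ?I. (C (fst (h k)) (snd (h k))) * \<beta> (h k) x)" for x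
    proof -
      have "(\<Sum>k<card ?I. (C (fst (h k)) (snd (h k))) * \<beta> (h k) x) = (\<Sum>i\<in>?I. C (fst i) (snd i) * \<beta> i x)"
        by (rule sum.reindex_bij_betw[OF h])
      also have "\<dots> = (\<Sum>T\<in>\<T>. \<Sum>\<alpha>\<in>?M. C T \<alpha> * \<beta> (T, \<alpha>) x)"
        by (simp add: sum.cartesian_product case_prod_unfold)
      also have "\<dots> = v x"
      proof (cases "x \<in> D")
        case True
        have "(\<Sum>T\<in>\<T>. \<Sum>\<alpha>\<in>?M. C T \<alpha> * \<beta> (T, \<alpha>) x) = (\<Sum>T\<in>\<T>. if T = sel x then v x else 0)"
        proof (intro sum.cong refl)
          fix T assume "T \<in> \<T>"
          show "(\<Sum>\<alpha>\<in>?M. C T \<alpha> * \<beta> (T, \<alpha>) x) = (if T = sel x then v x else 0)"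
            using C[OF sel[OF True]] True by (auto simp: \<beta>_def)
        qed
        then show ?thesis using mesh_finite sel[OF True] by simp
      next
        case False
        then show ?thesis using fe_outside[OF v] by (simp add: \<beta>_def)
      qed
      finally show ?thesis by simp
    qed
    then show "\<exists>c. \<forall>x. v x = (\<Sum>k<card ?I. c k * \<beta> (h k) x)"
      by (intro exI[of _ "\<lambda>k. C (fst (h k)) (snd (h k))"]) blast
  qed
qed

end

section \<open>Weighted energy forms on the finite element space\<close>

context finite_elements
begin

text \<open>The weight is a parameter because one form serves the random coefficient, the single
  modes, the Hermite coefficients and differences of coefficients. Classical gradients stand for the
  weak ones, with which they agree on \<open>V\<close>.\<close>

definition wip :: "('a \<Rightarrow> real) \<Rightarrow> ('a \<Rightarrow> real) \<Rightarrow> ('a \<Rightarrow> real) \<Rightarrow> real" where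
  "wip h u v = (\<integral>x. h x * (classical_grad u x \<bullet> classical_grad v x) \<partial>lebesgue_on D)"

abbreviation ip :: "('a \<Rightarrow> real) \<Rightarrow> ('a \<Rightarrow> real) \<Rightarrow> real" where
  "ip \<equiv> wip (\<lambda>_. 1)"

definition nrm :: "('a \<Rightarrow> real) \<Rightarrow> real" where
  "nrm u = sqrt (ip u u)"

definition weight :: "('a \<Rightarrow> real) \<Rightarrow> bool" where
  "weight h \<longleftrightarrow> h \<in> borel_measurable (lebesgue_on D) \<and> (\<exists>H. \<forall>x\<in>D. \<bar>h x\<bar> \<le> H)"

lemma weightI: "h \<in> borel_measurable (lebesgue_on D) \<Longrightarrow> (\<And>x. x \<in> D \<Longrightarrow> \<bar>h x\<bar> \<le> H) \<Longrightarrow> weight h"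
  unfolding weight_def by blast

lemma weight_const: "weight (\<lambda>_. c)"
  by (rule weightI[of _ "\<bar>c\<bar>"]) auto

lemma fe_sq: "u \<in> V \<Longrightarrow> square_integrable_on D u" "u \<in> V \<Longrightarrow> square_integrable_on D (classical_grad u)"
  using fe_has_weak_grad has_weak_gradD by blast+

lemma wip_integrable:
  assumes "weight h" "u \<in> V" "v \<in> V"
  shows "integrable (lebesgue_on D) (\<lambda>x. h x * (classical_grad u x \<bullet> classical_grad v x))"
  using assms square_integrable_on_weighted_inner[OF fe_sq(2) fe_sq(2)] unfolding weight_def by blast

text \<open>Classical gradients are additive where both functions are differentiable; on the
  skeleton \<open>frechet_derivative\<close> may be an arbitrary value.\<close>

lemma fe_grad_lincomb:
  assumes "u \<in> V" "v \<in> V" "x \<in> D - skeleton"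
  shows "classical_grad (\<lambda>x. a * u x + c * v x) x = a *\<^sub>R classical_grad u x + c *\<^sub>R classical_grad v x"
proof (rule classical_grad_eqI)
  have u: "GDERIV u x :> classical_grad u x" and v: "GDERIV v x :> classical_grad v x"
    using fe_differentiable assms GDERIV_classical_grad by blast+
  have "GDERIV (\<lambda>x. a * u x) x :> a *\<^sub>R classical_grad u x + u x *\<^sub>R 0"
    "GDERIV (\<lambda>x. c * v x) x :> c *\<^sub>R classical_grad v x + v x *\<^sub>R 0"
    by (intro GDERIV_mult GDERIV_const u v)+
  from GDERIV_add[OF this] show "GDERIV (\<lambda>x. a * u x + c * v x) x :> a *\<^sub>R classical_grad u x + c *\<^sub>R classical_grad v x"
    by simp
qed

lemma AE_off_skeleton: "(\<And>x. x \<in> D - skeleton \<Longrightarrow> Q x) \<Longrightarrow> AE x in lebesgue_on D. Q x"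
  by (rule AE_D_negligibleI[OF negligible_skeleton])

lemma fe_zero: "(\<lambda>x. 0) \<in> V"
proof -
  have t: "test_function D (\<lambda>x. 0)" by (simp add: test_function_iff C1_const)
  have sq: "square_integrable_on D (\<lambda>x. 0 :: real)" "square_integrable_on D (\<lambda>x. 0 :: 'a)"
    by (auto simp: square_integrable_on_def)
  have "has_weak_grad D (\<lambda>x. 0) (\<lambda>x. 0)"
    by (simp add: has_weak_grad_def sq)
  then have "(\<lambda>x. 0) \<in> H10 D"
    unfolding H10_def using t by (intro CollectI exI[of _ "\<lambda>x. 0"] conjI exI[of _ "\<lambda>n x. 0"]) (auto simp: C1_const)
  moreover have "(\<lambda>x. 0) \<in> polynomials_upto q"
    unfolding polynomials_upto_def by (intro CollectI exI[of _ "\<lambda>_. 0"]) simp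
  ultimately show ?thesis unfolding fe_space_def by auto
qed

lemma wip_commute: "wip h u v = wip h v u"
  by (simp add: wip_def inner_commute)

lemma wip_lincomb_left:
  assumes h: "weight h" and uvw: "u \<in> V" "v \<in> V" "w \<in> V"
  shows "wip h (\<lambda>x. a * u x + c * v x) w = a * wip h u w + c * wip h v w"
proof -
  note iu = wip_integrable[OF h uvw(1,3)] and iv = wip_integrable[OF h uvw(2,3)]
  note iw = wip_integrable[OF h fe_lincomb[OF uvw(1,2)] uvw(3)]
  have "wip h (\<lambda>x. a * u x + c * v x) w
    = (\<integral>x. a *\<^sub>R (h x * (classical_grad u x \<bullet> classical_grad w x)) + c *\<^sub>R (h x * (classical_grad v x \<bullet> classical_grad w x)) \<partial>lebesgue_on D)"
    unfolding wip_def
  proof (rule integral_cong_AE)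
    show "AE x in lebesgue_on D. h x * (classical_grad (\<lambda>x. a * u x + c * v x) x \<bullet> classical_grad w x)
      = a *\<^sub>R (h x * (classical_grad u x \<bullet> classical_grad w x)) + c *\<^sub>R (h x * (classical_grad v x \<bullet> classical_grad w x))"
      by (rule AE_off_skeleton) (simp add: fe_grad_lincomb[OF uvw(1,2)] inner_add_left algebra_simps)
    show "(\<lambda>x. h x * (classical_grad (\<lambda>x. a * u x + c * v x) x \<bullet> classical_grad w x)) \<in> borel_measurable (lebesgue_on D)"
      by (rule borel_measurable_integrable[OF iw])
    show "(\<lambda>x. a *\<^sub>R (h x * (classical_grad u x \<bullet> classical_grad w x)) + c *\<^sub>R (h x * (classical_grad v x \<bullet> classical_grad w x))) \<in> borel_measurable (lebesgue_on D)"
      by (intro borel_measurable_add borel_measurable_scaleR borel_measurable_const borel_measurable_integrable[OF iu] borel_measurable_integrable[OF iv])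
  qed
  also have "\<dots> = a *\<^sub>R wip h u w + c *\<^sub>R wip h v w"
    unfolding wip_def by (rule integral_scaleR_lincomb[OF iu iv])
  finally show ?thesis by simp
qed

lemma wip_weight_lincomb:
  assumes "weight h" "weight k" "u \<in> V" "v \<in> V"
  shows "wip (\<lambda>x. a * h x + c * k x) u v = a * wip h u v + c * wip k u v"
  using integral_scaleR_lincomb[OF wip_integrable[OF assms(1,3,4)] wip_integrable[OF assms(2,3,4)], of a c]
  by (simp add: wip_def distrib_right mult.assoc)

lemma wip_cmult: "wip (\<lambda>x. c * h x) u v = c * wip h u v"
  by (simp add: wip_def mult.assoc)

lemma wip_cong: "(\<And>x. x \<in> D \<Longrightarrow> h x = k x) \<Longrightarrow> wip h u v = wip k u v"
  unfolding wip_def by (rule Bochner_Integration.integral_cong) auto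

lemma wip_lower:
  assumes "weight h" "u \<in> V" "\<And>x. x \<in> D \<Longrightarrow> m \<le> h x"
  shows "m * ip u u \<le> wip h u u"
proof -
  have "(\<integral>x. m * (1 * (classical_grad u x \<bullet> classical_grad u x)) \<partial>lebesgue_on D) \<le> wip h u u"
    unfolding wip_def
    by (intro integral_mono integrable_mult_right wip_integrable assms weight_const)
      (auto intro!: mult_right_mono assms)
  then show ?thesis by (simp add: wip_def)
qed

lemma ip_nonneg: "ip u u \<ge> 0"
  unfolding wip_def by (intro integral_nonneg_AE AE_I2) simp

lemma nrm_nonneg: "nrm u \<ge> 0" and nrm_square: "(nrm u)\<^sup>2 = ip u u"
  using ip_nonneg by (auto simp: nrm_def)

lemma fe_poincare:
  obtains C where "C > 0" "\<And>v. v \<in> V \<Longrightarrow> (\<integral>x. (v x)\<^sup>2 \<partial>lebesgue_on D) \<le> C * ip v v"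
proof -
  obtain R where R: "R > 0" "D \<subseteq> cball 0 R"
    using bounded_D unfolding bounded_pos by (metis mem_cball_0 subsetI)
  show ?thesis
  proof (rule that[of "16 * R\<^sup>2"])
    show "16 * R\<^sup>2 > 0" using R by simp
    fix v assume v: "v \<in> V"
    show "(\<integral>x. (v x)\<^sup>2 \<partial>lebesgue_on D) \<le> 16 * R\<^sup>2 * ip v v"
      using H10_poincare[OF fe_H10[OF v] fe_has_weak_grad[OF v] R(2,1)]
      by (simp add: wip_def dot_square_norm)
  qed
qed

text \<open>The Poincare inequality gives \<open>v = 0\<close> almost everywhere, and
  \<open>fe_AE_zero\<close> removes the exceptional set.\<close>

lemma ip_eq_0:
  assumes v: "v \<in> V" "ip v v = 0"
  shows "v = (\<lambda>x. 0)"
proof -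
  obtain C where "(\<integral>x. (v x)\<^sup>2 \<partial>lebesgue_on D) \<le> C * ip v v" using fe_poincare v(1) by metis
  then have "(\<integral>x. (v x)\<^sup>2 \<partial>lebesgue_on D) \<le> 0" using v(2) by simp
  moreover have "(\<integral>x. (v x)\<^sup>2 \<partial>lebesgue_on D) \<ge> 0" by (intro integral_nonneg_AE AE_I2) simp
  ultimately have z: "(\<integral>x. (v x)\<^sup>2 \<partial>lebesgue_on D) = 0" by simp
  have "AE x in lebesgue_on D. (v x)\<^sup>2 = 0"
    using integral_nonneg_eq_0_iff_AE[of "lebesgue_on D" "\<lambda>x. (v x)\<^sup>2"] z square_integrable_onD(2)[OF fe_sq(1)[OF v(1)]] by simp
  then have "AE x in lebesgue_on D. v x = 0" by eventually_elim simp
  then show ?thesis by (rule fe_AE_zero[OF v(1)])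
qed

lemma ip_inner_function_space: "inner_function_space V ip"
  by (rule inner_function_space.intro)
    (assumption | rule fe_zero fe_lincomb wip_lincomb_left weight_const wip_commute ip_nonneg ip_eq_0)+

sublocale inner_function_space V ip
  by (rule ip_inner_function_space)

text \<open>The weight may change sign, so the form is not an inner product with a Cauchy-Schwarz
  inequality of its own. The inequality is applied to the gradients at each point instead, followed
  by Young's inequality with an optimised parameter.\<close>

lemma wip_bound:
  assumes h: "weight h" "\<And>x. x \<in> D \<Longrightarrow> \<bar>h x\<bar> \<le> H" "H \<ge> 0" and uv: "u \<in> V" "v \<in> V"
  shows "\<bar>wip h u v\<bar> \<le> H * (nrm u * nrm v)"
proof (cases "nrm u = 0 \<or> nrm v = 0")
  case True
  then have "u = (\<lambda>x. 0) \<or> v = (\<lambda>x. 0)" using ip_eq_0 uv unfolding nrm_def by auto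
  then have "wip h u v = 0" by (auto simp: wip_def C1_const(2))
  then show ?thesis using True by auto
next
  case False
  then have pos: "nrm u > 0" "nrm v > 0" using nrm_nonneg[of u] nrm_nonneg[of v] by auto
  \<comment> \<open>This choice balances the two terms of Young's inequality, so that they add up to
    exactly \<open>H * (nrm u * nrm v)\<close>.\<close>
  define t where "t = nrm v / nrm u"
  have t: "t > 0" using pos by (simp add: t_def)
  note i1 = wip_integrable[OF weight_const[of 1] uv(1) uv(1)] and i2 = wip_integrable[OF weight_const[of 1] uv(2) uv(2)]
  have "\<bar>wip h u v\<bar> \<le> (\<integral>x. \<bar>h x * (classical_grad u x \<bullet> classical_grad v x)\<bar> \<partial>lebesgue_on D)"
    unfolding wip_def by (rule integral_abs_bound)
  also have "\<dots> \<le> (\<integral>x. (H * t / 2) *\<^sub>R (1 * (classical_grad u x \<bullet> classical_grad u x)) + (H / (2 * t)) *\<^sub>R (1 * (classical_grad v x \<bullet> classical_grad v x)) \<partial>lebesgue_on D)"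
  proof (rule integral_mono)
    show "integrable (lebesgue_on D) (\<lambda>x. \<bar>h x * (classical_grad u x \<bullet> classical_grad v x)\<bar>)"
      using wip_integrable[OF h(1) uv] by (rule integrable_abs)
    show "integrable (lebesgue_on D) (\<lambda>x. (H * t / 2) *\<^sub>R (1 * (classical_grad u x \<bullet> classical_grad u x)) + (H / (2 * t)) *\<^sub>R (1 * (classical_grad v x \<bullet> classical_grad v x)))"
      by (intro Bochner_Integration.integrable_add integrable_scaleR_right i1 i2)
    fix x assume "x \<in> space (lebesgue_on D)"
    then have "\<bar>h x\<bar> \<le> H" using h(2) by simp
    define p q where "p = norm (classical_grad u x)" and "q = norm (classical_grad v x)"
    have "\<bar>classical_grad u x \<bullet> classical_grad v x\<bar> \<le> p * q"
      unfolding p_def q_def by (rule Cauchy_Schwarz_ineq2)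
    also have "p * q \<le> t / 2 * p\<^sup>2 + 1 / (2 * t) * q\<^sup>2"
      using zero_le_power2[of "t * p - q"] t by (simp add: field_simps power2_eq_square)
    finally have *: "\<bar>classical_grad u x \<bullet> classical_grad v x\<bar> \<le> t / 2 * p\<^sup>2 + 1 / (2 * t) * q\<^sup>2" .
    have "\<bar>h x * (classical_grad u x \<bullet> classical_grad v x)\<bar> \<le> H * (t / 2 * p\<^sup>2 + 1 / (2 * t) * q\<^sup>2)"
      unfolding abs_mult using * \<open>\<bar>h x\<bar> \<le> H\<close> by (intro mult_mono) (auto simp: h(3))
    also have "\<dots> = (H * t / 2) *\<^sub>R (1 * (classical_grad u x \<bullet> classical_grad u x)) + (H / (2 * t)) *\<^sub>R (1 * (classical_grad v x \<bullet> classical_grad v x))"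
      by (simp add: p_def q_def dot_square_norm algebra_simps)
    finally show "\<bar>h x * (classical_grad u x \<bullet> classical_grad v x)\<bar> \<le> \<dots>" .
  qed
  also have "\<dots> = (H * t / 2) *\<^sub>R ip u u + (H / (2 * t)) *\<^sub>R ip v v"
    unfolding wip_def by (rule integral_scaleR_lincomb[OF i1 i2])
  also have "\<dots> = H * (nrm u * nrm v)"
    using pos by (simp add: t_def nrm_square[symmetric] power2_eq_square)
  finally show ?thesis .
qed

lemma ip_bound: "u \<in> V \<Longrightarrow> v \<in> V \<Longrightarrow> \<bar>ip u v\<bar> \<le> nrm u * nrm v"
  using wip_bound[OF weight_const[of 1], of 1 u v] by simp

text \<open>Every energy estimate ends this way: one factor \<open>nrm u\<close> is divided out, the
  case \<open>nrm u = 0\<close> being trivial.\<close>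

lemma nrm_leI:
  assumes "u \<in> V" "ip u u \<le> B * nrm u" "B \<ge> 0"
  shows "nrm u \<le> B"
proof (cases "nrm u = 0")
  case False
  then have "nrm u > 0" using nrm_nonneg[of u] by simp
  moreover have "nrm u * nrm u \<le> B * nrm u" using assms(2) nrm_square[of u] by (simp add: power2_eq_square)
  ultimately show ?thesis by simp
qed (use assms in simp)

lemma wip_sum_right:
  assumes "weight h" "u \<in> V" "\<And>i. i \<in> I \<Longrightarrow> e i \<in> V"
  shows "wip h u (\<lambda>x. \<Sum>i\<in>I. d i * e i x) = (\<Sum>i\<in>I. d i * wip h u (e i))"
proof (cases "finite I")
  case True
  then show ?thesis using assms(3)
  proof (induction I rule: finite_induct)
    case empty
    show ?case by (simp add: wip_def C1_const(2))
  next
    case (insert i I)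
    have "wip h (\<lambda>x. d i * e i x + 1 * (\<Sum>i\<in>I. d i * e i x)) u = d i * wip h (e i) u + 1 * wip h (\<lambda>x. \<Sum>i\<in>I. d i * e i x) u"
      using insert assms(1,2) by (intro wip_lincomb_left sum_mem) auto
    then show ?case using insert by (simp add: wip_commute)
  qed
qed (simp add: wip_def C1_const(2))

lemma nrm_zero: "nrm (\<lambda>x. 0) = 0"
  using ip_zero_left[OF fe_zero] by (simp add: nrm_def)

lemma nrm_lincomb:
  assumes "u \<in> V" "v \<in> V"
  shows "nrm (\<lambda>x. a * u x + c * v x) \<le> \<bar>a\<bar> * nrm u + \<bar>c\<bar> * nrm v"
proof (rule nrm_leI)
  let ?w = "\<lambda>x. a * u x + c * v x"
  show w: "?w \<in> V" by (rule fe_lincomb[OF assms])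
  have "ip ?w ?w = a * ip u ?w + c * ip v ?w"
    by (rule wip_lincomb_left[OF weight_const assms w])
  also have "\<dots> \<le> \<bar>a\<bar> * (nrm u * nrm ?w) + \<bar>c\<bar> * (nrm v * nrm ?w)"
    using mult_left_mono[OF ip_bound[OF assms(1) w], of "\<bar>a\<bar>"] mult_left_mono[OF ip_bound[OF assms(2) w], of "\<bar>c\<bar>"]
    by (simp add: abs_mult[symmetric])
  finally show "ip ?w ?w \<le> (\<bar>a\<bar> * nrm u + \<bar>c\<bar> * nrm v) * nrm ?w" by (simp add: algebra_simps)
qed (simp add: nrm_nonneg)

lemma nrm_sum:
  assumes "\<And>i. i \<in> I \<Longrightarrow> e i \<in> V"
  shows "nrm (\<lambda>x. \<Sum>i\<in>I. d i * e i x) \<le> (\<Sum>i\<in>I. \<bar>d i\<bar> * nrm (e i))"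
proof (cases "finite I")
  case True
  then show ?thesis using assms
  proof (induction I rule: finite_induct)
    case (insert i I)
    have "nrm (\<lambda>x. d i * e i x + 1 * (\<Sum>i\<in>I. d i * e i x)) \<le> \<bar>d i\<bar> * nrm (e i) + \<bar>1\<bar> * nrm (\<lambda>x. \<Sum>i\<in>I. d i * e i x)"
      using insert by (intro nrm_lincomb sum_mem) auto
    moreover have "nrm (\<lambda>x. \<Sum>i\<in>I. d i * e i x) \<le> (\<Sum>i\<in>I. \<bar>d i\<bar> * nrm (e i))"
      using insert by blast
    ultimately show ?case using insert by simp
  qed (simp add: nrm_zero)
qed (simp add: nrm_zero)

text \<open>Testing with the difference and definiteness. It turns the tested equations of model II
  into identities between functions.\<close>

lemma fe_eqI:
  assumes "u \<in> V" "v \<in> V" "\<And>w. w \<in> V \<Longrightarrow> ip u w = ip v w"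
  shows "u = v"
proof -
  define d where "d x = 1 * u x + (-1) * v x" for x
  have d: "d \<in> V" unfolding d_def[abs_def] by (rule fe_lincomb[OF assms(1,2)])
  have "ip d d = 1 * ip u d + (-1) * ip v d"
    using wip_lincomb_left[OF weight_const assms(1,2) d, of 1 1 "-1"] by (simp add: d_def[abs_def])
  then have "ip d d = 0" using assms(3)[OF d] by simp
  then have "d = (\<lambda>x. 0)" by (rule ip_eq_0[OF d])
  then have "u x = v x" for x using d_def[of x] by simp
  then show ?thesis by auto
qed

end

section \<open>Coordinates in an orthonormal basis\<close>

locale fe_basis = finite_elements D \<T> q for D :: "'a::euclidean_space set" and \<T> q +
  fixes n :: nat and e :: "nat \<Rightarrow> 'a \<Rightarrow> real"
  assumes e_mem: "i < n \<Longrightarrow> e i \<in> V"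
    and e_orth: "i < n \<Longrightarrow> j < n \<Longrightarrow> ip (e i) (e j) = (if i = j then 1 else 0)"
    and e_expand: "v \<in> V \<Longrightarrow> v x = (\<Sum>i<n. ip v (e i) * e i x)"
begin

lemma ip_e:
  assumes "j < n"
  shows "ip (\<lambda>x. \<Sum>i<n. d i * e i x) (e j) = d j"
proof -
  have "ip (\<lambda>x. \<Sum>i<n. d i * e i x) (e j) = (\<Sum>i<n. d i * ip (e i) (e j))"
    by (rule ip_sum_left) (use e_mem assms in auto)
  also have "\<dots> = (\<Sum>i<n. if i = j then d j else 0)"
    using e_orth assms by (intro sum.cong) auto
  also have "\<dots> = d j" using assms by simp
  finally show ?thesis .
qed

lemma e_sum_mem: "(\<lambda>x. \<Sum>i<n. d i * e i x) \<in> V"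
  using sum_mem[of "{..<n}" e] e_mem by simp

lemma parseval:
  assumes "u \<in> V" "v \<in> V"
  shows "ip u v = (\<Sum>i<n. ip u (e i) * ip v (e i))"
proof -
  have "v = (\<lambda>x. \<Sum>i<n. ip v (e i) * e i x)" using e_expand[OF assms(2)] by (rule ext)
  then have "ip u v = ip u (\<lambda>x. \<Sum>i<n. ip v (e i) * e i x)" by simp
  also have "\<dots> = (\<Sum>i<n. ip v (e i) * ip u (e i))"
    by (rule wip_sum_right) (use assms e_mem weight_const in auto)
  finally show ?thesis by (simp add: mult.commute)
qed

text \<open>In an orthonormal basis the representative is written down by its coordinates. The minus
  sign suits a perturbation of the coefficient moved to the right-hand side.\<close>

lemma riesz:
  assumes h: "weight h" and u: "u \<in> V"
  obtains w where "w \<in> V" "\<And>v. v \<in> V \<Longrightarrow> ip w v = - wip h u v"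
proof (rule that)
  let ?w = "\<lambda>x. \<Sum>i<n. (- wip h u (e i)) * e i x"
  show w: "?w \<in> V" by (rule e_sum_mem)
  fix v assume v: "v \<in> V"
  have "v = (\<lambda>x. \<Sum>i<n. ip v (e i) * e i x)" using e_expand[OF v] by (rule ext)
  then have "wip h u v = wip h u (\<lambda>x. \<Sum>i<n. ip v (e i) * e i x)" by simp
  also have "\<dots> = (\<Sum>i<n. ip v (e i) * wip h u (e i))"
    by (rule wip_sum_right) (use assms e_mem in auto)
  finally have *: "wip h u v = (\<Sum>i<n. ip v (e i) * wip h u (e i))" .
  have "ip ?w v = (\<Sum>i<n. ip ?w (e i) * ip v (e i))" by (rule parseval[OF w v])
  also have "\<dots> = (\<Sum>i<n. (- wip h u (e i)) * ip v (e i))"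
    by (intro sum.cong refl) (simp only: ip_e lessThan_iff)
  also have "\<dots> = - wip h u v" unfolding * by (simp add: sum_negf mult.commute)
  finally show "ip ?w v = - wip h u v" .
qed

lemma abs_coord_le: "v \<in> V \<Longrightarrow> j < n \<Longrightarrow> \<bar>ip v (e j)\<bar> \<le> nrm v"
  using ip_bound[OF _ e_mem, of v j] e_orth[of j j] by (simp add: nrm_def)

end

lemma (in finite_elements) fe_basis_exists: "\<exists>n e. fe_basis D \<T> q n e"
proof -
  have "\<exists>(N::nat) b. \<forall>v\<in>V. \<exists>c. \<forall>x. v x = (\<Sum>k<N. c k * b k x)"
  proof (rule fe_finite_span)
    fix N :: nat and b
    assume "\<And>v. v \<in> V \<Longrightarrow> \<exists>c. \<forall>x. v x = (\<Sum>k<N. c k * b k x)"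
    then show ?thesis by (intro exI[of _ N] exI[of _ b] ballI)
  qed
  then obtain N :: nat and b where b: "\<forall>v\<in>V. \<exists>c. \<forall>x. v x = (\<Sum>k<N. c k * b k x)"
    by (elim exE)
  have "\<exists>(n::nat) e. (\<forall>i<n. e i \<in> V) \<and> (\<forall>i<n. \<forall>j<n. ip (e i) (e j) = (if i = j then 1 else 0)) \<and>
    (\<forall>v\<in>V. \<forall>x. v x = (\<Sum>i<n. ip v (e i) * e i x))"
    by (rule orthonormal_basis_exists[OF ip_inner_function_space]) (rule bspec[OF b])
  then obtain n :: nat and e where e: "\<forall>i<n. e i \<in> V" "\<forall>i<n. \<forall>j<n. ip (e i) (e j) = (if i = j then 1 else 0)"
    "\<forall>v\<in>V. \<forall>x. v x = (\<Sum>i<n. ip v (e i) * e i x)"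
    by (elim exE conjE)
  have "fe_basis D \<T> q n e"
  proof (intro fe_basis.intro fe_basis_axioms.intro)
    show "finite_elements D \<T>" by (rule finite_elements_axioms)
  qed (use e in simp_all)
  then show ?thesis by (intro exI)
qed

section \<open>The finite element problems\<close>

text \<open>The l1 norm is used because it bounds the field, whose modes are at most 1 in absolute
  value, and because its exponential factors over the coordinates.\<close>

definition ell :: "nat \<Rightarrow> (nat \<Rightarrow> real) \<Rightarrow> real" where
  "ell M y = (\<Sum>k<M. \<bar>y k\<bar>)"

text \<open>A growth class that is closed under sums and products, contains the Hermite polynomials
  and the bounds on the solutions, and has finite Gaussian moments.\<close>

definition exp_bounded :: "nat \<Rightarrow> ((nat \<Rightarrow> real) \<Rightarrow> real) \<Rightarrow> bool" where
  "exp_bounded M g \<longleftrightarrow> (\<exists>C c. 0 \<le> C \<and> 0 \<le> c \<and> (\<forall>y. \<bar>g y\<bar> \<le> C * exp (c * ell M y)))"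

lemma ell_nonneg: "0 \<le> ell M y"
  unfolding ell_def by (intro sum_nonneg) simp

lemma exp_boundedI:
  assumes "\<And>y. \<bar>g y\<bar> \<le> C * exp (c * ell M y)" "0 \<le> C" "0 \<le> c"
  shows "exp_bounded M g"
  using assms unfolding exp_bounded_def by blast

lemma exp_bounded_le:
  assumes "exp_bounded M g" "\<And>y. \<bar>h y\<bar> \<le> \<bar>g y\<bar>"
  shows "exp_bounded M h"
  using assms unfolding exp_bounded_def by (meson order_trans)

lemma exp_bounded_const: "exp_bounded M (\<lambda>_. c)"
  by (rule exp_boundedI[of _ "\<bar>c\<bar>" 0]) auto

lemma exp_bounded_exp: "0 \<le> c \<Longrightarrow> exp_bounded M (\<lambda>y. exp (c * ell M y))"
  by (rule exp_boundedI[of _ 1 c]) auto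

lemma exp_bounded_mult:
  assumes "exp_bounded M g" "exp_bounded M h"
  shows "exp_bounded M (\<lambda>y. g y * h y)"
proof -
  obtain C c where 1: "0 \<le> C" "0 \<le> c" "\<And>y. \<bar>g y\<bar> \<le> C * exp (c * ell M y)"
    using assms(1) unfolding exp_bounded_def by blast
  obtain B b where 2: "0 \<le> B" "0 \<le> b" "\<And>y. \<bar>h y\<bar> \<le> B * exp (b * ell M y)"
    using assms(2) unfolding exp_bounded_def by blast
  show ?thesis
  proof (rule exp_boundedI[of _ "C * B" "c + b"])
    fix y
    have "\<bar>g y * h y\<bar> \<le> (C * exp (c * ell M y)) * (B * exp (b * ell M y))"
      unfolding abs_mult using 1 2 by (intro mult_mono) auto
    also have "\<dots> = C * B * exp ((c + b) * ell M y)" by (simp add: distrib_right exp_add)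
    finally show "\<bar>g y * h y\<bar> \<le> C * B * exp ((c + b) * ell M y)" .
  qed (use 1 2 in auto)
qed

lemma exp_bounded_add:
  assumes "exp_bounded M g" "exp_bounded M h"
  shows "exp_bounded M (\<lambda>y. g y + h y)"
proof -
  obtain C c where 1: "0 \<le> C" "0 \<le> c" "\<And>y. \<bar>g y\<bar> \<le> C * exp (c * ell M y)"
    using assms(1) unfolding exp_bounded_def by blast
  obtain B b where 2: "0 \<le> B" "0 \<le> b" "\<And>y. \<bar>h y\<bar> \<le> B * exp (b * ell M y)"
    using assms(2) unfolding exp_bounded_def by blast
  show ?thesis
  proof (rule exp_boundedI[of _ "C + B" "c + b"])
    fix y
    have "\<bar>g y + h y\<bar> \<le> C * exp (c * ell M y) + B * exp (b * ell M y)"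
      using 1(3)[of y] 2(3)[of y] by linarith
    also have "\<dots> \<le> C * exp ((c + b) * ell M y) + B * exp ((c + b) * ell M y)"
      using 1 2 ell_nonneg[of M y] by (intro add_mono mult_left_mono) (auto intro: mult_right_mono)
    also have "\<dots> = (C + B) * exp ((c + b) * ell M y)" by (simp add: distrib_right)
    finally show "\<bar>g y + h y\<bar> \<le> (C + B) * exp ((c + b) * ell M y)" .
  qed (use 1 2 in auto)
qed

lemma exp_bounded_sum: "(\<And>i. i \<in> I \<Longrightarrow> exp_bounded M (g i)) \<Longrightarrow> exp_bounded M (\<lambda>y. \<Sum>i\<in>I. g i y)"
  by (induction I rule: infinite_finite_induct) (auto intro: exp_bounded_add exp_bounded_const)

lemma exp_bounded_prod: "(\<And>i. i \<in> I \<Longrightarrow> exp_bounded M (g i)) \<Longrightarrow> exp_bounded M (\<lambda>y. \<Prod>i\<in>I. g i y)"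
  by (induction I rule: infinite_finite_induct) (auto intro: exp_bounded_mult exp_bounded_const)

lemma exp_bounded_abs: "exp_bounded M g \<Longrightarrow> exp_bounded M (\<lambda>y. \<bar>g y\<bar>)"
  by (rule exp_bounded_le) auto

lemma exp_bounded_coord: "k < M \<Longrightarrow> exp_bounded M (\<lambda>y. y k)"
proof (rule exp_boundedI[of _ 1 1])
  fix y :: "nat \<Rightarrow> real" assume "k < M"
  then have "\<bar>y k\<bar> \<le> ell M y" unfolding ell_def by (intro member_le_sum) auto
  also have "\<dots> \<le> exp (ell M y)" using exp_ge_add_one_self[of "ell M y"] by linarith
  finally show "\<bar>y k\<bar> \<le> 1 * exp (1 * ell M y)" by simp
qed auto

lemma exp_bounded_hermite:
  assumes k: "k < M"
  shows "exp_bounded M (\<lambda>y. hermite m (y k))"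
proof (induction m rule: less_induct)
  case (less m)
  consider "m = 0" | "m = Suc 0" | m' where "m = Suc (Suc m')" by (metis not0_implies_Suc)
  then show ?case
  proof cases
    case 3
    then have "exp_bounded M (\<lambda>y. y k * hermite (Suc m') (y k) + (- real (Suc m')) * hermite m' (y k))"
      by (intro exp_bounded_add exp_bounded_mult exp_bounded_const exp_bounded_coord k less) auto
    then show ?thesis unfolding 3 hermite.simps by (simp only: mult_minus_left add_uminus_conv_diff)
  qed (use k in \<open>simp_all add: exp_bounded_const exp_bounded_coord\<close>)
qed

lemma exp_bounded_hermite_multi: "exp_bounded M (hermite_multi M \<alpha>)"
  unfolding hermite_multi_def[abs_def] by (intro exp_bounded_prod exp_bounded_hermite) auto

text \<open>Everything follows from \<open>1 + z \<le> exp z\<close> at \<open>z\<close> and at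
  \<open>-z\<close>, which puts \<open>exp z - 1\<close> between \<open>z\<close> and
  \<open>z * exp z\<close>; the second bound inserts the first into
  \<open>exp z - 1 - z \<le> z * (exp z - 1)\<close>.\<close>

lemma exp_minus_one_bounds:
  fixes z :: real
  shows "\<bar>exp z - 1\<bar> \<le> \<bar>z\<bar> * exp \<bar>z\<bar>" "\<bar>exp z - 1 - z\<bar> \<le> z\<^sup>2 * exp \<bar>z\<bar>"
proof -
  have lo: "z \<le> exp z - 1" using exp_ge_add_one_self[of z] by linarith
  have "(1 - z) * exp z \<le> exp (-z) * exp z"
    using exp_ge_add_one_self[of "-z"] by (intro mult_right_mono) auto
  then have up: "exp z - 1 \<le> z * exp z" by (simp add: exp_minus algebra_simps)
  have "z * exp z \<le> \<bar>z\<bar> * exp \<bar>z\<bar>" by (intro mult_mono) auto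
  moreover have "\<bar>z\<bar> * 1 \<le> \<bar>z\<bar> * exp \<bar>z\<bar>" by (intro mult_left_mono) auto
  ultimately show 1: "\<bar>exp z - 1\<bar> \<le> \<bar>z\<bar> * exp \<bar>z\<bar>" using lo up by linarith
  have "exp z - 1 - z \<le> z * (exp z - 1)" using up by (simp add: algebra_simps)
  also have "\<dots> \<le> \<bar>z\<bar> * \<bar>exp z - 1\<bar>" by (metis abs_ge_self abs_mult)
  also have "\<dots> \<le> \<bar>z\<bar> * (\<bar>z\<bar> * exp \<bar>z\<bar>)" by (intro mult_left_mono 1) simp
  also have "\<dots> = z\<^sup>2 * exp \<bar>z\<bar>" by (simp add: power2_eq_square abs_mult_self_eq flip: mult.assoc)
  finally show "\<bar>exp z - 1 - z\<bar> \<le> z\<^sup>2 * exp \<bar>z\<bar>" using lo by linarith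
qed

text \<open>A mean value bound, again from \<open>1 + x \<le> exp x\<close>, now with
  \<open>x\<close> the difference of the exponents.\<close>

lemma exp_diff_bound:
  fixes a b :: real
  assumes "a \<le> c" "b \<le> c"
  shows "\<bar>exp a - exp b\<bar> \<le> \<bar>a - b\<bar> * exp c"
proof -
  have *: "exp s - exp t \<le> (s - t) * exp s" for s t :: real
  proof -
    have "(1 + (t - s)) * exp s \<le> exp (t - s) * exp s"
      by (intro mult_right_mono exp_ge_add_one_self) auto
    then show ?thesis by (simp add: algebra_simps flip: exp_add)
  qed
  have "(a - b) * exp a \<le> \<bar>a - b\<bar> * exp c" "(b - a) * exp b \<le> \<bar>a - b\<bar> * exp c"
    using assms by (intro mult_mono; auto)+
  then show ?thesis using *[of a b] *[of b a] by linarith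
qed

text \<open>\<open>phi_bound\<close> is what is kept of the Karhunen-Loeve normalisation: each term
  of a nonnegative series with sum 1 is at most 1. The solutions are families in \<sigma>, since the
  rate concerns \<sigma> tending to 0.\<close>

locale model_problem = fe_basis D \<T> q n e
  for D :: "'a::euclidean_space set" and \<T> q n e +
  fixes f :: "'a \<Rightarrow> real" and lam :: "nat \<Rightarrow> real" and \<phi> :: "nat \<Rightarrow> 'a \<Rightarrow> real" and M p :: nat
    and uI :: "real \<Rightarrow> (nat \<Rightarrow> real) \<Rightarrow> 'a \<Rightarrow> real"
    and uII :: "real \<Rightarrow> (nat \<Rightarrow> nat) \<Rightarrow> 'a \<Rightarrow> real"
  assumes phi_measurable: "\<phi> k \<in> borel_measurable (lebesgue_on D)"
    and phi_bound: "x \<in> D \<Longrightarrow> \<bar>sqrt (lam k) * \<phi> k x\<bar> \<le> 1"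
    and model_I: "0 < \<sigma> \<Longrightarrow> model_I_solution D V f M lam \<phi> \<sigma> (uI \<sigma>)"
    and model_II: "0 < \<sigma> \<Longrightarrow> model_II_solution D V f M p lam \<phi> \<sigma> (uII \<sigma>)"
begin

definition mode :: "nat \<Rightarrow> 'a \<Rightarrow> real" where "mode k x = sqrt (lam k) * \<phi> k x"

definition field :: "(nat \<Rightarrow> real) \<Rightarrow> 'a \<Rightarrow> real" where "field y x = (\<Sum>k<M. y k * mode k x)"

definition coeff :: "real \<Rightarrow> (nat \<Rightarrow> real) \<Rightarrow> 'a \<Rightarrow> real" where
  "coeff \<sigma> y x = exp (\<sigma> * field y x - \<sigma>\<^sup>2 / 2)"

abbreviation params :: "(nat \<Rightarrow> real) set" where "params \<equiv> {..<M} \<rightarrow>\<^sub>E UNIV"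

lemma lognormal_coeff_eq: "lognormal_coeff M lam \<phi> \<sigma> x y = coeff \<sigma> y x"
  by (simp add: lognormal_coeff_def coeff_def field_def Phi1_def mode_def sum_distrib_left mult.assoc mult.left_commute mult.commute)

lemma mode_weight: "weight (mode k)"
  unfolding mode_def[abs_def] using phi_bound phi_measurable by (intro weightI[of _ 1]) auto

lemma mode_bound: "x \<in> D \<Longrightarrow> \<bar>mode k x\<bar> \<le> 1"
  unfolding mode_def by (rule phi_bound)

lemma field_bound: "x \<in> D \<Longrightarrow> \<bar>field y x\<bar> \<le> ell M y"
proof -
  assume x: "x \<in> D"
  have "\<bar>field y x\<bar> \<le> (\<Sum>k<M. \<bar>y k * mode k x\<bar>)" unfolding field_def by (rule sum_abs)
  also have "\<dots> \<le> (\<Sum>k<M. \<bar>y k\<bar> * 1)"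
    unfolding abs_mult by (intro sum_mono mult_left_mono mode_bound x) simp
  finally show ?thesis by (simp add: ell_def)
qed

lemma field_measurable: "field y \<in> borel_measurable (lebesgue_on D)"
  unfolding field_def[abs_def] using mode_weight
  by (intro borel_measurable_sum borel_measurable_times borel_measurable_const) (auto simp: weight_def)

lemma field_weight: "weight (field y)"
  using field_bound field_measurable by (intro weightI[of _ "ell M y"]) auto

lemma coeff_measurable: "coeff \<sigma> y \<in> borel_measurable (lebesgue_on D)"
  unfolding coeff_def[abs_def] using field_measurable[of y] by measurable

lemma coeff_bounds:
  assumes "0 < \<sigma>" "x \<in> D"
  shows "coeff \<sigma> y x \<le> exp (\<sigma> * ell M y)" "exp (- (\<sigma> * ell M y + \<sigma>\<^sup>2 / 2)) \<le> coeff \<sigma> y x"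
proof -
  have "\<bar>\<sigma> * field y x\<bar> \<le> \<sigma> * ell M y"
    using field_bound[OF assms(2), of y] assms(1) by (simp add: abs_mult)
  then show "coeff \<sigma> y x \<le> exp (\<sigma> * ell M y)" "exp (- (\<sigma> * ell M y + \<sigma>\<^sup>2 / 2)) \<le> coeff \<sigma> y x"
    using zero_le_power2[of \<sigma>] unfolding coeff_def exp_le_cancel_iff by linarith+
qed

lemma coeff_weight: "0 < \<sigma> \<Longrightarrow> weight (coeff \<sigma> y)"
  using coeff_bounds coeff_measurable by (intro weightI[of _ "exp (\<sigma> * ell M y)"]) (auto simp: coeff_def)

lemma wip_field:
  assumes "u \<in> V" "v \<in> V"
  shows "wip (field y) u v = (\<Sum>k<M. y k * wip (mode k) u v)"
proof -
  have "wip (field y) u v = (\<integral>x. (\<Sum>k<M. y k * (mode k x * (classical_grad u x \<bullet> classical_grad v x))) \<partial>lebesgue_on D)"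
    unfolding wip_def field_def by (simp add: sum_distrib_right mult.assoc)
  also have "\<dots> = (\<Sum>k<M. \<integral>x. y k * (mode k x * (classical_grad u x \<bullet> classical_grad v x)) \<partial>lebesgue_on D)"
    by (intro Bochner_Integration.integral_sum integrable_mult_right wip_integrable mode_weight assms)
  finally show ?thesis by (simp add: wip_def)
qed

section \<open>Stability of model I and measurability in the parameters\<close>

lemma uI_mem: "0 < \<sigma> \<Longrightarrow> y \<in> params \<Longrightarrow> uI \<sigma> y \<in> V"
  using model_I unfolding model_I_solution_def by blast

text \<open>At \<open>\<sigma> = 1\<close> and zero parameters the coefficient is the constant
  \<open>exp (-1/2)\<close>, so rescaling that solution gives the one for coefficient 1. The term
  with factor 0 brings it into the form of \<open>fe_lincomb\<close>.\<close>

definition u0 :: "'a \<Rightarrow> real" where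
  "u0 x = exp (-1/2) * uI 1 (\<lambda>k\<in>{..<M}. 0) x + 0 * uI 1 (\<lambda>k\<in>{..<M}. 0) x"

lemma model_I_load:
  assumes "0 < \<sigma>" "y \<in> params" "v \<in> V"
  shows "wip (coeff \<sigma> y) (uI \<sigma> y) v = (\<integral>x. f x * v x \<partial>lebesgue_on D)"
proof -
  have "(\<integral>x. lognormal_coeff M lam \<phi> \<sigma> x y * (weak_grad D (uI \<sigma> y) x \<bullet> weak_grad D v x) \<partial>lebesgue_on D)
              = (\<integral>x. f x * v x \<partial>lebesgue_on D)"
    using model_I[OF assms(1)] assms(2,3) unfolding model_I_solution_def by blast
  then show ?thesis
    by (simp add: fe_weak_grad[OF uI_mem[OF assms(1,2)]] fe_weak_grad[OF assms(3)] lognormal_coeff_eq wip_def)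
qed

lemma u0_mem: "u0 \<in> V"
  unfolding u0_def[abs_def] by (intro fe_lincomb uI_mem) auto

lemma ip_u0: 
  assumes v: "v \<in> V"
  shows "ip u0 v = (\<integral>x. f x * v x \<partial>lebesgue_on D)"
proof -
  let ?z = "\<lambda>k\<in>{..<M}. 0 :: real"
  have z: "?z \<in> params" by auto
  have zV: "uI 1 ?z \<in> V" by (rule uI_mem[OF _ z]) simp
  have "ip u0 v = exp (-1/2) * ip (uI 1 ?z) v + 0 * ip (uI 1 ?z) v"
    unfolding u0_def[abs_def] by (rule wip_lincomb_left[OF weight_const zV zV v])
  also have "\<dots> = wip (\<lambda>x. exp (-1/2) * 1) (uI 1 ?z) v" unfolding wip_cmult by simp
  also have "\<dots> = wip (coeff 1 ?z) (uI 1 ?z) v"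
    by (rule wip_cong) (simp add: coeff_def field_def)
  also have "\<dots> = (\<integral>x. f x * v x \<partial>lebesgue_on D)"
    by (rule model_I_load[OF _ z v]) simp
  finally show ?thesis .
qed

text \<open>From here on the load enters through \<open>u0\<close> alone, which makes the two models
  comparable in one inner product.\<close>

lemma model_I_wip: "0 < \<sigma> \<Longrightarrow> y \<in> params \<Longrightarrow> v \<in> V \<Longrightarrow> wip (coeff \<sigma> y) (uI \<sigma> y) v = ip u0 v"
  by (simp add: model_I_load ip_u0)

text \<open>The coefficient is at least
  \<open>exp (- (\<sigma> * ell M y + \<sigma>\<^sup>2 / 2))\<close>, and the reciprocal of this
  bound is the factor paid. This one estimate serves the size, the parameter dependence and the
  expansion of \<open>uI\<close>.\<close>

lemma coercive:
  assumes "0 < \<sigma>" "w \<in> V" "0 \<le> B" "wip (coeff \<sigma> y) w w \<le> B * nrm w"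
  shows "nrm w \<le> B * exp (\<sigma> * ell M y + \<sigma>\<^sup>2 / 2)"
proof (rule nrm_leI[OF assms(2)])
  have "exp (- (\<sigma> * ell M y + \<sigma>\<^sup>2 / 2)) * ip w w \<le> B * nrm w"
    using wip_lower[OF coeff_weight[OF assms(1), of y] assms(2) coeff_bounds(2)[OF assms(1)]] assms(4) by linarith
  then have "exp (\<sigma> * ell M y + \<sigma>\<^sup>2 / 2) * (exp (- (\<sigma> * ell M y + \<sigma>\<^sup>2 / 2)) * ip w w)
      \<le> exp (\<sigma> * ell M y + \<sigma>\<^sup>2 / 2) * (B * nrm w)"
    by (intro mult_left_mono) auto
  moreover have "exp (\<sigma> * ell M y + \<sigma>\<^sup>2 / 2) * exp (- (\<sigma> * ell M y + \<sigma>\<^sup>2 / 2)) = 1"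
    by (simp only: flip: exp_add) simp
  ultimately have "ip w w \<le> exp (\<sigma> * ell M y + \<sigma>\<^sup>2 / 2) * (B * nrm w)"
    by (simp only: mult.assoc[symmetric] mult_1)
  then show "ip w w \<le> B * exp (\<sigma> * ell M y + \<sigma>\<^sup>2 / 2) * nrm w"
    by (simp only: mult.assoc mult.left_commute)
  show "0 \<le> B * exp (\<sigma> * ell M y + \<sigma>\<^sup>2 / 2)" using assms(3) by simp
qed

lemma uI_bound:
  assumes "0 < \<sigma>" "y \<in> params"
  shows "nrm (uI \<sigma> y) \<le> nrm u0 * exp (\<sigma> * ell M y + \<sigma>\<^sup>2 / 2)"
proof (rule coercive[OF assms(1) uI_mem[OF assms] nrm_nonneg])
  show "wip (coeff \<sigma> y) (uI \<sigma> y) (uI \<sigma> y) \<le> nrm u0 * nrm (uI \<sigma> y)"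
    using ip_bound[OF u0_mem uI_mem[OF assms]] model_I_wip[OF assms uI_mem[OF assms]] by linarith
qed

text \<open>This is the source of measurability in the parameters. The difference solves a problem
  with the coefficient at \<open>z\<close>, driven by the difference of the coefficients acting on
  \<open>uI \<sigma> y\<close>. Since \<open>ell M z \<le> ell M y + \<delta>\<close>, the bound
  involves only \<open>y\<close> and \<delta>, and it tends to 0 with \<delta>.\<close>

lemma uI_lipschitz:
  assumes \<sigma>: "0 < \<sigma>" and y: "y \<in> params" "z \<in> params"
    and \<delta>: "\<delta> = (\<Sum>k<M. \<bar>z k - y k\<bar>)"
  shows "nrm (\<lambda>x. 1 * uI \<sigma> z x + (-1) * uI \<sigma> y x)
    \<le> (\<sigma> * \<delta> * exp (\<sigma> * (ell M y + \<delta>))) * nrm (uI \<sigma> y) * exp (\<sigma> * (ell M y + \<delta>) + \<sigma>\<^sup>2 / 2)"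
proof -
  let ?w = "\<lambda>x. 1 * uI \<sigma> z x + (-1) * uI \<sigma> y x"
  let ?H = "\<sigma> * \<delta> * exp (\<sigma> * (ell M y + \<delta>))"
  have w: "?w \<in> V" by (intro fe_lincomb uI_mem \<sigma> y)
  have \<delta>0: "\<delta> \<ge> 0" unfolding \<delta> by (intro sum_nonneg) simp
  have ellz: "ell M z \<le> ell M y + \<delta>"
    unfolding ell_def \<delta> sum.distrib[symmetric] by (intro sum_mono) linarith
  have H0: "?H \<ge> 0" using \<sigma> \<delta>0 by simp
  have fd: "\<bar>field y x - field z x\<bar> \<le> \<delta>" if x: "x \<in> D" for x
  proof -
    have "\<bar>field y x - field z x\<bar> = \<bar>\<Sum>k<M. (y k - z k) * mode k x\<bar>"
      by (simp add: field_def sum_subtractf algebra_simps)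
    also have "\<dots> \<le> (\<Sum>k<M. \<bar>(y k - z k) * mode k x\<bar>)" by (rule sum_abs)
    also have "\<dots> \<le> (\<Sum>k<M. \<bar>y k - z k\<bar> * 1)"
      unfolding abs_mult by (intro sum_mono mult_left_mono mode_bound x) simp
    finally show ?thesis by (simp add: \<delta> abs_minus_commute)
  qed
  have cd: "\<bar>1 * coeff \<sigma> y x + (-1) * coeff \<sigma> z x\<bar> \<le> ?H" if x: "x \<in> D" for x
  proof -
    have "\<sigma> * field y x \<le> \<sigma> * (ell M y + \<delta>)" "\<sigma> * field z x \<le> \<sigma> * (ell M y + \<delta>)"
      using field_bound[OF x, of y] field_bound[OF x, of z] ellz \<delta>0 \<sigma> by (intro mult_left_mono; linarith)+
    then have le: "\<sigma> * field y x - \<sigma>\<^sup>2 / 2 \<le> \<sigma> * (ell M y + \<delta>)" "\<sigma> * field z x - \<sigma>\<^sup>2 / 2 \<le> \<sigma> * (ell M y + \<delta>)"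
      using zero_le_power2[of \<sigma>] by linarith+
    have "\<bar>coeff \<sigma> y x - coeff \<sigma> z x\<bar> \<le> \<bar>(\<sigma> * field y x - \<sigma>\<^sup>2 / 2) - (\<sigma> * field z x - \<sigma>\<^sup>2 / 2)\<bar> * exp (\<sigma> * (ell M y + \<delta>))"
      unfolding coeff_def by (rule exp_diff_bound[OF le])
    also have "(\<sigma> * field y x - \<sigma>\<^sup>2 / 2) - (\<sigma> * field z x - \<sigma>\<^sup>2 / 2) = \<sigma> * (field y x - field z x)"
      by (simp add: algebra_simps)
    also have "\<bar>\<sigma> * (field y x - field z x)\<bar> * exp (\<sigma> * (ell M y + \<delta>)) \<le> ?H"
      using fd[OF x] \<sigma> by (auto simp: abs_mult intro!: mult_right_mono mult_left_mono)
    finally show ?thesis by simp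
  qed
  have wt: "weight (\<lambda>x. 1 * coeff \<sigma> y x + (-1) * coeff \<sigma> z x)"
    using coeff_measurable cd by (intro weightI[of _ ?H]) auto
  \<comment> \<open>Both solutions see the same load, so the load cancels and only the change of the
    coefficient remains.\<close>
  have "wip (coeff \<sigma> z) ?w ?w = 1 * wip (coeff \<sigma> z) (uI \<sigma> z) ?w + (-1) * wip (coeff \<sigma> z) (uI \<sigma> y) ?w"
    by (intro wip_lincomb_left coeff_weight uI_mem w \<sigma> y)
  also have "\<dots> = 1 * wip (coeff \<sigma> y) (uI \<sigma> y) ?w + (-1) * wip (coeff \<sigma> z) (uI \<sigma> y) ?w"
    using model_I_wip[OF \<sigma> y(1) w] model_I_wip[OF \<sigma> y(2) w] by simp
  also have "\<dots> = wip (\<lambda>x. 1 * coeff \<sigma> y x + (-1) * coeff \<sigma> z x) (uI \<sigma> y) ?w"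
    by (intro wip_weight_lincomb[symmetric] coeff_weight uI_mem w \<sigma> y)
  also have "\<dots> \<le> ?H * (nrm (uI \<sigma> y) * nrm ?w)"
    using wip_bound[OF wt cd H0 uI_mem[OF \<sigma> y(1)] w] by linarith
  finally have "wip (coeff \<sigma> z) ?w ?w \<le> ?H * nrm (uI \<sigma> y) * nrm ?w" by (simp only: mult.assoc)
  then have "nrm ?w \<le> ?H * nrm (uI \<sigma> y) * exp (\<sigma> * ell M z + \<sigma>\<^sup>2 / 2)"
    using H0 nrm_nonneg by (intro coercive \<sigma> w) auto
  also have "\<dots> \<le> ?H * nrm (uI \<sigma> y) * exp (\<sigma> * (ell M y + \<delta>) + \<sigma>\<^sup>2 / 2)"
    using ellz H0 nrm_nonneg[of "uI \<sigma> y"] \<sigma> by (intro mult_left_mono) (auto intro: mult_left_mono)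
  finally show ?thesis .
qed

lemma ip_diff_left:
  assumes "u \<in> V" "v \<in> V" "w \<in> V"
  shows "ip (\<lambda>x. 1 * u x + (-1) * v x) w = ip u w - ip v w"
  using wip_lincomb_left[OF weight_const assms, of 1 1 "-1"] by simp

text \<open>Model I is posed on \<open>params\<close>; restricting first gives a map on all of
  \<open>nat \<Rightarrow> real\<close>, whose product topology makes each coordinate
  continuous.\<close>

lemma uI_coord_continuous:
  assumes \<sigma>: "0 < \<sigma>" and j: "j < n"
  shows "isCont (\<lambda>y. ip (uI \<sigma> (restrict y {..<M})) (e j)) y"
proof -
  let ?r = "\<lambda>y::nat \<Rightarrow> real. restrict y {..<M}"
  define \<delta> where "\<delta> z = (\<Sum>k<M. \<bar>z k - y k\<bar>)" for z
  have r: "?r y \<in> params" for y by auto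
  have \<delta>lim: "(\<delta> \<longlongrightarrow> 0) (at y)"
  proof -
    have coord: "((\<lambda>z::nat \<Rightarrow> real. z k) \<longlongrightarrow> y k) (at y)" for k
    proof -
      have "continuous_on UNIV (\<lambda>z::nat \<Rightarrow> real. z k)" by (rule continuous_on_product_coordinates)
      then show ?thesis unfolding continuous_on_def by (rule bspec) simp
    qed
    have "((\<lambda>z. \<Sum>k<M. \<bar>z k - y k\<bar>) \<longlongrightarrow> (\<Sum>k<M. \<bar>y k - y k\<bar>)) (at y)"
      by (intro tendsto_intros coord)
    then show ?thesis by (simp add: \<delta>_def[abs_def])
  qed
  define B where "B d = (\<sigma> * d * exp (\<sigma> * (ell M (?r y) + d))) * nrm (uI \<sigma> (?r y)) * exp (\<sigma> * (ell M (?r y) + d) + \<sigma>\<^sup>2 / 2)" for d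
  have "((\<lambda>z. B (\<delta> z)) \<longlongrightarrow> B 0) (at y)"
    unfolding B_def by (intro tendsto_intros \<delta>lim)
  then have Blim: "((\<lambda>z. B (\<delta> z)) \<longlongrightarrow> 0) (at y)" by (simp add: B_def)
  have "\<bar>ip (uI \<sigma> (?r z)) (e j) - ip (uI \<sigma> (?r y)) (e j)\<bar> \<le> B (\<delta> z)" for z
  proof -
    let ?w = "\<lambda>x. 1 * uI \<sigma> (?r z) x + (-1) * uI \<sigma> (?r y) x"
    have w: "?w \<in> V" by (intro fe_lincomb uI_mem \<sigma> r)
    have "ip (uI \<sigma> (?r z)) (e j) - ip (uI \<sigma> (?r y)) (e j) = ip ?w (e j)"
      using ip_diff_left[OF uI_mem[OF \<sigma> r] uI_mem[OF \<sigma> r] e_mem[OF j]] by simp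
    moreover have "\<bar>ip ?w (e j)\<bar> \<le> nrm ?w" by (rule abs_coord_le[OF w j])
    moreover have "nrm ?w \<le> B (\<delta> z)"
      unfolding B_def by (rule uI_lipschitz[OF \<sigma> r r]) (simp add: \<delta>_def)
    ultimately show ?thesis by simp
  qed
  then have "((\<lambda>z. ip (uI \<sigma> (?r z)) (e j) - ip (uI \<sigma> (?r y)) (e j)) \<longlongrightarrow> 0) (at y)"
    using Blim by (intro Lim_null_comparison[OF _ Blim] always_eventually allI) simp
  then show ?thesis unfolding isCont_def by (rule LIM_zero_cancel)
qed

text \<open>Beyond \<open>M\<close> the points of the product space take the constant value
  \<open>undefined\<close>, so every coordinate is measurable. The identity thus carries Borel
  measurability on \<open>nat \<Rightarrow> real\<close> over to the finite product.\<close>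

lemma restrict_measurable_product:
  "(\<lambda>y. y) \<in> Pi\<^sub>M {..<M} (\<lambda>_. borel :: real measure) \<rightarrow>\<^sub>M (borel :: (nat \<Rightarrow> real) measure)"
proof (rule measurable_coordinatewise_then_product)
  fix i :: nat
  show "(\<lambda>y. y i) \<in> borel_measurable (Pi\<^sub>M {..<M} (\<lambda>_. borel :: real measure))"
  proof (cases "i < M")
    case True
    then show ?thesis by (intro measurable_component_singleton) simp
  next
    case False
    have "(\<lambda>y. undefined :: real) \<in> borel_measurable (Pi\<^sub>M {..<M} (\<lambda>_. borel :: real measure))" by simp
    then show ?thesis
      by (rule measurable_cong[THEN iffD1, rotated]) (use False in \<open>auto simp: space_PiM PiE_def extensional_def\<close>)
  qed
qed

lemma uI_coord_measurable:
  assumes \<sigma>: "0 < \<sigma>" and j: "j < n"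
  shows "(\<lambda>y. ip (uI \<sigma> y) (e j)) \<in> borel_measurable (Pi\<^sub>M {..<M} (\<lambda>_. borel))"
proof -
  have "continuous_on UNIV (\<lambda>y. ip (uI \<sigma> (restrict y {..<M})) (e j))"
    by (intro continuous_at_imp_continuous_on ballI uI_coord_continuous[OF assms])
  then have "(\<lambda>y. ip (uI \<sigma> (restrict y {..<M})) (e j)) \<in> borel_measurable borel"
    by (rule borel_measurable_continuous_onI)
  from measurable_compose[OF restrict_measurable_product this]
  have "(\<lambda>y. ip (uI \<sigma> (restrict y {..<M})) (e j)) \<in> borel_measurable (Pi\<^sub>M {..<M} (\<lambda>_. borel))" .
  then show ?thesis
    by (rule measurable_cong[THEN iffD1, rotated]) (auto simp: space_PiM PiE_def extensional_restrict)
qed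

end

section \<open>Expansion for small $\sigma$\<close>

context model_problem
begin

abbreviation J :: "(nat \<Rightarrow> nat) set" where "J \<equiv> multi_indices {..<M} p"

definition order :: "(nat \<Rightarrow> nat) \<Rightarrow> nat" where "order \<alpha> = (\<Sum>k<M. \<alpha> k)"

text \<open>The factor \<open>exp (- \<sigma>\<^sup>2)\<close> of \<open>wick_inverse_coeff\<close>
  is left out: it is common to all terms of the system and reappears only as
  \<open>exp (\<sigma>\<^sup>2)\<close> on the load. What remains is of size
  \<open>\<sigma> ^ order \<beta>\<close>.\<close>

definition monomial_coeff :: "real \<Rightarrow> (nat \<Rightarrow> nat) \<Rightarrow> 'a \<Rightarrow> real" where
  "monomial_coeff \<sigma> \<beta> x = (\<Prod>k<M. (\<sigma> * mode k x) ^ \<beta> k) / (\<Prod>k<M. fact (\<beta> k))"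

lemma finite_J: "finite J"
  by (rule finite_multi_indices) simp

lemma J_outside: "\<alpha> \<in> J \<Longrightarrow> M \<le> k \<Longrightarrow> \<alpha> k = 0"
  by (simp add: multi_indices_def)

lemma J_eqI: "\<alpha> \<in> J \<Longrightarrow> \<beta> \<in> J \<Longrightarrow> (\<And>k. k < M \<Longrightarrow> \<alpha> k = \<beta> k) \<Longrightarrow> \<alpha> = \<beta>"
  by (rule ext) (metis J_outside not_le)

lemma zero_J: "(\<lambda>_. 0) \<in> J"
  by (simp add: multi_indices_def)

lemma wick_inverse_coeff_eq: "wick_inverse_coeff M lam \<phi> \<sigma> x \<beta> = exp (- \<sigma>\<^sup>2) * monomial_coeff \<sigma> \<beta> x"
  by (simp add: wick_inverse_coeff_def monomial_coeff_def Phi1_def mode_def mult.assoc)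

lemma monomial_coeff_bound:
  assumes "0 < \<sigma>" "x \<in> D"
  shows "\<bar>monomial_coeff \<sigma> \<beta> x\<bar> \<le> \<sigma> ^ order \<beta>"
proof -
  have num: "\<bar>\<Prod>k<M. (\<sigma> * mode k x) ^ \<beta> k\<bar> \<le> \<sigma> ^ order \<beta>"
  proof -
    have "\<bar>\<Prod>k<M. (\<sigma> * mode k x) ^ \<beta> k\<bar> = (\<Prod>k<M. \<bar>\<sigma> * mode k x\<bar> ^ \<beta> k)"
      by (simp add: abs_prod power_abs)
    also have "\<dots> \<le> (\<Prod>k<M. \<sigma> ^ \<beta> k)"
    proof (intro prod_mono conjI power_mono)
      show "\<bar>\<sigma> * mode k x\<bar> \<le> \<sigma>" for k
        using mult_left_mono[OF mode_bound[OF assms(2), of k], of \<sigma>] assms(1) by (simp add: abs_mult)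
    qed auto
    finally show ?thesis by (simp add: order_def power_sum)
  qed
  have den: "(1::real) \<le> (\<Prod>k<M. fact (\<beta> k))" by (rule prod_ge_1) (simp add: fact_ge_1)
  have "\<bar>monomial_coeff \<sigma> \<beta> x\<bar> = \<bar>\<Prod>k<M. (\<sigma> * mode k x) ^ \<beta> k\<bar> / (\<Prod>k<M. fact (\<beta> k))"
    using den by (simp add: monomial_coeff_def abs_divide)
  also have "\<dots> \<le> \<bar>\<Prod>k<M. (\<sigma> * mode k x) ^ \<beta> k\<bar> / 1"
    using den by (intro divide_left_mono) auto
  finally show ?thesis using num by simp
qed

lemma monomial_coeff_weight:
  assumes "0 < \<sigma>"
  shows "weight (monomial_coeff \<sigma> \<beta>)"
proof (rule weightI[of _ "\<sigma> ^ order \<beta>"])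
  have [measurable]: "mode k \<in> borel_measurable (lebesgue_on D)" for k
    using mode_weight by (simp add: weight_def)
  show "monomial_coeff \<sigma> \<beta> \<in> borel_measurable (lebesgue_on D)"
    unfolding monomial_coeff_def[abs_def] by measurable
qed (rule monomial_coeff_bound[OF assms])

lemma monomial_coeff_0: "(\<And>k. k < M \<Longrightarrow> \<beta> k = 0) \<Longrightarrow> monomial_coeff \<sigma> \<beta> x = 1"
  by (simp add: monomial_coeff_def)

section \<open>Forward substitution in model II\<close>

lemma uII_mem: "0 < \<sigma> \<Longrightarrow> \<alpha> \<in> J \<Longrightarrow> uII \<sigma> \<alpha> \<in> V"
  using model_II unfolding model_II_solution_def by blast

text \<open>The diagonal entry has index difference 0 and hence coefficient 1, so each row expresses
  its unknown through the strictly smaller indices.\<close>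

lemma model_II_recursion:
  assumes \<sigma>: "0 < \<sigma>" and \<gamma>: "\<gamma> \<in> J" and v: "v \<in> V"
  shows "ip (uII \<sigma> \<gamma>) v = (if \<gamma> = (\<lambda>_. 0) then exp (\<sigma>\<^sup>2) * ip u0 v else 0)
    - (\<Sum>\<alpha> \<in> {\<alpha> \<in> J. (\<forall>k. \<alpha> k \<le> \<gamma> k)} - {\<gamma>}. wip (monomial_coeff \<sigma> (\<lambda>k. \<gamma> k - \<alpha> k)) (uII \<sigma> \<alpha>) v)"
proof -
  let ?A = "{\<alpha> \<in> J. (\<forall>k. \<alpha> k \<le> \<gamma> k)}"
  let ?W = "\<lambda>\<alpha>. wip (monomial_coeff \<sigma> (\<lambda>k. \<gamma> k - \<alpha> k)) (uII \<sigma> \<alpha>) v"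
  have A: "finite ?A" "\<gamma> \<in> ?A" using finite_J \<gamma> by auto
  have "(\<Sum>\<alpha>\<in>?A. \<integral>x. wick_inverse_coeff M lam \<phi> \<sigma> x (\<lambda>k. \<gamma> k - \<alpha> k) *
                 (weak_grad D (uII \<sigma> \<alpha>) x \<bullet> weak_grad D v x) \<partial>lebesgue_on D)
        = (if \<gamma> = (\<lambda>_. 0) then \<integral>x. f x * v x \<partial>lebesgue_on D else 0)"
    using model_II[OF \<sigma>] \<gamma> v unfolding model_II_solution_def by blast
  moreover have "(\<integral>x. wick_inverse_coeff M lam \<phi> \<sigma> x (\<lambda>k. \<gamma> k - \<alpha> k) *
                 (weak_grad D (uII \<sigma> \<alpha>) x \<bullet> weak_grad D v x) \<partial>lebesgue_on D) = exp (- \<sigma>\<^sup>2) * ?W \<alpha>" if "\<alpha> \<in> ?A" for \<alpha>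
  proof -
    have "\<alpha> \<in> J" using that by simp
    then show ?thesis
      unfolding fe_weak_grad[OF uII_mem[OF \<sigma> \<open>\<alpha> \<in> J\<close>]] fe_weak_grad[OF v] wick_inverse_coeff_eq wip_cmult[symmetric]
      by (simp only: wip_def)
  qed
  ultimately have "(\<Sum>\<alpha>\<in>?A. exp (- \<sigma>\<^sup>2) * ?W \<alpha>) = (if \<gamma> = (\<lambda>_. 0) then ip u0 v else 0)"
    by (simp add: ip_u0[OF v])
  then have S: "exp (- \<sigma>\<^sup>2) * (\<Sum>\<alpha>\<in>?A. ?W \<alpha>) = (if \<gamma> = (\<lambda>_. 0) then ip u0 v else 0)"
    by (simp only: sum_distrib_left)
  have e1: "exp (\<sigma>\<^sup>2) * exp (- \<sigma>\<^sup>2) = (1::real)" by (simp flip: exp_add)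
  have mi: "c * (if P then a else 0) = (if P then c * a else 0)" for c a :: real and P by simp
  have "(\<Sum>\<alpha>\<in>?A. ?W \<alpha>) = (exp (\<sigma>\<^sup>2) * exp (- \<sigma>\<^sup>2)) * (\<Sum>\<alpha>\<in>?A. ?W \<alpha>)" unfolding e1 by (rule mult_1[symmetric])
  also have "\<dots> = (if \<gamma> = (\<lambda>_. 0) then exp (\<sigma>\<^sup>2) * ip u0 v else 0)" unfolding mult.assoc S mi ..
  finally have 1: "(\<Sum>\<alpha>\<in>?A. ?W \<alpha>) = (if \<gamma> = (\<lambda>_. 0) then exp (\<sigma>\<^sup>2) * ip u0 v else 0)" .
  have 2: "(\<Sum>\<alpha>\<in>?A. ?W \<alpha>) = ?W \<gamma> + (\<Sum>\<alpha>\<in>?A - {\<gamma>}. ?W \<alpha>)"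
    by (rule sum.remove[OF A])
  have 3: "?W \<gamma> = ip (uII \<sigma> \<gamma>) v"
    by (rule wip_cong) (simp add: monomial_coeff_0)
  show ?thesis unfolding 1[symmetric] 2 3 by (rule add_diff_cancel_right'[symmetric])
qed

lemma uII_0:
  assumes \<sigma>: "0 < \<sigma>" and v: "v \<in> V"
  shows "ip (uII \<sigma> (\<lambda>_. 0)) v = exp (\<sigma>\<^sup>2) * ip u0 v"
proof -
  have "{\<alpha> \<in> J. (\<forall>k. \<alpha> k \<le> (0::nat))} - {\<lambda>_. 0} = {}" by auto
  with model_II_recursion[OF \<sigma> zero_J v] show ?thesis by (simp only: sum.empty if_True simp_thms diff_0_right)
qed

definition unit_index :: "nat \<Rightarrow> nat \<Rightarrow> nat" where "unit_index k = (\<lambda>i. if i = k then 1 else 0)"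

lemma unit_index_J: "k < M \<Longrightarrow> 1 \<le> p \<Longrightarrow> unit_index k \<in> J"
  by (auto simp: multi_indices_def unit_index_def)

lemma order_unit_index: "k < M \<Longrightarrow> order (unit_index k) = 1"
  by (simp add: order_def unit_index_def)

lemma below_unit_index:
  assumes "k < M" "1 \<le> p"
  shows "{\<alpha> \<in> J. (\<forall>i. \<alpha> i \<le> unit_index k i)} - {unit_index k} = {\<lambda>_. 0}"
proof
  show "{\<alpha> \<in> J. (\<forall>i. \<alpha> i \<le> unit_index k i)} - {unit_index k} \<subseteq> {\<lambda>_. 0}"
  proof
    fix \<alpha> assume a: "\<alpha> \<in> {\<alpha> \<in> J. (\<forall>i. \<alpha> i \<le> unit_index k i)} - {unit_index k}"
    have i: "\<alpha> i = 0" if "i \<noteq> k" for i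
    proof -
      have "\<alpha> i \<le> unit_index k i" using a by blast
      then show ?thesis using that by (simp add: unit_index_def)
    qed
    have "\<alpha> k \<noteq> 1"
    proof
      assume "\<alpha> k = 1"
      then have "\<alpha> = unit_index k" using i by (auto simp: unit_index_def)
      then show False using a by blast
    qed
    moreover have "\<alpha> k \<le> unit_index k k" using a by blast
    ultimately have "\<alpha> k = 0" by (simp add: unit_index_def)
    then have "\<alpha> = (\<lambda>_. 0)" using i by (metis ext)
    then show "\<alpha> \<in> {\<lambda>_. 0}" by simp
  qed
  have "(\<lambda>_. 0) \<noteq> unit_index k" by (metis unit_index_def zero_neq_one)
  then show "{\<lambda>_. 0} \<subseteq> {\<alpha> \<in> J. (\<forall>i. \<alpha> i \<le> unit_index k i)} - {unit_index k}"
    using zero_J by auto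
qed

text \<open>The \<open>- 0\<close> is the form in which the index difference arrives from the
  recursion at the zero index.\<close>

lemma monomial_coeff_unit:
  assumes "k < M"
  shows "monomial_coeff \<sigma> (\<lambda>i. unit_index k i - 0) x = \<sigma> * mode k x"
proof -
  have "(\<Prod>i<M. (\<sigma> * mode i x) ^ (if i = k then 1 else 0)) = (\<Prod>i<M. if i = k then \<sigma> * mode k x else 1)"
    by (intro prod.cong) auto
  moreover have "(\<Prod>i<M. fact (if i = k then 1 else 0) :: real) = 1"
    by (intro prod.neutral) auto
  ultimately show ?thesis using assms by (simp add: monomial_coeff_def unit_index_def)
qed

text \<open>The functions written w_k in the overview: the first-order response of the solution to a
  perturbation of the coefficient along mode \<open>k\<close>.\<close>

definition mode_response :: "nat \<Rightarrow> 'a \<Rightarrow> real" where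
  "mode_response k = (SOME w. w \<in> V \<and> (\<forall>v\<in>V. ip w v = - wip (mode k) u0 v))"

lemma mode_response: "mode_response k \<in> V" "v \<in> V \<Longrightarrow> ip (mode_response k) v = - wip (mode k) u0 v"
proof -
  have "\<exists>w. w \<in> V \<and> (\<forall>v\<in>V. ip w v = - wip (mode k) u0 v)"
    using riesz[OF mode_weight u0_mem] by metis
  from someI_ex[OF this]
  show "mode_response k \<in> V" "v \<in> V \<Longrightarrow> ip (mode_response k) v = - wip (mode k) u0 v"
    unfolding mode_response_def by blast+
qed

lemma mode_response_bound: "nrm (mode_response k) \<le> nrm u0"
proof (rule nrm_leI[OF mode_response(1)])
  show "ip (mode_response k) (mode_response k) \<le> nrm u0 * nrm (mode_response k)"
    using mode_response(2)[OF mode_response(1)] wip_bound[OF mode_weight mode_bound _ u0_mem mode_response(1), of k k]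
    by simp
qed (rule nrm_nonneg)

text \<open>Below a unit index there is only the zero index, whose coefficient is
  \<open>exp (\<sigma>\<^sup>2)\<close> times \<open>u0\<close>. So model II answers mode
  \<open>k\<close> by the same \<open>mode_response k\<close> as model I, up to a factor that
  differs from 1 by order \<sigma>^2; this is the source of the variance reduction.\<close>

lemma uII_unit:
  assumes \<sigma>: "0 < \<sigma>" and k: "k < M" "1 \<le> p" and v: "v \<in> V"
  shows "ip (uII \<sigma> (unit_index k)) v = \<sigma> * exp (\<sigma>\<^sup>2) * ip (mode_response k) v"
proof -
  let ?U = "uII \<sigma> (\<lambda>_. 0)"
  have U: "?U \<in> V" by (rule uII_mem[OF \<sigma> zero_J])
  have ne: "unit_index k \<noteq> (\<lambda>_. 0)" by (metis unit_index_def zero_neq_one)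
  have "ip (uII \<sigma> (unit_index k)) v = - wip (\<lambda>x. \<sigma> * mode k x) ?U v"
  proof -
    have fe: "monomial_coeff \<sigma> (unit_index k) = (\<lambda>x. \<sigma> * mode k x)"
      using monomial_coeff_unit[OF k(1)] by (intro ext) simp
    have rec: "ip (uII \<sigma> (unit_index k)) v = (if unit_index k = (\<lambda>_. 0) then exp (\<sigma>\<^sup>2) * ip u0 v else 0)
      - (\<Sum>\<alpha>\<in>{\<lambda>_. 0}. wip (monomial_coeff \<sigma> (\<lambda>i. unit_index k i - \<alpha> i)) (uII \<sigma> \<alpha>) v)"
      using model_II_recursion[OF \<sigma> unit_index_J[OF k] v] unfolding below_unit_index[OF k] .
    then show ?thesis using ne by (simp add: fe)
  qed
  also have "\<dots> = - \<sigma> * wip (mode k) ?U v" by (simp add: wip_cmult)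
  also have "wip (mode k) ?U v = exp (\<sigma>\<^sup>2) * wip (mode k) u0 v"
  proof -
    have "?U = (\<lambda>x. exp (\<sigma>\<^sup>2) * u0 x + 0 * u0 x)"
    proof (rule fe_eqI[OF U fe_lincomb[OF u0_mem u0_mem]])
      fix w assume w: "w \<in> V"
      show "ip ?U w = ip (\<lambda>x. exp (\<sigma>\<^sup>2) * u0 x + 0 * u0 x) w"
        using uII_0[OF \<sigma> w] wip_lincomb_left[OF weight_const u0_mem u0_mem w, of 1 "exp (\<sigma>\<^sup>2)" 0] by simp
    qed
    then have "wip (mode k) ?U v = wip (mode k) (\<lambda>x. exp (\<sigma>\<^sup>2) * u0 x + 0 * u0 x) v" by simp
    also have "\<dots> = exp (\<sigma>\<^sup>2) * wip (mode k) u0 v + 0 * wip (mode k) u0 v"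
      by (rule wip_lincomb_left[OF mode_weight u0_mem u0_mem v])
    finally show ?thesis by simp
  qed
  also have "- \<sigma> * (exp (\<sigma>\<^sup>2) * wip (mode k) u0 v) = \<sigma> * exp (\<sigma>\<^sup>2) * ip (mode_response k) v"
    using mode_response(2)[OF v] by simp
  finally show ?thesis .
qed

text \<open>Forward substitution preserves homogeneity: the coefficient linking \<alpha> to \<gamma>
  has order \<open>order \<gamma> - order \<alpha>\<close> in \<sigma>, and the induction hypothesis
  supplies the rest. The restriction \<open>\<sigma> \<le> 1\<close> bounds
  \<open>exp (\<sigma>\<^sup>2)\<close> by \<open>exp 1\<close>.\<close>

lemma uII_bound:
  assumes "\<gamma> \<in> J"
  shows "\<exists>C\<ge>0. \<forall>\<sigma>. 0 < \<sigma> \<and> \<sigma> \<le> 1 \<longrightarrow> nrm (uII \<sigma> \<gamma>) \<le> C * \<sigma> ^ order \<gamma>"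
  using assms
proof (induction "order \<gamma>" arbitrary: \<gamma> rule: less_induct)
  case less
  let ?A = "{\<alpha> \<in> J. (\<forall>k. \<alpha> k \<le> \<gamma> k)} - {\<gamma>}"
  have ord: "order \<alpha> < order \<gamma>" "order (\<lambda>k. \<gamma> k - \<alpha> k) + order \<alpha> = order \<gamma>" if a: "\<alpha> \<in> ?A" for \<alpha>
  proof -
    have le: "\<alpha> k \<le> \<gamma> k" for k using a by blast
    have "order (\<lambda>k. \<gamma> k - \<alpha> k) + order \<alpha> = (\<Sum>k<M. (\<gamma> k - \<alpha> k) + \<alpha> k)"
      unfolding order_def by (rule sum.distrib[symmetric])
    also have "\<dots> = order \<gamma>" unfolding order_def using le by (intro sum.cong) auto
    finally show *: "order (\<lambda>k. \<gamma> k - \<alpha> k) + order \<alpha> = order \<gamma>" .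
    have "\<exists>k<M. \<alpha> k \<noteq> \<gamma> k"
    proof (rule ccontr)
      assume "\<not> ?thesis"
      then have "\<alpha> = \<gamma>" using a less.prems by (intro J_eqI) auto
      then show False using a by blast
    qed
    then obtain k where "k < M" "\<alpha> k < \<gamma> k" using le by (metis le_neq_implies_less)
    then show "order \<alpha> < order \<gamma>" unfolding order_def using le by (intro sum_strict_mono_ex1) auto
  qed
  have "\<forall>\<alpha>\<in>?A. \<exists>C\<ge>0. \<forall>\<sigma>. 0 < \<sigma> \<and> \<sigma> \<le> 1 \<longrightarrow> nrm (uII \<sigma> \<alpha>) \<le> C * \<sigma> ^ order \<alpha>"
    using less.hyps ord(1) by blast
  then obtain C where C: "\<And>\<alpha>. \<alpha> \<in> ?A \<Longrightarrow> C \<alpha> \<ge> 0"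
    "\<And>\<alpha> \<sigma>. \<alpha> \<in> ?A \<Longrightarrow> 0 < \<sigma> \<Longrightarrow> \<sigma> \<le> 1 \<Longrightarrow> nrm (uII \<sigma> \<alpha>) \<le> C \<alpha> * \<sigma> ^ order \<alpha>"
    by (metis (no_types, lifting))
  define K where "K = (if \<gamma> = (\<lambda>_. 0) then exp 1 * nrm u0 else 0) + (\<Sum>\<alpha>\<in>?A. C \<alpha>)"
  have K: "K \<ge> 0" unfolding K_def using C(1) nrm_nonneg[of u0] by (intro add_nonneg_nonneg sum_nonneg) auto
  have "nrm (uII \<sigma> \<gamma>) \<le> K * \<sigma> ^ order \<gamma>" if \<sigma>: "0 < \<sigma>" "\<sigma> \<le> 1" for \<sigma>
  proof (rule nrm_leI)
    let ?u = "uII \<sigma> \<gamma>"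
    show u: "?u \<in> V" by (rule uII_mem[OF \<sigma>(1) less.prems])
    have s1: "(if \<gamma> = (\<lambda>_. 0) then exp (\<sigma>\<^sup>2) * ip u0 ?u else 0)
      \<le> (if \<gamma> = (\<lambda>_. 0) then exp 1 * nrm u0 else 0) * \<sigma> ^ order \<gamma> * nrm ?u"
    proof (cases "\<gamma> = (\<lambda>_. 0)")
      case True
      then have "order \<gamma> = 0" by (simp add: order_def)
      have "exp (\<sigma>\<^sup>2) * ip u0 ?u \<le> exp 1 * (nrm u0 * nrm ?u)"
      proof (rule mult_mono')
        show "exp (\<sigma>\<^sup>2) \<le> exp 1" using \<sigma> by (simp add: power_le_one)
        show "ip u0 ?u \<le> nrm u0 * nrm ?u" using ip_bound[OF u0_mem u] by linarith
        show "0 \<le> exp (\<sigma>\<^sup>2)" by simp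
        \<comment> \<open>For the zero index \<open>exp (\<sigma>\<^sup>2) * ip u0 ?u\<close> equals
          \<open>ip ?u ?u\<close>.\<close>
        show "0 \<le> ip u0 ?u"
          using uII_0[OF \<sigma>(1) u] True ip_nonneg[of ?u] by (metis exp_gt_zero zero_le_mult_iff not_exp_le_zero)
      qed
      then show ?thesis using True \<open>order \<gamma> = 0\<close> by simp
    qed simp
    have s2: "- wip (monomial_coeff \<sigma> (\<lambda>k. \<gamma> k - \<alpha> k)) (uII \<sigma> \<alpha>) ?u \<le> C \<alpha> * \<sigma> ^ order \<gamma> * nrm ?u"
      if a: "\<alpha> \<in> ?A" for \<alpha>
    proof -
      have aV: "uII \<sigma> \<alpha> \<in> V" using a by (intro uII_mem \<sigma>) auto
      have "\<bar>wip (monomial_coeff \<sigma> (\<lambda>k. \<gamma> k - \<alpha> k)) (uII \<sigma> \<alpha>) ?u\<bar> \<le> \<sigma> ^ order (\<lambda>k. \<gamma> k - \<alpha> k) * (nrm (uII \<sigma> \<alpha>) * nrm ?u)"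
        using \<sigma> by (intro wip_bound monomial_coeff_weight monomial_coeff_bound aV u) auto
      also have "\<dots> \<le> \<sigma> ^ order (\<lambda>k. \<gamma> k - \<alpha> k) * ((C \<alpha> * \<sigma> ^ order \<alpha>) * nrm ?u)"
        using \<sigma> nrm_nonneg by (intro mult_left_mono mult_right_mono C(2)[OF a]) auto
      also have "\<dots> = C \<alpha> * \<sigma> ^ (order (\<lambda>k. \<gamma> k - \<alpha> k) + order \<alpha>) * nrm ?u" by (simp add: power_add)
      finally show ?thesis unfolding ord(2)[OF a] by linarith
    qed
    have "ip ?u ?u = (if \<gamma> = (\<lambda>_. 0) then exp (\<sigma>\<^sup>2) * ip u0 ?u else 0)
      + (\<Sum>\<alpha>\<in>?A. - wip (monomial_coeff \<sigma> (\<lambda>k. \<gamma> k - \<alpha> k)) (uII \<sigma> \<alpha>) ?u)"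
      unfolding model_II_recursion[OF \<sigma>(1) less.prems u] by (simp add: sum_negf)
    also have "\<dots> \<le> (if \<gamma> = (\<lambda>_. 0) then exp 1 * nrm u0 else 0) * \<sigma> ^ order \<gamma> * nrm ?u + (\<Sum>\<alpha>\<in>?A. C \<alpha> * \<sigma> ^ order \<gamma> * nrm ?u)"
      by (intro add_mono s1 sum_mono s2)
    also have "\<dots> = K * \<sigma> ^ order \<gamma> * nrm ?u"
      by (simp only: K_def distrib_right sum_distrib_right)
    finally show "ip ?u ?u \<le> K * \<sigma> ^ order \<gamma> * nrm ?u" .
    show "0 \<le> K * \<sigma> ^ order \<gamma>" using K \<sigma> by simp
  qed
  with K show ?case by blast
qed

section \<open>First-order expansion of model I at \<sigma> = 0\<close>

definition uI1 :: "(nat \<Rightarrow> real) \<Rightarrow> 'a \<Rightarrow> real" where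
  "uI1 y x = (\<Sum>k<M. y k * mode_response k x)"

lemma uI1_mem: "uI1 y \<in> V"
  unfolding uI1_def[abs_def] by (rule sum_mem) (rule mode_response(1))

lemma ip_uI1: "v \<in> V \<Longrightarrow> ip (uI1 y) v = - wip (field y) u0 v"
proof -
  assume v: "v \<in> V"
  have "ip (uI1 y) v = (\<Sum>k<M. y k * ip (mode_response k) v)"
    unfolding uI1_def[abs_def] by (rule ip_sum_left) (use mode_response(1) v in auto)
  also have "\<dots> = - wip (field y) u0 v"
    unfolding wip_field[OF u0_mem v] by (simp add: mode_response(2)[OF v] sum_negf)
  finally show ?thesis .
qed

lemma uI1_bound: "nrm (uI1 y) \<le> ell M y * nrm u0"
proof -
  have "nrm (uI1 y) \<le> (\<Sum>k<M. \<bar>y k\<bar> * nrm (mode_response k))"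
    unfolding uI1_def[abs_def] by (rule nrm_sum) (rule mode_response(1))
  also have "\<dots> \<le> (\<Sum>k<M. \<bar>y k\<bar> * nrm u0)"
    by (intro sum_mono mult_left_mono mode_response_bound) simp
  finally show ?thesis by (simp add: ell_def sum_distrib_right)
qed

text \<open>The remainder \<open>?r\<close> is estimated in the energy of the coefficient itself.
  Inserting the equations for \<open>u0\<close> and \<open>uI1\<close> leaves two residuals: the
  second-order Taylor error of the coefficient acting on \<open>u0\<close>, and its first-order
  error acting on \<sigma> times \<open>uI1 y\<close>. Both are of order \<sigma>^2.\<close>

lemma model_I_expansion:
  assumes \<sigma>: "0 < \<sigma>" "\<sigma> \<le> 1" and y: "y \<in> params"
  shows "nrm (\<lambda>x. 1 * uI \<sigma> y x + (-1) * (1 * u0 x + \<sigma> * uI1 y x)) \<le> 3 * \<sigma>\<^sup>2 * exp (ell M y + 1) ^ 4 * nrm u0"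
proof -
  \<comment> \<open>A common majorant of \<open>ell M y\<close>, of 1 and of
    \<open>exp \<bar>z\<bar>\<close> for the exponent \<open>z\<close> of the coefficient, so that
    products of such factors become powers of \<open>E\<close>.\<close>
  define E where "E = exp (ell M y + 1)"
  have ellE: "ell M y + 1 \<le> E" "1 \<le> E"
    using exp_ge_add_one_self[of "ell M y + 1"] ell_nonneg[of M y] by (auto simp: E_def)
  let ?w = "\<lambda>x. 1 * u0 x + \<sigma> * uI1 y x"
  let ?r = "\<lambda>x. 1 * uI \<sigma> y x + (-1) * ?w x"
  let ?a = "coeff \<sigma> y"
  \<comment> \<open>With \<open>z = \<sigma> * field y x - \<sigma>\<^sup>2 / 2\<close> the
    coefficient is \<open>exp z\<close>. Then \<open>?k\<close> is \<open>1 - exp z\<close>, of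
    first order, and \<open>?h\<close> is \<open>- (exp z - 1 - z) + \<sigma>\<^sup>2 / 2\<close>,
    of second order: the shift in the exponent does not disturb the first order.\<close>
  let ?h = "\<lambda>x. 1 * (1 * 1 + (-1) * ?a x) + \<sigma> * field y x"
  let ?k = "\<lambda>x. 1 * 1 + (-1) * ?a x"
  have wV: "?w \<in> V" by (rule fe_lincomb[OF u0_mem uI1_mem])
  have uV: "uI \<sigma> y \<in> V" by (rule uI_mem[OF \<sigma>(1) y])
  have r: "?r \<in> V" by (rule fe_lincomb[OF uV wV])
  note aw = coeff_weight[OF \<sigma>(1), of y]
  have zb: "\<bar>\<sigma> * field y x - \<sigma>\<^sup>2 / 2\<bar> \<le> \<sigma> * E" "\<bar>\<sigma> * field y x - \<sigma>\<^sup>2 / 2\<bar> \<le> ell M y + 1" if x: "x \<in> D" for x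
  proof -
    have "\<bar>\<sigma> * field y x - \<sigma>\<^sup>2 / 2\<bar> \<le> \<bar>\<sigma> * field y x\<bar> + \<sigma>\<^sup>2 / 2"
      using abs_triangle_ineq4[of "\<sigma> * field y x" "\<sigma>\<^sup>2 / 2"] by simp
    also have "\<dots> \<le> \<sigma> * ell M y + \<sigma>\<^sup>2 / 2" using field_bound[OF x, of y] \<sigma> by (simp add: abs_mult)
    also have "\<dots> \<le> \<sigma> * (ell M y + 1)"
      using \<sigma> mult_left_mono[OF \<sigma>(2), of \<sigma>] by (simp add: power2_eq_square algebra_simps)
    finally have *: "\<bar>\<sigma> * field y x - \<sigma>\<^sup>2 / 2\<bar> \<le> \<sigma> * (ell M y + 1)" .
    also have "\<dots> \<le> \<sigma> * E" using ellE \<sigma> by simp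
    finally show "\<bar>\<sigma> * field y x - \<sigma>\<^sup>2 / 2\<bar> \<le> \<sigma> * E" .
    have "\<sigma> * (ell M y + 1) \<le> 1 * (ell M y + 1)" using \<sigma> ell_nonneg[of M y] by (intro mult_right_mono) auto
    with * show "\<bar>\<sigma> * field y x - \<sigma>\<^sup>2 / 2\<bar> \<le> ell M y + 1" by simp
  qed
  have kb: "\<bar>?k x\<bar> \<le> \<sigma> * E * E" and hb: "\<bar>?h x\<bar> \<le> 2 * \<sigma>\<^sup>2 * E ^ 3" if x: "x \<in> D" for x
  proof -
    define z where "z = \<sigma> * field y x - \<sigma>\<^sup>2 / 2"
    have ez: "exp \<bar>z\<bar> \<le> E" using zb(2)[OF x] by (simp add: E_def z_def)
    have z: "\<bar>z\<bar> \<le> \<sigma> * E" using zb(1)[OF x] by (simp add: z_def)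
    have az: "?a x = exp z" by (simp add: coeff_def z_def)
    have "\<bar>exp z - 1\<bar> \<le> \<bar>z\<bar> * exp \<bar>z\<bar>" by (rule exp_minus_one_bounds)
    also have "\<dots> \<le> (\<sigma> * E) * E" using z ez \<sigma> ellE by (intro mult_mono) auto
    finally show "\<bar>?k x\<bar> \<le> \<sigma> * E * E" by (simp add: az abs_minus_commute)
    have "\<bar>exp z - 1 - z\<bar> \<le> z\<^sup>2 * exp \<bar>z\<bar>" by (rule exp_minus_one_bounds)
    also have "\<dots> \<le> (\<sigma> * E)\<^sup>2 * E"
      using z ez ellE by (intro mult_mono) (auto simp: abs_le_square_iff[symmetric])
    finally have 1: "\<bar>exp z - 1 - z\<bar> \<le> \<sigma>\<^sup>2 * E ^ 3" by (simp add: power2_eq_square power3_eq_cube mult.assoc mult.left_commute)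
    have "?h x = - (exp z - 1 - z) + \<sigma>\<^sup>2 / 2" by (simp add: az z_def)
    then have "\<bar>?h x\<bar> = \<bar>- (exp z - 1 - z) + \<sigma>\<^sup>2 / 2\<bar>" by (simp only:)
    also have "\<dots> \<le> \<bar>exp z - 1 - z\<bar> + \<sigma>\<^sup>2 / 2" using zero_le_power2[of \<sigma>] by linarith
    finally have "\<bar>?h x\<bar> \<le> \<bar>exp z - 1 - z\<bar> + \<sigma>\<^sup>2 / 2" .
    moreover have "\<sigma>\<^sup>2 / 2 \<le> \<sigma>\<^sup>2 * E ^ 3"
    proof -
      have "\<sigma>\<^sup>2 / 2 \<le> \<sigma>\<^sup>2 * 1" by simp
      also have "\<dots> \<le> \<sigma>\<^sup>2 * E ^ 3" using ellE(2) by (intro mult_left_mono one_le_power) auto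
      finally show ?thesis .
    qed
    ultimately show "\<bar>?h x\<bar> \<le> 2 * \<sigma>\<^sup>2 * E ^ 3" using 1 by linarith
  qed
  have kw: "weight ?k"
    using coeff_measurable[of \<sigma> y] kb by (intro weightI[of _ "\<sigma> * E * E"]) auto
  have hw: "weight ?h"
    using coeff_measurable[of \<sigma> y] field_measurable[of y] hb by (intro weightI[of _ "2 * \<sigma>\<^sup>2 * E ^ 3"]) auto
  \<comment> \<open>The \<open>field\<close> inside \<open>?h\<close> comes from the equation of
    \<open>uI1\<close>, which replaces \<open>ip (uI1 y) ?r\<close> by
    \<open>- wip (field y) u0 ?r\<close>.\<close>
  have eq: "wip ?a ?r ?r = wip ?h u0 ?r + \<sigma> * wip ?k (uI1 y) ?r"
  proof -
    have 1: "wip ?a ?r ?r = 1 * wip ?a (uI \<sigma> y) ?r + (-1) * wip ?a ?w ?r"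
      by (rule wip_lincomb_left[OF aw uV wV r])
    have 2: "wip ?a ?w ?r = 1 * wip ?a u0 ?r + \<sigma> * wip ?a (uI1 y) ?r"
      by (rule wip_lincomb_left[OF aw u0_mem uI1_mem r])
    have 3: "wip ?h u0 ?r = 1 * wip ?k u0 ?r + \<sigma> * wip (field y) u0 ?r"
      by (rule wip_weight_lincomb[OF kw field_weight u0_mem r])
    have 4: "wip ?k u ?r = 1 * ip u ?r + (-1) * wip ?a u ?r" if "u \<in> V" for u
      by (rule wip_weight_lincomb[OF weight_const aw that r])
    show ?thesis
      unfolding 1 2 3 4[OF u0_mem] 4[OF uI1_mem] model_I_wip[OF \<sigma>(1) y r] ip_uI1[OF r]
      by (simp add: algebra_simps)
  qed
  have b1: "wip ?h u0 ?r \<le> 2 * \<sigma>\<^sup>2 * E ^ 3 * (nrm u0 * nrm ?r)"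
  proof (rule order_trans[OF abs_ge_self wip_bound[OF hw _ _ u0_mem r]])
    show "\<bar>?h x\<bar> \<le> 2 * \<sigma>\<^sup>2 * E ^ 3" if "x \<in> D" for x by (rule hb[OF that])
    show "0 \<le> 2 * \<sigma>\<^sup>2 * E ^ 3" using ellE by simp
  qed
  have b2: "\<sigma> * wip ?k (uI1 y) ?r \<le> \<sigma>\<^sup>2 * E ^ 3 * (nrm u0 * nrm ?r)"
  proof -
    have "wip ?k (uI1 y) ?r \<le> \<sigma> * E * E * (nrm (uI1 y) * nrm ?r)"
    proof (rule order_trans[OF abs_ge_self wip_bound[OF kw _ _ uI1_mem r]])
      show "\<bar>?k x\<bar> \<le> \<sigma> * E * E" if "x \<in> D" for x by (rule kb[OF that])
      show "0 \<le> \<sigma> * E * E" using ellE \<sigma> by simp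
    qed
    also have "\<dots> \<le> \<sigma> * E * E * ((E * nrm u0) * nrm ?r)"
    proof (intro mult_left_mono mult_right_mono nrm_nonneg)
      have "ell M y * nrm u0 \<le> E * nrm u0" using ellE by (intro mult_right_mono nrm_nonneg) linarith
      then show "nrm (uI1 y) \<le> E * nrm u0" using uI1_bound[of y] by linarith
      show "0 \<le> \<sigma> * E * E" using \<sigma> ellE by simp
    qed
    finally have "\<sigma> * wip ?k (uI1 y) ?r \<le> \<sigma> * (\<sigma> * E * E * ((E * nrm u0) * nrm ?r))"
      using \<sigma> by (intro mult_left_mono) auto
    then show ?thesis by (simp add: power2_eq_square power3_eq_cube mult.assoc)
  qed
  have "wip ?a ?r ?r \<le> (3 * \<sigma>\<^sup>2 * E ^ 3 * nrm u0) * nrm ?r"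
    unfolding eq using b1 b2 by (simp add: algebra_simps)
  \<comment> \<open>The weights 2 and 1 of the residuals add up to 3; coercivity supplies the fourth
    factor \<open>E\<close>.\<close>
  then have "nrm ?r \<le> (3 * \<sigma>\<^sup>2 * E ^ 3 * nrm u0) * exp (\<sigma> * ell M y + \<sigma>\<^sup>2 / 2)"
    using ellE nrm_nonneg[of u0] by (intro coercive[OF \<sigma>(1) r]) auto
  also have "\<dots> \<le> (3 * \<sigma>\<^sup>2 * E ^ 3 * nrm u0) * E"
  proof (intro mult_left_mono)
    have "\<sigma> * ell M y \<le> 1 * ell M y" using \<sigma> ell_nonneg by (intro mult_right_mono) auto
    moreover have "\<sigma>\<^sup>2 \<le> 1" using \<sigma> by (simp add: power_le_one)
    ultimately show "exp (\<sigma> * ell M y + \<sigma>\<^sup>2 / 2) \<le> E" by (simp add: E_def)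
    show "0 \<le> 3 * \<sigma>\<^sup>2 * E ^ 3 * nrm u0" using ellE nrm_nonneg[of u0] by simp
  qed
  finally show ?thesis unfolding E_def by (simp add: power4_eq_xxxx power3_eq_cube mult.assoc mult.left_commute mult.commute)
qed

end

section \<open>Cancellation between the two models\<close>

context model_problem
begin

definition higher_indices :: "(nat \<Rightarrow> nat) set" where "higher_indices = {\<alpha> \<in> J. 2 \<le> order \<alpha>}"

text \<open>The condition on \<open>p\<close> enters here: with degree at least one all unit indices
  belong to \<open>J\<close>, so model II has terms to set against the first order of model
  I.\<close>

lemma J_split:
  assumes "1 \<le> p"
  shows "J = insert (\<lambda>_. 0) (unit_index ` {..<M} \<union> higher_indices)"
proof
  show "insert (\<lambda>_. 0) (unit_index ` {..<M} \<union> higher_indices) \<subseteq> J"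
    using zero_J unit_index_J assms by (auto simp: higher_indices_def)
  show "J \<subseteq> insert (\<lambda>_. 0) (unit_index ` {..<M} \<union> higher_indices)"
  proof
    fix \<alpha> assume \<alpha>: "\<alpha> \<in> J"
    consider "order \<alpha> = 0" | "order \<alpha> = Suc 0" | "2 \<le> order \<alpha>" by linarith
    then show "\<alpha> \<in> insert (\<lambda>_. 0) (unit_index ` {..<M} \<union> higher_indices)"
    proof cases
      case 1
      then have "\<alpha> k = 0" if "k < M" for k using that by (simp add: order_def)
      then have "\<alpha> = (\<lambda>_. 0)" by (intro J_eqI \<alpha> zero_J) auto
      then show ?thesis by simp
    next
      case 2
      then obtain k where k: "k < M" "\<alpha> k = Suc 0" "\<And>i. i < M \<Longrightarrow> k \<noteq> i \<Longrightarrow> \<alpha> i = 0"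
        unfolding order_def sum_eq_Suc0_iff[OF finite_lessThan] by auto
      have "\<alpha> = unit_index k"
        by (rule J_eqI[OF \<alpha> unit_index_J[OF k(1) assms]]) (use k in \<open>auto simp: unit_index_def\<close>)
      then show ?thesis using k(1) by blast
    next
      case 3
      then show ?thesis using \<alpha> by (simp add: higher_indices_def)
    qed
  qed
qed

lemma sum_J_split:
  assumes "1 \<le> p"
  shows "(\<Sum>\<alpha>\<in>J. g \<alpha>) = g (\<lambda>_. 0) + ((\<Sum>k<M. g (unit_index k)) + (\<Sum>\<alpha>\<in>higher_indices. g \<alpha>) :: real)"
proof -
  have f2: "finite higher_indices" using finite_J by (simp add: higher_indices_def)
  have ne: "(\<lambda>_. 0) \<notin> unit_index ` {..<M} \<union> higher_indices"
  proof
    assume "(\<lambda>_. 0) \<in> unit_index ` {..<M} \<union> higher_indices"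
    moreover have "order (\<lambda>_. 0) = 0" by (simp add: order_def)
    ultimately show False using order_unit_index by (auto simp: higher_indices_def)
  qed
  have dis: "unit_index ` {..<M} \<inter> higher_indices = {}" using order_unit_index by (auto simp: higher_indices_def)
  have inj: "inj_on unit_index {..<M}"
    by (rule inj_onI) (metis unit_index_def zero_neq_one)
  have "(\<Sum>\<alpha>\<in>J. g \<alpha>) = (\<Sum>\<alpha>\<in>insert (\<lambda>_. 0) (unit_index ` {..<M} \<union> higher_indices). g \<alpha>)"
    using J_split[OF assms] by simp
  also have "\<dots> = g (\<lambda>_. 0) + (\<Sum>\<alpha>\<in>unit_index ` {..<M} \<union> higher_indices. g \<alpha>)"
    by (rule sum.insert) (use f2 ne in auto)
  also have "(\<Sum>\<alpha>\<in>unit_index ` {..<M} \<union> higher_indices. g \<alpha>) = (\<Sum>\<alpha>\<in>unit_index ` {..<M}. g \<alpha>) + (\<Sum>\<alpha>\<in>higher_indices. g \<alpha>)"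
    by (rule sum.union_disjoint) (use f2 dis in auto)
  also have "(\<Sum>\<alpha>\<in>unit_index ` {..<M}. g \<alpha>) = (\<Sum>k<M. g (unit_index k))"
    using sum.reindex[OF inj, of g] by simp
  finally show ?thesis .
qed

lemma hermite_multi_0: "hermite_multi M (\<lambda>_. 0) y = 1"
  by (simp add: hermite_multi_def)

lemma hermite_multi_unit: "k < M \<Longrightarrow> hermite_multi M (unit_index k) y = y k"
proof -
  assume k: "k < M"
  have "hermite_multi M (unit_index k) y = (\<Prod>i<M. if i = k then y k else 1)"
    unfolding hermite_multi_def unit_index_def by (intro prod.cong) auto
  then show ?thesis using k by simp
qed

abbreviation ut :: "real \<Rightarrow> (nat \<Rightarrow> real) \<Rightarrow> 'a \<Rightarrow> real" where
  "ut \<sigma> y \<equiv> u_tilde M p (uI \<sigma>) (uII \<sigma>) y"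

lemma ut_eq:
  "ut \<sigma> y = (\<lambda>x. 1 * (1 * uII \<sigma> (\<lambda>_. 0) x + 1 * uI \<sigma> y x)
    + (-1) * (\<Sum>\<alpha>\<in>J. hermite_multi M \<alpha> y * uII \<sigma> \<alpha> x))"
  by (rule ext) (simp add: u_tilde_def chaos_sum_def mult.commute)

lemma ut_mem:
  assumes "0 < \<sigma>" "y \<in> params"
  shows "ut \<sigma> y \<in> V"
  unfolding ut_eq by (intro fe_lincomb uII_mem uI_mem zero_J sum_mem assms)

lemma ut_coord:
  assumes "0 < \<sigma>" "y \<in> params" "v \<in> V"
  shows "ip (ut \<sigma> y) v = ip (uII \<sigma> (\<lambda>_. 0)) v + ip (uI \<sigma> y) v - (\<Sum>\<alpha>\<in>J. hermite_multi M \<alpha> y * ip (uII \<sigma> \<alpha>) v)"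
proof -
  note U = uII_mem[OF assms(1) zero_J] and u = uI_mem[OF assms(1,2)]
  have S: "(\<lambda>x. \<Sum>\<alpha>\<in>J. hermite_multi M \<alpha> y * uII \<sigma> \<alpha> x) \<in> V"
    by (intro sum_mem uII_mem assms)
  have "ip (ut \<sigma> y) v = 1 * (1 * ip (uII \<sigma> (\<lambda>_. 0)) v + 1 * ip (uI \<sigma> y) v)
      + (-1) * ip (\<lambda>x. \<Sum>\<alpha>\<in>J. hermite_multi M \<alpha> y * uII \<sigma> \<alpha> x) v"
    unfolding ut_eq
    by (simp only: wip_lincomb_left[OF weight_const fe_lincomb[OF U u] S assms(3)] wip_lincomb_left[OF weight_const U u assms(3)])
  moreover have "ip (\<lambda>x. \<Sum>\<alpha>\<in>J. hermite_multi M \<alpha> y * uII \<sigma> \<alpha> x) v = (\<Sum>\<alpha>\<in>J. hermite_multi M \<alpha> y * ip (uII \<sigma> \<alpha>) v)"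
    by (rule ip_sum_left) (use uII_mem assms in auto)
  ultimately show ?thesis by simp
qed

lemma exp_bounded_ell: "exp_bounded M (ell M)"
  unfolding ell_def[abs_def] by (intro exp_bounded_sum exp_bounded_abs exp_bounded_coord) auto

text \<open>The terms of order zero and one in \<open>\<sigma>\<close> cancel between the two models.\<close>

lemma ut_deviation:
  assumes p: "1 \<le> p"
  shows "\<exists>G. exp_bounded M G \<and> (\<forall>\<sigma> y. 0 < \<sigma> \<and> \<sigma> \<le> 1 \<and> y \<in> params \<longrightarrow>
    nrm (\<lambda>x. 1 * ut \<sigma> y x + (-1) * u0 x) \<le> \<sigma>\<^sup>2 * G y)"
proof -
  have "\<forall>\<alpha>\<in>J. \<exists>C\<ge>0. \<forall>\<sigma>. 0 < \<sigma> \<and> \<sigma> \<le> 1 \<longrightarrow> nrm (uII \<sigma> \<alpha>) \<le> C * \<sigma> ^ order \<alpha>"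
    using uII_bound by blast
  then obtain C where C: "\<And>\<alpha>. \<alpha> \<in> J \<Longrightarrow> C \<alpha> \<ge> 0"
    "\<And>\<alpha> \<sigma>. \<alpha> \<in> J \<Longrightarrow> 0 < \<sigma> \<Longrightarrow> \<sigma> \<le> 1 \<Longrightarrow> nrm (uII \<sigma> \<alpha>) \<le> C \<alpha> * \<sigma> ^ order \<alpha>"
    by (metis (no_types, lifting))
  \<comment> \<open>The three terms bound, after division by \<open>\<sigma>\<^sup>2\<close>, the
    remainder of model I, the first-order mismatch caused by \<open>exp (\<sigma>\<^sup>2)\<close>,
    and the chaos terms of degree at least two.\<close>
  define G where "G y = 3 * exp (ell M y + 1) ^ 4 * nrm u0 + exp 1 * (ell M y * nrm u0)
     + (\<Sum>\<alpha>\<in>higher_indices. \<bar>hermite_multi M \<alpha> y\<bar> * C \<alpha>)" for y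
  have e4: "exp (ell M y + 1) ^ 4 = exp 4 * exp (4 * ell M y)" for y
    by (simp add: exp_add[symmetric] exp_of_nat_mult[symmetric] algebra_simps)
  have "exp_bounded M G"
    unfolding G_def[abs_def] e4
    by (intro exp_bounded_add exp_bounded_mult exp_bounded_const exp_bounded_exp exp_bounded_ell
        exp_bounded_sum exp_bounded_abs exp_bounded_hermite_multi) auto
  moreover have "nrm (\<lambda>x. 1 * ut \<sigma> y x + (-1) * u0 x) \<le> \<sigma>\<^sup>2 * G y"
    if \<sigma>: "0 < \<sigma>" "\<sigma> \<le> 1" and y: "y \<in> params" for \<sigma> y
  proof -
    let ?r = "\<lambda>x. 1 * uI \<sigma> y x + (-1) * (1 * u0 x + \<sigma> * uI1 y x)"
    let ?S = "\<lambda>x. \<Sum>\<alpha>\<in>higher_indices. hermite_multi M \<alpha> y * uII \<sigma> \<alpha> x"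
    \<comment> \<open>\<open>uI1 y\<close> carries the factor \<sigma> in model I and
      \<open>\<sigma> * exp (\<sigma>\<^sup>2)\<close> in model II. The difference is of order
      \<sigma>^3; order \<sigma>^2 is all that is used below.\<close>
    let ?d = "\<sigma> * (1 - exp (\<sigma>\<^sup>2))"
    have rV: "?r \<in> V" by (intro fe_lincomb uI_mem u0_mem uI1_mem \<sigma> y)
    have higher_mem: "uII \<sigma> \<alpha> \<in> V" if "\<alpha> \<in> higher_indices" for \<alpha> using that \<sigma> by (intro uII_mem) (auto simp: higher_indices_def)
    have SV: "?S \<in> V" by (intro sum_mem higher_mem)
    have unit: "uII \<sigma> (unit_index k) = (\<lambda>x. (\<sigma> * exp (\<sigma>\<^sup>2)) * mode_response k x + 0 * mode_response k x)" if k: "k < M" for k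
    proof (rule fe_eqI[OF uII_mem[OF \<sigma>(1) unit_index_J[OF k p]] fe_lincomb[OF mode_response(1) mode_response(1)]])
      fix w assume w: "w \<in> V"
      show "ip (uII \<sigma> (unit_index k)) w = ip (\<lambda>x. (\<sigma> * exp (\<sigma>\<^sup>2)) * mode_response k x + 0 * mode_response k x) w"
        unfolding wip_lincomb_left[OF weight_const mode_response(1) mode_response(1) w] uII_unit[OF \<sigma>(1) k p w] by simp
    qed
    have eq: "(\<lambda>x. 1 * ut \<sigma> y x + (-1) * u0 x) = (\<lambda>x. 1 * (1 * ?r x + ?d * uI1 y x) + (-1) * ?S x)"
    proof
      fix x
      have "(\<Sum>k<M. hermite_multi M (unit_index k) y * uII \<sigma> (unit_index k) x) = (\<Sum>k<M. (\<sigma> * exp (\<sigma>\<^sup>2)) * (y k * mode_response k x))"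
        by (intro sum.cong refl) (simp add: hermite_multi_unit unit)
      also have "\<dots> = \<sigma> * exp (\<sigma>\<^sup>2) * uI1 y x" unfolding uI1_def by (rule sum_distrib_left[symmetric])
      finally have u: "(\<Sum>k<M. hermite_multi M (unit_index k) y * uII \<sigma> (unit_index k) x) = \<sigma> * exp (\<sigma>\<^sup>2) * uI1 y x" .
      have "(\<Sum>\<alpha>\<in>J. hermite_multi M \<alpha> y * uII \<sigma> \<alpha> x) = uII \<sigma> (\<lambda>_. 0) x + (\<sigma> * exp (\<sigma>\<^sup>2) * uI1 y x + ?S x)"
        unfolding sum_J_split[OF p] u hermite_multi_0 by simp
      then show "1 * ut \<sigma> y x + (-1) * u0 x = 1 * (1 * ?r x + ?d * uI1 y x) + (-1) * ?S x"
        unfolding ut_eq by (simp add: algebra_simps)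
    qed
    have d: "\<bar>?d\<bar> \<le> \<sigma>\<^sup>2 * exp 1"
    proof -
      have "\<sigma>\<^sup>2 \<le> 1" using \<sigma> by (simp add: power_le_one)
      have "\<bar>exp (\<sigma>\<^sup>2) - 1\<bar> \<le> \<bar>\<sigma>\<^sup>2\<bar> * exp \<bar>\<sigma>\<^sup>2\<bar>" by (rule exp_minus_one_bounds)
      also have "\<dots> \<le> \<sigma>\<^sup>2 * exp 1" using \<open>\<sigma>\<^sup>2 \<le> 1\<close> by (simp add: mult_left_mono)
      finally have 1: "\<bar>1 - exp (\<sigma>\<^sup>2)\<bar> \<le> \<sigma>\<^sup>2 * exp 1" by (simp add: abs_minus_commute)
      have "\<bar>?d\<bar> = \<sigma> * \<bar>1 - exp (\<sigma>\<^sup>2)\<bar>" using \<sigma> by (simp add: abs_mult)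
      also have "\<dots> \<le> 1 * \<bar>1 - exp (\<sigma>\<^sup>2)\<bar>" using \<sigma> by (intro mult_right_mono) auto
      finally show ?thesis using 1 by simp
    qed
    have "nrm (\<lambda>x. 1 * ut \<sigma> y x + (-1) * u0 x) \<le> \<bar>1\<bar> * nrm (\<lambda>x. 1 * ?r x + ?d * uI1 y x) + \<bar>-1\<bar> * nrm ?S"
      unfolding eq by (rule nrm_lincomb[OF fe_lincomb[OF rV uI1_mem] SV])
    also have "\<dots> = nrm (\<lambda>x. 1 * ?r x + ?d * uI1 y x) + nrm ?S" by simp
    also have "\<dots> \<le> (nrm ?r + \<bar>?d\<bar> * nrm (uI1 y)) + nrm ?S"
      using nrm_lincomb[OF rV uI1_mem, of 1 ?d y] by (simp only: abs_one mult_1 add_le_cancel_right)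
    also have "\<dots> \<le> (3 * \<sigma>\<^sup>2 * exp (ell M y + 1) ^ 4 * nrm u0 + (\<sigma>\<^sup>2 * exp 1) * (ell M y * nrm u0))
        + (\<Sum>\<alpha>\<in>higher_indices. \<bar>hermite_multi M \<alpha> y\<bar> * (C \<alpha> * \<sigma>\<^sup>2))"
    proof (intro add_mono model_I_expansion \<sigma> y mult_mono d uI1_bound nrm_nonneg)
      have "nrm ?S \<le> (\<Sum>\<alpha>\<in>higher_indices. \<bar>hermite_multi M \<alpha> y\<bar> * nrm (uII \<sigma> \<alpha>))"
        by (rule nrm_sum[OF higher_mem])
      also have "\<dots> \<le> (\<Sum>\<alpha>\<in>higher_indices. \<bar>hermite_multi M \<alpha> y\<bar> * (C \<alpha> * \<sigma>\<^sup>2))"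
      proof (intro sum_mono mult_left_mono)
        fix \<alpha> assume a: "\<alpha> \<in> higher_indices"
        then have J: "\<alpha> \<in> J" "2 \<le> order \<alpha>" by (auto simp: higher_indices_def)
        have "nrm (uII \<sigma> \<alpha>) \<le> C \<alpha> * \<sigma> ^ order \<alpha>" by (rule C(2)[OF J(1) \<sigma>])
        also have "\<dots> \<le> C \<alpha> * \<sigma>\<^sup>2"
          using J \<sigma> C(1)[OF J(1)] by (intro mult_left_mono power_decreasing) auto
        finally show "nrm (uII \<sigma> \<alpha>) \<le> C \<alpha> * \<sigma>\<^sup>2" .
      qed simp
      finally show "nrm ?S \<le> (\<Sum>\<alpha>\<in>higher_indices. \<bar>hermite_multi M \<alpha> y\<bar> * (C \<alpha> * \<sigma>\<^sup>2))" .
    qed (use \<sigma> in auto)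
    also have "\<dots> = \<sigma>\<^sup>2 * G y"
      unfolding G_def by (simp add: distrib_left sum_distrib_left mult.assoc mult.left_commute mult.commute)
    finally show ?thesis .
  qed
  ultimately show ?thesis by blast
qed

end

section \<open>Hermite polynomials under the Gaussian density\<close>

lemma hermite_has_derivative:
  "(hermite (Suc m) has_real_derivative real (Suc m) * hermite m t) (at t)"
proof (induction m arbitrary: t rule: less_induct)
  case (less m)
  consider "m = 0" | "m = Suc 0" | l where "m = Suc (Suc l)" by (metis not0_implies_Suc)
  then show ?case
  proof cases
    case 1
    have "hermite (Suc 0) = (\<lambda>t. t)" by auto
    with 1 show ?thesis by (simp add: DERIV_ident)
  next
    case 2
    have "hermite (Suc (Suc 0)) = (\<lambda>t. t * t - 1)" by auto
    moreover have "((\<lambda>t. t * t - 1) has_real_derivative 2 * t) (at t)"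
      by (auto intro!: derivative_eq_intros)
    ultimately show ?thesis using 2 by simp
  next
    case 3
    have eq: "hermite (Suc m) = (\<lambda>t. t * hermite m t - real m * hermite (Suc l) t)"
      using 3 by (intro ext) simp
    have d1: "(hermite m has_real_derivative real m * hermite (Suc l) t) (at t)"
      unfolding 3 by (rule less.IH) (simp add: 3)
    have d2: "(hermite (Suc l) has_real_derivative real (Suc l) * hermite l t) (at t)"
      by (rule less.IH) (simp add: 3)
    have "((\<lambda>t. t * hermite m t - real m * hermite (Suc l) t) has_real_derivative
        (1 * hermite m t + real m * hermite (Suc l) t * t) - real m * (real (Suc l) * hermite l t)) (at t)"
      by (intro DERIV_diff DERIV_mult DERIV_ident DERIV_cmult d1 d2)
    moreover have "(1 * hermite m t + real m * hermite (Suc l) t * t) - real m * (real (Suc l) * hermite l t) = real (Suc m) * hermite m t"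
      unfolding 3 hermite.simps by (simp add: algebra_simps)
    ultimately show ?thesis by (simp only: eq)
  qed
qed

lemma continuous_hermite: "continuous_on UNIV (hermite m)"
proof (cases m)
  case 0
  then show ?thesis by simp
next
  case (Suc l)
  then show ?thesis
    using hermite_has_derivative[of l] by (meson DERIV_isCont continuous_at_imp_continuous_on)
qed

lemma hermite_measurable [measurable]: "hermite m \<in> borel_measurable borel"
  using continuous_hermite by (rule borel_measurable_continuous_onI)

text \<open>The multivariate bound read in dimension 1, where \<open>ell\<close> is the absolute
  value.\<close>

lemma hermite_exp_bound:
  obtains C c where "0 \<le> C" "0 \<le> c" "\<And>t. \<bar>hermite m t\<bar> \<le> C * exp (c * \<bar>t\<bar>)"
proof -
  obtain C c where C: "0 \<le> C" "0 \<le> c" "\<And>y. \<bar>hermite m (y 0)\<bar> \<le> C * exp (c * ell 1 y)"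
    using exp_bounded_hermite[of 0 1 m] unfolding exp_bounded_def by auto
  have "\<bar>hermite m t\<bar> \<le> C * exp (c * \<bar>t\<bar>)" for t using C(3)[of "\<lambda>_. t"] by (simp add: ell_def)
  then show ?thesis using C that by blast
qed

text \<open>Completing the square turns \<open>std_normal_density x * exp (b * x)\<close> into a
  multiple of the normal density with mean \<open>b\<close>; the two signs of \<open>b\<close>
  together dominate the exponential of the absolute value.\<close>

lemma integrable_std_normal_exp: "integrable lborel (\<lambda>x. std_normal_density x * exp (c * \<bar>x\<bar>))"
proof -
  have shift: "std_normal_density x * exp (b * x) = exp (b\<^sup>2 / 2) * normal_density b 1 x" for b x :: real
    by (simp add: normal_density_def power2_eq_square algebra_simps flip: exp_add) (simp add: field_simps)
  show ?thesis
  proof (rule Bochner_Integration.integrable_bound)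
    show "integrable lborel (\<lambda>x. std_normal_density x * exp (\<bar>c\<bar> * x) + std_normal_density x * exp ((- \<bar>c\<bar>) * x))"
      unfolding shift by (intro Bochner_Integration.integrable_add integrable_mult_right integrable_normal_density) auto
    have "norm (std_normal_density x * exp (c * \<bar>x\<bar>)) \<le> norm (std_normal_density x * exp (\<bar>c\<bar> * x) + std_normal_density x * exp ((- \<bar>c\<bar>) * x))" for x
    proof -
      have "c * \<bar>x\<bar> \<le> \<bar>c\<bar> * \<bar>x\<bar>" by (intro mult_right_mono) auto
      then have "exp (c * \<bar>x\<bar>) \<le> exp (\<bar>c\<bar> * x) + exp ((- \<bar>c\<bar>) * x)"
        by (cases "x \<ge> 0") (auto intro: add_increasing add_increasing2)
      then have "std_normal_density x * exp (c * \<bar>x\<bar>) \<le> std_normal_density x * (exp (\<bar>c\<bar> * x) + exp ((- \<bar>c\<bar>) * x))"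
        by (intro mult_left_mono normal_density_nonneg)
      moreover have "0 \<le> std_normal_density x * exp (c * \<bar>x\<bar>)" by (intro mult_nonneg_nonneg normal_density_nonneg) simp
      ultimately show ?thesis by (simp add: distrib_left)
    qed
    then show "AE x in lborel. norm (std_normal_density x * exp (c * \<bar>x\<bar>)) \<le> norm (std_normal_density x * exp (\<bar>c\<bar> * x) + std_normal_density x * exp ((- \<bar>c\<bar>) * x))"
      by (intro AE_I2)
  qed measurable
qed

lemma integrable_std_normal_hermite: "integrable lborel (\<lambda>x. std_normal_density x * hermite m x)"
proof -
  obtain C c where C: "0 \<le> C" "0 \<le> c" "\<And>t. \<bar>hermite m t\<bar> \<le> C * exp (c * \<bar>t\<bar>)"
    using hermite_exp_bound by blast
  show ?thesis
  proof (rule Bochner_Integration.integrable_bound)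
    show "integrable lborel (\<lambda>x. C * (std_normal_density x * exp (c * \<bar>x\<bar>)))"
      by (intro integrable_mult_right integrable_std_normal_exp)
    have "norm (std_normal_density x * hermite m x) \<le> norm (C * (std_normal_density x * exp (c * \<bar>x\<bar>)))" for x
    proof -
      have "std_normal_density x * \<bar>hermite m x\<bar> \<le> std_normal_density x * (C * exp (c * \<bar>x\<bar>))"
        by (intro mult_left_mono C normal_density_nonneg)
      then show ?thesis using C(1) by (simp add: abs_mult mult.left_commute)
    qed
    then show "AE x in lborel. norm (std_normal_density x * hermite m x) \<le> norm (C * (std_normal_density x * exp (c * \<bar>x\<bar>)))"
      by (intro AE_I2)
  qed measurable
qed

text \<open>Needed for the boundary terms at both infinities. Half of the Gaussian exponent absorbs
  the linear growth, \<open>c * \<bar>x\<bar> \<le> c\<^sup>2 + x\<^sup>2 / 4\<close>, and the rest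
  satisfies \<open>exp (- (x\<^sup>2 / 4)) \<le> 4 * (inverse x)\<^sup>2\<close>.\<close>

lemma std_normal_hermite_tendsto_0: "((\<lambda>x. std_normal_density x * hermite m x) \<longlongrightarrow> 0) at_infinity"
proof -
  obtain C c where C: "0 \<le> C" "0 \<le> c" "\<And>t. \<bar>hermite m t\<bar> \<le> C * exp (c * \<bar>t\<bar>)"
    using hermite_exp_bound by blast
  define K where "K = 1 / sqrt (2 * pi) * (C * exp (c\<^sup>2))"
  have "norm (std_normal_density x * hermite m x) \<le> K * (4 * (inverse x)\<^sup>2)" if x: "x \<noteq> 0" for x
  proof -
    have "c * \<bar>x\<bar> \<le> c\<^sup>2 + x\<^sup>2 / 4"
      using zero_le_power2[of "\<bar>x\<bar> / 2 - c"] by (simp add: power2_eq_square field_simps)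
    then have e: "exp (- x\<^sup>2 / 2) * exp (c * \<bar>x\<bar>) \<le> exp (c\<^sup>2) * exp (- (x\<^sup>2 / 4))"
      unfolding exp_add[symmetric] exp_le_cancel_iff by simp
    have "exp (- (x\<^sup>2 / 4)) \<le> 4 * (inverse x)\<^sup>2"
    proof -
      have "x\<^sup>2 / 4 \<le> exp (x\<^sup>2 / 4)" using exp_ge_add_one_self[of "x\<^sup>2 / 4"] by linarith
      then have "inverse (exp (x\<^sup>2 / 4)) \<le> inverse (x\<^sup>2 / 4)" using x by (intro le_imp_inverse_le) auto
      then show ?thesis by (simp add: exp_minus field_simps)
    qed
    then have e2: "exp (c\<^sup>2) * exp (- (x\<^sup>2 / 4)) \<le> exp (c\<^sup>2) * (4 * (inverse x)\<^sup>2)"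
      by (intro mult_left_mono) auto
    have "norm (std_normal_density x * hermite m x) = 1 / sqrt (2 * pi) * (exp (- x\<^sup>2 / 2) * \<bar>hermite m x\<bar>)"
      by (simp add: std_normal_density_def abs_mult)
    also have "\<dots> \<le> 1 / sqrt (2 * pi) * (exp (- x\<^sup>2 / 2) * (C * exp (c * \<bar>x\<bar>)))"
      by (intro mult_left_mono C) auto
    also have "\<dots> = 1 / sqrt (2 * pi) * (C * (exp (- x\<^sup>2 / 2) * exp (c * \<bar>x\<bar>)))" by simp
    also have "\<dots> \<le> 1 / sqrt (2 * pi) * (C * (exp (c\<^sup>2) * (4 * (inverse x)\<^sup>2)))"
      using order_trans[OF e e2] C(1) by (intro mult_left_mono) auto
    finally show ?thesis by (simp add: K_def)
  qed
  then have ev: "\<forall>\<^sub>F x in at_infinity. norm (std_normal_density x * hermite m x) \<le> K * (4 * (inverse x)\<^sup>2)"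
    unfolding eventually_at_infinity by (intro exI[of _ 1]) auto
  have "((\<lambda>x::real. K * (4 * (inverse x)\<^sup>2)) \<longlongrightarrow> K * (4 * 0\<^sup>2)) at_infinity"
    by (intro tendsto_intros tendsto_inverse_0)
  then have "((\<lambda>x::real. K * (4 * (inverse x)\<^sup>2)) \<longlongrightarrow> 0) at_infinity" by simp
  then show ?thesis by (rule Lim_null_comparison[OF ev])
qed

text \<open>\<open>He\<^sub>m\<^sub>+\<^sub>1 \<phi> = - (He\<^sub>m \<phi>)'\<close> for the Gaussian density \<open>\<phi>\<close>.\<close>

lemma integral_std_normal_hermite: "(\<integral>x. std_normal_density x * hermite (Suc m) x \<partial>lborel) = 0"
proof -
  define F where "F x = std_normal_density x * hermite m x" for x
  have dphi: "(std_normal_density has_real_derivative - x * std_normal_density x) (at x)" for x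
  proof -
    have "((\<lambda>x::real. exp (- x\<^sup>2 / 2)) has_real_derivative - x * exp (- x\<^sup>2 / 2)) (at x)"
      by (auto intro!: derivative_eq_intros)
    from DERIV_cmult[OF this, of "1 / sqrt (2 * pi)"] show ?thesis
      by (simp only: std_normal_density_def[abs_def] mult.left_commute)
  qed
  have dF: "(F has_real_derivative - (std_normal_density x * hermite (Suc m) x)) (at x)" for x
  proof (cases m)
    case 0
    then have "F = std_normal_density" by (auto simp: F_def)
    then show ?thesis using dphi[of x] 0 by (simp add: mult.commute)
  next
    case (Suc l)
    have "(F has_real_derivative (- x * std_normal_density x) * hermite (Suc l) x + (real (Suc l) * hermite l x) * std_normal_density x) (at x)"
      unfolding F_def[abs_def] Suc by (intro DERIV_mult dphi hermite_has_derivative)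
    then show ?thesis unfolding Suc hermite.simps by (rule DERIV_cong) (simp add: algebra_simps)
  qed
  have lim: "(F \<longlongrightarrow> 0) at_top" "(F \<longlongrightarrow> 0) at_bot"
    using std_normal_hermite_tendsto_0[of m] unfolding F_def[abs_def]
    by (auto intro: filterlim_mono at_top_le_at_infinity at_bot_le_at_infinity)
  have int: "integrable lborel (\<lambda>x. - (std_normal_density x * hermite (Suc m) x))"
    using integrable_std_normal_hermite by (intro Bochner_Integration.integrable_minus)
  \<comment> \<open>The fundamental theorem of calculus over the whole line, with both boundary
    values equal to 0.\<close>
  have "(LBINT x=-\<infinity>..\<infinity>. - (std_normal_density x * hermite (Suc m) x)) = 0 - 0"
  proof (rule interval_integral_FTC_integrable)
    show "(F has_vector_derivative - (std_normal_density x * hermite (Suc m) x)) (at x)" for x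
      using dF by (simp add: has_real_derivative_iff_has_vector_derivative)
    show "isCont (\<lambda>x. - (std_normal_density x * hermite (Suc m) x)) x" for x
    proof -
      have "isCont std_normal_density x" using dphi by (rule DERIV_isCont)
      moreover have "isCont (hermite (Suc m)) x" using continuous_hermite by (simp add: continuous_on_eq_continuous_at)
      ultimately show ?thesis by (intro continuous_intros)
    qed
    show "set_integrable lborel (einterval (-\<infinity>) \<infinity>) (\<lambda>x. - (std_normal_density x * hermite (Suc m) x))"
      using int by (simp add: set_integrable_def)
    show "((F \<circ> real_of_ereal) \<longlongrightarrow> 0) (at_right (-\<infinity>))" "((F \<circ> real_of_ereal) \<longlongrightarrow> 0) (at_left \<infinity>)"
      using lim by (simp_all add: ereal_tendsto_simps)
  qed simp
  then show ?thesis by (simp add: interval_lebesgue_integral_def set_lebesgue_integral_def)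
qed

section \<open>Gaussian expectations\<close>

context finite_elements
begin

lemma fe_grad_sum:
  assumes "\<And>i. i \<in> I \<Longrightarrow> e i \<in> V" "x \<in> D - skeleton"
  shows "classical_grad (\<lambda>x. \<Sum>i\<in>I. d i * e i x) x = (\<Sum>i\<in>I. d i *\<^sub>R classical_grad (e i) x)"
proof (cases "finite I")
  case True
  then show ?thesis using assms(1)
  proof (induction I rule: finite_induct)
    case (insert i I)
    have "classical_grad (\<lambda>x. d i * e i x + 1 * (\<Sum>i\<in>I. d i * e i x)) x
        = d i *\<^sub>R classical_grad (e i) x + 1 *\<^sub>R classical_grad (\<lambda>x. \<Sum>i\<in>I. d i * e i x) x"
      using insert by (intro fe_grad_lincomb sum_mem assms(2)) auto
    then show ?case using insert by simp
  qed (simp add: C1_const(2))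
qed (simp add: C1_const(2))

lemma H10_norm_square: "v \<in> V \<Longrightarrow> (H10_norm D v)\<^sup>2 = ip v v"
  using ip_nonneg[of v] by (simp add: H10_norm_def fe_weak_grad wip_def dot_square_norm)

text \<open>Both branches of \<open>weak_grad\<close> yield a weak gradient as soon as one exists.
  General elements of \<open>H10 D\<close> occur as test elements in the weak measurability that
  \<open>L2_H10\<close> demands.\<close>

lemma weak_grad_square_integrable: "v \<in> H10 D \<Longrightarrow> square_integrable_on D (weak_grad D v)"
proof -
  assume "v \<in> H10 D"
  then have ex: "\<exists>g. has_weak_grad D v g" by (auto simp: H10_def)
  have "has_weak_grad D v (weak_grad D v)"
  proof (cases "has_weak_grad D v (classical_grad v)")
    case False
    then show ?thesis using someI_ex[OF ex] by (simp add: weak_grad_def)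
  qed (simp add: weak_grad_def)
  then show ?thesis by (rule has_weak_gradD(2))
qed

end

section \<open>Moments of functions of the Gaussian vector\<close>

locale random_problem = model_problem D \<T> q n e f lam \<phi> M p uI uII + prob_space P
  for D :: "'a::euclidean_space set" and \<T> q n e f lam \<phi> M p uI uII and P :: "'w measure" +
  fixes \<xi> :: "nat \<Rightarrow> 'w \<Rightarrow> real"
  assumes xi_indep: "indep_vars (\<lambda>_. borel) \<xi> UNIV"
    and xi_normal: "distributed P lborel (\<xi> k) std_normal_density"
begin

abbreviation param_measure :: "(nat \<Rightarrow> real) measure" where
  "param_measure \<equiv> Pi\<^sub>M {..<M} (\<lambda>_. borel)"

abbreviation gv :: "'w \<Rightarrow> nat \<Rightarrow> real" where "gv \<equiv> gaussian_vector M \<xi>"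

lemma xi_measurable [measurable]: "\<xi> k \<in> borel_measurable P"
  using distributed_measurable[OF xi_normal[of k]] by simp

lemma gv_measurable: "gv \<in> P \<rightarrow>\<^sub>M param_measure"
  unfolding gaussian_vector_def[abs_def] by (rule measurable_restrict) simp

lemma gv_params: "gv \<omega> \<in> params"
  by (simp add: gaussian_vector_def)

lemma space_param_measure: "space param_measure = params"
  by (simp add: space_PiM)

lemma integrable_xi:
  assumes "integrable lborel (\<lambda>x. std_normal_density x * g x)" "g \<in> borel_measurable borel"
  shows "integrable P (\<lambda>\<omega>. g (\<xi> k \<omega>))"
  using distributed_integrable[OF xi_normal[of k], of g] assms by simp

lemma xi_indep_compose:
  assumes "\<And>k. Y k \<in> borel_measurable borel"
  shows "indep_vars (\<lambda>_. borel) (\<lambda>k \<omega>. Y k (\<xi> k \<omega>)) {..<M}"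
  by (rule indep_vars_compose2[OF indep_vars_subset[OF xi_indep subset_UNIV]]) (rule assms)

text \<open>The exponential of the l1 norm is a product over the coordinates, so independence
  reduces the claim to one dimension.\<close>

lemma integrable_exp_gv: "integrable P (\<lambda>\<omega>. exp (c * ell M (gv \<omega>)))"
proof -
  have "integrable P (\<lambda>\<omega>. \<Prod>k<M. exp (c * \<bar>\<xi> k \<omega>\<bar>))"
    by (rule indep_vars_integrable[OF finite_lessThan xi_indep_compose])
      (auto intro!: integrable_xi integrable_std_normal_exp)
  moreover have "(\<Prod>k<M. exp (c * \<bar>\<xi> k \<omega>\<bar>)) = exp (c * ell M (gv \<omega>))" for \<omega>
    by (simp add: ell_def gaussian_vector_def sum_distrib_left exp_sum)
  ultimately show ?thesis by simp
qed

text \<open>Measurability and growth in one notion that is stable under sums and products, so that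
  squares of coordinates need no separate integrability argument. The bound is required on
  \<open>params\<close>, where the solutions are given.\<close>

definition moderate :: "((nat \<Rightarrow> real) \<Rightarrow> real) \<Rightarrow> bool" where
  "moderate g \<longleftrightarrow> g \<in> borel_measurable param_measure \<and>
    (\<exists>G. exp_bounded M G \<and> (\<forall>y\<in>params. \<bar>g y\<bar> \<le> \<bar>G y\<bar>))"

lemma moderateI:
  "g \<in> borel_measurable param_measure \<Longrightarrow> exp_bounded M G \<Longrightarrow> (\<And>y. y \<in> params \<Longrightarrow> \<bar>g y\<bar> \<le> \<bar>G y\<bar>) \<Longrightarrow> moderate g"
  unfolding moderate_def by blast

lemma moderate_measurable: "moderate g \<Longrightarrow> g \<in> borel_measurable param_measure"
  by (simp add: moderate_def)

lemma moderate_const: "moderate (\<lambda>_. c)"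
  by (rule moderateI[OF _ exp_bounded_const[of M c]]) auto

lemma moderate_mult:
  assumes "moderate g" "moderate h"
  shows "moderate (\<lambda>y. g y * h y)"
proof -
  obtain G where G: "exp_bounded M G" "\<forall>y\<in>params. \<bar>g y\<bar> \<le> \<bar>G y\<bar>" using assms(1) unfolding moderate_def by blast
  obtain H where H: "exp_bounded M H" "\<forall>y\<in>params. \<bar>h y\<bar> \<le> \<bar>H y\<bar>" using assms(2) unfolding moderate_def by blast
  show ?thesis
  proof (rule moderateI[OF _ exp_bounded_mult[OF G(1) H(1)]])
    show "(\<lambda>y. g y * h y) \<in> borel_measurable param_measure"
      by (intro borel_measurable_times moderate_measurable assms)
    show "\<bar>g y * h y\<bar> \<le> \<bar>G y * H y\<bar>" if "y \<in> params" for y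
      unfolding abs_mult using that G H by (intro mult_mono) auto
  qed
qed

lemma moderate_add:
  assumes "moderate g" "moderate h"
  shows "moderate (\<lambda>y. g y + h y)"
proof -
  obtain G where G: "exp_bounded M G" "\<forall>y\<in>params. \<bar>g y\<bar> \<le> \<bar>G y\<bar>" using assms(1) unfolding moderate_def by blast
  obtain H where H: "exp_bounded M H" "\<forall>y\<in>params. \<bar>h y\<bar> \<le> \<bar>H y\<bar>" using assms(2) unfolding moderate_def by blast
  show ?thesis
  proof (rule moderateI[OF _ exp_bounded_add[OF exp_bounded_abs[OF G(1)] exp_bounded_abs[OF H(1)]]])
    show "(\<lambda>y. g y + h y) \<in> borel_measurable param_measure"
      by (intro borel_measurable_add moderate_measurable assms)
    show "\<bar>g y + h y\<bar> \<le> \<bar>\<bar>G y\<bar> + \<bar>H y\<bar>\<bar>" if "y \<in> params" for y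
    proof -
      have "\<bar>g y\<bar> \<le> \<bar>G y\<bar>" "\<bar>h y\<bar> \<le> \<bar>H y\<bar>" using that G H by auto
      then show ?thesis by linarith
    qed
  qed
qed

lemma moderate_sum: "(\<And>i. i \<in> I \<Longrightarrow> moderate (g i)) \<Longrightarrow> moderate (\<lambda>y. \<Sum>i\<in>I. g i y)"
  by (induction I rule: infinite_finite_induct) (auto intro: moderate_add moderate_const)

lemma moderate_cong:
  assumes "moderate g" "\<And>y. y \<in> params \<Longrightarrow> h y = g y"
  shows "moderate h"
proof -
  obtain G where G: "exp_bounded M G" "\<forall>y\<in>params. \<bar>g y\<bar> \<le> \<bar>G y\<bar>" using assms(1) unfolding moderate_def by blast
  show ?thesis
  proof (rule moderateI[OF _ G(1)])
    show "h \<in> borel_measurable param_measure"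
      using moderate_measurable[OF assms(1)] measurable_cong[of param_measure h g borel] assms(2)
      unfolding space_param_measure by blast
    show "\<bar>h y\<bar> \<le> \<bar>G y\<bar>" if "y \<in> params" for y using assms(2)[OF that] G(2) that by simp
  qed
qed

lemma moderate_hermite: "moderate (hermite_multi M \<alpha>)"
proof (rule moderateI[OF _ exp_bounded_hermite_multi[of M \<alpha>]])
  show "hermite_multi M \<alpha> \<in> borel_measurable param_measure"
    unfolding hermite_multi_def[abs_def]
  proof (rule borel_measurable_prod)
    fix k assume "k \<in> {..<M}"
    then have "(\<lambda>y. y k) \<in> borel_measurable param_measure" by (rule measurable_component_singleton)
    from measurable_compose[OF this hermite_measurable]
    show "(\<lambda>y. hermite (\<alpha> k) (y k)) \<in> borel_measurable param_measure" .
  qed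
qed simp

lemma moderate_uI:
  assumes "0 < \<sigma>" "j < n"
  shows "moderate (\<lambda>y. ip (uI \<sigma> y) (e j))"
proof (rule moderateI[OF uI_coord_measurable[OF assms]])
  show "exp_bounded M (\<lambda>y. nrm u0 * (exp (\<sigma>\<^sup>2 / 2) * exp (\<sigma> * ell M y)))"
    using assms by (intro exp_bounded_mult exp_bounded_const exp_bounded_exp) simp
  fix y assume y: "y \<in> params"
  have "\<bar>ip (uI \<sigma> y) (e j)\<bar> \<le> nrm (uI \<sigma> y)" by (rule abs_coord_le[OF uI_mem[OF assms(1) y] assms(2)])
  also have "\<dots> \<le> nrm u0 * exp (\<sigma> * ell M y + \<sigma>\<^sup>2 / 2)" by (rule uI_bound[OF assms(1) y])
  also have "\<dots> = nrm u0 * (exp (\<sigma>\<^sup>2 / 2) * exp (\<sigma> * ell M y))" by (simp add: exp_add mult.commute)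
  finally show "\<bar>ip (uI \<sigma> y) (e j)\<bar> \<le> \<bar>nrm u0 * (exp (\<sigma>\<^sup>2 / 2) * exp (\<sigma> * ell M y))\<bar>" by linarith
qed

lemma moderate_ut:
  assumes "0 < \<sigma>" "j < n"
  shows "moderate (\<lambda>y. ip (ut \<sigma> y) (e j))"
proof (rule moderate_cong)
  show "moderate (\<lambda>y. (ip (uII \<sigma> (\<lambda>_. 0)) (e j) + ip (uI \<sigma> y) (e j)) + (-1) * (\<Sum>\<alpha>\<in>J. hermite_multi M \<alpha> y * ip (uII \<sigma> \<alpha>) (e j)))"
    by (intro moderate_add moderate_mult moderate_const moderate_sum moderate_hermite moderate_uI assms)
qed (simp add: ut_coord[OF assms(1) _ e_mem[OF assms(2)]])

lemma moderate_integrable: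
  assumes g: "moderate g"
  shows "integrable P (\<lambda>\<omega>. g (gv \<omega>))"
proof -
  obtain G where G: "exp_bounded M G" "\<forall>y\<in>params. \<bar>g y\<bar> \<le> \<bar>G y\<bar>" using g unfolding moderate_def by blast
  obtain C c where C: "0 \<le> C" "\<And>y. \<bar>G y\<bar> \<le> C * exp (c * ell M y)" using G(1) unfolding exp_bounded_def by blast
  show ?thesis
  proof (rule Bochner_Integration.integrable_bound)
    show "integrable P (\<lambda>\<omega>. C * exp (c * ell M (gv \<omega>)))" by (intro integrable_mult_right integrable_exp_gv)
    show "(\<lambda>\<omega>. g (gv \<omega>)) \<in> borel_measurable P"
      by (rule measurable_compose[OF gv_measurable moderate_measurable[OF g]])
    show "AE \<omega> in P. norm (g (gv \<omega>)) \<le> norm (C * exp (c * ell M (gv \<omega>)))"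
    proof (rule AE_I2)
      fix \<omega>
      have "\<bar>g (gv \<omega>)\<bar> \<le> \<bar>G (gv \<omega>)\<bar>" using G(2) gv_params by blast
      also have "\<dots> \<le> C * exp (c * ell M (gv \<omega>))" by (rule C)
      finally show "norm (g (gv \<omega>)) \<le> norm (C * exp (c * ell M (gv \<omega>)))" by simp
    qed
  qed
qed

text \<open>Only the law of \<open>X\<close> enters, so integrability and means carry over from the
  Gaussian vector through \<open>distr\<close>.\<close>

lemma moderate_sample:
  assumes g: "moderate g" and X: "X \<in> P \<rightarrow>\<^sub>M param_measure" "distr P param_measure X = distr P param_measure gv"
  shows "integrable P (\<lambda>\<omega>. g (X \<omega>))" "(\<integral>\<omega>. g (X \<omega>) \<partial>P) = (\<integral>\<omega>. g (gv \<omega>) \<partial>P)"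
proof -
  note m = moderate_measurable[OF g]
  have "integrable (distr P param_measure gv) g"
    using moderate_integrable[OF g] by (subst integrable_distr_eq[OF gv_measurable m])
  then show "integrable P (\<lambda>\<omega>. g (X \<omega>))"
    unfolding X(2)[symmetric] by (subst (asm) integrable_distr_eq[OF X(1) m])
  show "(\<integral>\<omega>. g (X \<omega>) \<partial>P) = (\<integral>\<omega>. g (gv \<omega>) \<partial>P)"
    using integral_distr[OF X(1) m] integral_distr[OF gv_measurable m] X(2) by simp
qed

text \<open>Independence factors the mean over the coordinates, and a coordinate of positive degree
  contributes the factor zero.\<close>

lemma expectation_hermite:
  assumes "\<alpha> \<in> J" "\<alpha> \<noteq> (\<lambda>_. 0)"
  shows "(\<integral>\<omega>. hermite_multi M \<alpha> (gv \<omega>) \<partial>P) = 0"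
proof -
  obtain k where k: "k < M" "\<alpha> k \<noteq> 0"
    using J_eqI[OF assms(1) zero_J] assms(2) by blast
  have "(\<integral>\<omega>. hermite_multi M \<alpha> (gv \<omega>) \<partial>P) = (\<integral>\<omega>. (\<Prod>k<M. hermite (\<alpha> k) (\<xi> k \<omega>)) \<partial>P)"
    by (simp add: hermite_multi_def gaussian_vector_def)
  also have "\<dots> = (\<Prod>k<M. \<integral>\<omega>. hermite (\<alpha> k) (\<xi> k \<omega>) \<partial>P)"
    by (rule indep_vars_lebesgue_integral[OF finite_lessThan xi_indep_compose])
      (auto intro!: integrable_xi integrable_std_normal_hermite)
  also have "\<dots> = 0"
  proof (rule prod_zero[OF finite_lessThan], rule bexI)
    obtain l where l: "\<alpha> k = Suc l" using k(2) not0_implies_Suc by blast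
    have "(\<integral>\<omega>. hermite (Suc l) (\<xi> k \<omega>) \<partial>P) = (\<integral>x. std_normal_density x * hermite (Suc l) x \<partial>lborel)"
      by (rule distributed_integral[OF xi_normal, symmetric]) auto
    then show "(\<integral>\<omega>. hermite (\<alpha> k) (\<xi> k \<omega>) \<partial>P) = 0" unfolding l by (simp only: integral_std_normal_hermite)
    show "k \<in> {..<M}" using k by simp
  qed
  finally show ?thesis .
qed

lemma expectation_ut:
  assumes "0 < \<sigma>" "j < n"
  shows "(\<integral>\<omega>. ip (ut \<sigma> (gv \<omega>)) (e j) \<partial>P) = (\<integral>\<omega>. ip (uI \<sigma> (gv \<omega>)) (e j) \<partial>P)"
proof -
  let ?h = "\<lambda>\<alpha>. ip (uII \<sigma> \<alpha>) (e j)"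
  have "(\<Sum>\<alpha>\<in>J. (\<integral>\<omega>. hermite_multi M \<alpha> (gv \<omega>) \<partial>P) * ?h \<alpha>) = (\<Sum>\<alpha>\<in>J. if \<alpha> = (\<lambda>_. 0) then ?h (\<lambda>_. 0) else 0)"
    by (intro sum.cong refl) (auto simp: expectation_hermite hermite_multi_0 prob_space)
  also have "\<dots> = ?h (\<lambda>_. 0)" using finite_J zero_J by simp
  finally have H: "(\<Sum>\<alpha>\<in>J. (\<integral>\<omega>. hermite_multi M \<alpha> (gv \<omega>) \<partial>P) * ?h \<alpha>) = ?h (\<lambda>_. 0)" .
  have "(\<integral>\<omega>. ip (ut \<sigma> (gv \<omega>)) (e j) \<partial>P)
    = (\<integral>\<omega>. (?h (\<lambda>_. 0) + ip (uI \<sigma> (gv \<omega>)) (e j)) - (\<Sum>\<alpha>\<in>J. hermite_multi M \<alpha> (gv \<omega>) * ?h \<alpha>) \<partial>P)"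
    by (simp only: ut_coord[OF assms(1) gv_params e_mem[OF assms(2)]])
  also have "\<dots> = (\<integral>\<omega>. ?h (\<lambda>_. 0) + ip (uI \<sigma> (gv \<omega>)) (e j) \<partial>P) - (\<integral>\<omega>. (\<Sum>\<alpha>\<in>J. hermite_multi M \<alpha> (gv \<omega>) * ?h \<alpha>) \<partial>P)"
    by (intro Bochner_Integration.integral_diff Bochner_Integration.integrable_add Bochner_Integration.integrable_sum
        integrable_mult_left moderate_integrable moderate_hermite moderate_uI integrable_const assms)
  also have "(\<integral>\<omega>. ?h (\<lambda>_. 0) + ip (uI \<sigma> (gv \<omega>)) (e j) \<partial>P) = ?h (\<lambda>_. 0) + (\<integral>\<omega>. ip (uI \<sigma> (gv \<omega>)) (e j) \<partial>P)"
    by (subst Bochner_Integration.integral_add) (auto intro!: moderate_integrable moderate_uI assms simp: prob_space)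
  also have "(\<integral>\<omega>. (\<Sum>\<alpha>\<in>J. hermite_multi M \<alpha> (gv \<omega>) * ?h \<alpha>) \<partial>P) = (\<Sum>\<alpha>\<in>J. (\<integral>\<omega>. hermite_multi M \<alpha> (gv \<omega>) \<partial>P) * ?h \<alpha>)"
    by (subst Bochner_Integration.integral_sum) (auto intro!: integrable_mult_left moderate_integrable moderate_hermite)
  finally show ?thesis unfolding H by simp
qed

definition cmean :: "real \<Rightarrow> nat \<Rightarrow> real" where
  "cmean \<sigma> j = (\<integral>\<omega>. ip (ut \<sigma> (gv \<omega>)) (e j) \<partial>P)"

definition cvar :: "real \<Rightarrow> nat \<Rightarrow> real" where
  "cvar \<sigma> j = (\<integral>\<omega>. (ip (ut \<sigma> (gv \<omega>)) (e j) - cmean \<sigma> j)\<^sup>2 \<partial>P)"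

text \<open>The basis expansion is finite and holds at each point, so the pointwise expectation acts
  on the coordinates; by \<open>expectation_ut\<close> these have the same means for
  \<open>uI\<close> as for \<open>u_tilde\<close>.\<close>

lemma mean_field_expand:
  assumes "0 < \<sigma>"
  shows "integrable P (\<lambda>\<omega>. uI \<sigma> (gv \<omega>) x)" "mean_field P M \<xi> (uI \<sigma>) x = (\<Sum>j<n. cmean \<sigma> j * e j x)"
proof -
  have eq: "uI \<sigma> (gv \<omega>) x = (\<Sum>j<n. ip (uI \<sigma> (gv \<omega>)) (e j) * e j x)" for \<omega>
    by (rule e_expand[OF uI_mem[OF assms gv_params]])
  have i: "integrable P (\<lambda>\<omega>. ip (uI \<sigma> (gv \<omega>)) (e j) * e j x)" if "j < n" for j
    by (intro integrable_mult_left moderate_integrable moderate_uI assms that)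
  show "integrable P (\<lambda>\<omega>. uI \<sigma> (gv \<omega>) x)"
    unfolding eq by (intro Bochner_Integration.integrable_sum i) simp
  have "mean_field P M \<xi> (uI \<sigma>) x = (\<integral>\<omega>. (\<Sum>j<n. ip (uI \<sigma> (gv \<omega>)) (e j) * e j x) \<partial>P)"
    unfolding mean_field_def using eq by simp
  also have "\<dots> = (\<Sum>j<n. \<integral>\<omega>. ip (uI \<sigma> (gv \<omega>)) (e j) * e j x \<partial>P)"
    by (rule Bochner_Integration.integral_sum) (rule i, simp)
  also have "\<dots> = (\<Sum>j<n. cmean \<sigma> j * e j x)"
    by (intro sum.cong refl) (simp add: cmean_def expectation_ut assms)
  finally show "mean_field P M \<xi> (uI \<sigma>) x = (\<Sum>j<n. cmean \<sigma> j * e j x)" .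
qed

lemma moderate_ut_centered:
  assumes "0 < \<sigma>" "j < n"
  shows "moderate (\<lambda>y. ip (ut \<sigma> y) (e j) - c)"
  using moderate_add[OF moderate_ut[OF assms] moderate_const[of "- c"]] by simp

text \<open>The mean minimises the mean square deviation, so the variance is at most the mean square
  distance from the deterministic \<open>u0\<close>.\<close>

lemma cvar_bound:
  assumes "1 \<le> p"
  shows "\<exists>B\<ge>0. \<forall>\<sigma>. 0 < \<sigma> \<and> \<sigma> \<le> 1 \<longrightarrow> (\<Sum>j<n. cvar \<sigma> j) \<le> B * \<sigma> ^ 4"
proof -
  obtain G where G: "exp_bounded M G"
    "\<And>\<sigma> y. 0 < \<sigma> \<Longrightarrow> \<sigma> \<le> 1 \<Longrightarrow> y \<in> params \<Longrightarrow> nrm (\<lambda>x. 1 * ut \<sigma> y x + (-1) * u0 x) \<le> \<sigma>\<^sup>2 * G y"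
    using ut_deviation[OF assms] by blast
  obtain C c where C: "0 \<le> C" "\<And>y. \<bar>G y\<bar> \<le> C * exp (c * ell M y)" using G(1) unfolding exp_bounded_def by blast
  \<comment> \<open>The second moment of the growth bound. It is fixed before \<sigma>, which makes
    the final constant uniform.\<close>
  define B where "B = (\<integral>\<omega>. C\<^sup>2 * exp ((2 * c) * ell M (gv \<omega>)) \<partial>P)"
  have B: "B \<ge> 0" unfolding B_def by (intro integral_nonneg_AE AE_I2) simp
  have "(\<Sum>j<n. cvar \<sigma> j) \<le> B * \<sigma> ^ 4" if \<sigma>: "0 < \<sigma>" "\<sigma> \<le> 1" for \<sigma>
  proof -
    let ?t = "\<lambda>j \<omega>. ip (ut \<sigma> (gv \<omega>)) (e j)" and ?z = "\<lambda>j. ip u0 (e j)"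
    have sqi: "integrable P (\<lambda>\<omega>. (?t j \<omega> - a)\<^sup>2)" if "j < n" for j a
      using moderate_integrable[OF moderate_mult[OF moderate_ut_centered[OF \<sigma>(1) that, of a] moderate_ut_centered[OF \<sigma>(1) that, of a]]]
      by (simp add: power2_eq_square)
    have le: "cvar \<sigma> j \<le> (\<integral>\<omega>. (?t j \<omega> - ?z j)\<^sup>2 \<partial>P)" if j: "j < n" for j
    proof -
      let ?m = "cmean \<sigma> j"
      have it: "integrable P (\<lambda>\<omega>. ?t j \<omega> - ?m)" by (rule moderate_integrable[OF moderate_ut_centered[OF \<sigma>(1) j]])
      have "(\<integral>\<omega>. ?t j \<omega> - ?m \<partial>P) = (\<integral>\<omega>. ?t j \<omega> \<partial>P) - (\<integral>\<omega>. ?m \<partial>P)"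
        by (intro Bochner_Integration.integral_diff moderate_integrable moderate_ut \<sigma> j integrable_const)
      then have z: "(\<integral>\<omega>. ?t j \<omega> - ?m \<partial>P) = 0" by (simp add: cmean_def prob_space)
      \<comment> \<open>Expansion about the mean \<open>?m\<close>; the mixed term vanishes because
        \<open>?t j \<omega> - ?m\<close> has mean zero.\<close>
      have "(\<integral>\<omega>. (?t j \<omega> - ?z j)\<^sup>2 \<partial>P) = (\<integral>\<omega>. (?t j \<omega> - ?m)\<^sup>2 + (2 * (?m - ?z j) * (?t j \<omega> - ?m) + (?m - ?z j)\<^sup>2) \<partial>P)"
        by (intro Bochner_Integration.integral_cong refl) (simp add: power2_eq_square algebra_simps)
      also have "\<dots> = cvar \<sigma> j + (\<integral>\<omega>. 2 * (?m - ?z j) * (?t j \<omega> - ?m) + (?m - ?z j)\<^sup>2 \<partial>P)"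
        unfolding cvar_def
        by (intro Bochner_Integration.integral_add sqi j Bochner_Integration.integrable_add integrable_mult_right it integrable_const)
      also have "(\<integral>\<omega>. 2 * (?m - ?z j) * (?t j \<omega> - ?m) + (?m - ?z j)\<^sup>2 \<partial>P)
          = (\<integral>\<omega>. 2 * (?m - ?z j) * (?t j \<omega> - ?m) \<partial>P) + (\<integral>\<omega>. (?m - ?z j)\<^sup>2 \<partial>P)"
        by (intro Bochner_Integration.integral_add integrable_mult_right it integrable_const)
      also have "(\<integral>\<omega>. 2 * (?m - ?z j) * (?t j \<omega> - ?m) \<partial>P) = 2 * (?m - ?z j) * (\<integral>\<omega>. ?t j \<omega> - ?m \<partial>P)"
        by (rule integral_mult_right_zero)
      also have "(\<integral>\<omega>. (?m - ?z j)\<^sup>2 \<partial>P) = (?m - ?z j)\<^sup>2" by (simp add: prob_space)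
      finally show ?thesis unfolding z using zero_le_power2[of "?m - ?z j"] by simp
    qed
    have "(\<Sum>j<n. cvar \<sigma> j) \<le> (\<Sum>j<n. \<integral>\<omega>. (?t j \<omega> - ?z j)\<^sup>2 \<partial>P)"
      by (intro sum_mono le) simp
    also have "\<dots> = (\<integral>\<omega>. (\<Sum>j<n. (?t j \<omega> - ?z j)\<^sup>2) \<partial>P)"
      by (rule Bochner_Integration.integral_sum[symmetric]) (rule sqi, simp)
    also have "\<dots> \<le> (\<integral>\<omega>. \<sigma> ^ 4 * (C\<^sup>2 * exp ((2 * c) * ell M (gv \<omega>))) \<partial>P)"
    proof (rule integral_mono)
      show "integrable P (\<lambda>\<omega>. \<Sum>j<n. (?t j \<omega> - ?z j)\<^sup>2)" by (intro Bochner_Integration.integrable_sum sqi) simp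
      show "integrable P (\<lambda>\<omega>. \<sigma> ^ 4 * (C\<^sup>2 * exp ((2 * c) * ell M (gv \<omega>))))"
        by (intro integrable_mult_right integrable_exp_gv)
      fix \<omega>
      let ?w = "\<lambda>x. 1 * ut \<sigma> (gv \<omega>) x + (-1) * u0 x"
      have w: "?w \<in> V" by (intro fe_lincomb ut_mem u0_mem \<sigma> gv_params)
      \<comment> \<open>By Parseval the coordinate deviations add up to the squared gradient norm of
        the distance to \<open>u0\<close>, where the bound \<open>G\<close> applies for each
        \<omega>.\<close>
      have "(\<Sum>j<n. (?t j \<omega> - ?z j)\<^sup>2) = (\<Sum>j<n. ip ?w (e j) * ip ?w (e j))"
        by (intro sum.cong refl)
          (simp only: ip_diff_left[OF ut_mem[OF \<sigma>(1) gv_params] u0_mem e_mem] lessThan_iff power2_eq_square)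
      also have "\<dots> = (nrm ?w)\<^sup>2" unfolding nrm_square by (rule parseval[OF w w, symmetric])
      also have "\<dots> \<le> (\<sigma>\<^sup>2 * (C * exp (c * ell M (gv \<omega>))))\<^sup>2"
      proof (rule power_mono[OF _ nrm_nonneg])
        have "nrm ?w \<le> \<sigma>\<^sup>2 * G (gv \<omega>)" by (rule G(2)[OF \<sigma> gv_params])
        also have "\<dots> \<le> \<sigma>\<^sup>2 * (C * exp (c * ell M (gv \<omega>)))"
          using C(2)[of "gv \<omega>"] by (intro mult_left_mono) auto
        finally show "nrm ?w \<le> \<sigma>\<^sup>2 * (C * exp (c * ell M (gv \<omega>)))" .
      qed
      also have "\<dots> = \<sigma> ^ 4 * (C\<^sup>2 * exp ((2 * c) * ell M (gv \<omega>)))"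
        by (simp add: power_mult_distrib exp_double[symmetric] mult.assoc flip: power_mult)
      finally show "(\<Sum>j<n. (?t j \<omega> - ?z j)\<^sup>2) \<le> \<sigma> ^ 4 * (C\<^sup>2 * exp ((2 * c) * ell M (gv \<omega>)))" .
    qed
    also have "\<dots> = B * \<sigma> ^ 4" unfolding B_def by (simp add: mult.commute)
    finally show ?thesis .
  qed
  with B show ?thesis by blast
qed

end

section \<open>The Monte Carlo estimator\<close>

lemma integrable_mult_of_squares:
  fixes a b :: "'b \<Rightarrow> real"
  assumes "a \<in> borel_measurable Q" "b \<in> borel_measurable Q"
    "integrable Q (\<lambda>\<omega>. a \<omega> * a \<omega>)" "integrable Q (\<lambda>\<omega>. b \<omega> * b \<omega>)"
  shows "integrable Q (\<lambda>\<omega>. a \<omega> * b \<omega>)"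
proof (rule Bochner_Integration.integrable_bound)
  show "integrable Q (\<lambda>\<omega>. a \<omega> * a \<omega> + b \<omega> * b \<omega>)" by (intro Bochner_Integration.integrable_add assms)
  show "(\<lambda>\<omega>. a \<omega> * b \<omega>) \<in> borel_measurable Q" by (intro borel_measurable_times assms)
  have "\<bar>x * y\<bar> \<le> x * x + y * y" for x y :: real
  proof -
    have "2 * \<bar>x * y\<bar> \<le> x * x + y * y"
      using zero_le_power2[of "\<bar>x\<bar> - \<bar>y\<bar>"] by (simp add: power2_eq_square algebra_simps abs_mult)
    then show ?thesis by linarith
  qed
  then show "AE \<omega> in Q. norm (a \<omega> * b \<omega>) \<le> norm (a \<omega> * a \<omega> + b \<omega> * b \<omega>)"
    by (intro AE_I2) (auto intro: order_trans)
qed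

lemma square_sum_eq: "(\<Sum>j<n. a j * b j)\<^sup>2 = (\<Sum>i<n. \<Sum>j<n. (a i * a j) * (b i * b j))" for a b :: "nat \<Rightarrow> real"
  by (simp add: power2_eq_square sum_product mult.assoc mult.left_commute)

section \<open>Coordinates of the estimation error\<close>

locale sampled_problem = random_problem D \<T> q n e f lam \<phi> M p uI uII P \<xi>
  for D :: "'a::euclidean_space set" and \<T> q n e f lam \<phi> M p uI uII and P :: "'w measure" and \<xi> +
  fixes \<sigma> :: real and N :: nat and X :: "nat \<Rightarrow> 'w \<Rightarrow> nat \<Rightarrow> real"
  assumes sigma_pos: "0 < \<sigma>" and N_pos: "1 \<le> N"
    and samples: "independent_samples P M \<xi> N X"
begin

abbreviation est :: "'w \<Rightarrow> 'a \<Rightarrow> real" where "est \<equiv> E_IS M p N X (uI \<sigma>) (uII \<sigma>)"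

abbreviation err :: "'w \<Rightarrow> 'a \<Rightarrow> real" where "err \<equiv> (\<lambda>\<omega> x. est \<omega> x - mean_field P M \<xi> (uI \<sigma>) x)"

definition centered_coord :: "nat \<Rightarrow> (nat \<Rightarrow> real) \<Rightarrow> real" where
  "centered_coord j y = ip (ut \<sigma> y) (e j) - cmean \<sigma> j"

text \<open>The coordinates of \<open>err \<omega>\<close>, as \<open>err_expand\<close> shows; they
  have mean zero, so \<open>cov\<close> below is their covariance matrix.\<close>

definition dev :: "nat \<Rightarrow> 'w \<Rightarrow> real" where
  "dev j \<omega> = (\<Sum>i<N. centered_coord j (X i \<omega>)) / real N"

definition cov :: "nat \<Rightarrow> nat \<Rightarrow> real" where
  "cov i j = (\<integral>\<omega>. dev i \<omega> * dev j \<omega> \<partial>P)"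

lemma X_indep: "indep_vars (\<lambda>_. param_measure) X {..<N}"
  and X_distr: "i < N \<Longrightarrow> distr P param_measure (X i) = distr P param_measure gv"
  using samples by (auto simp: independent_samples_def)

lemma X_measurable: "i < N \<Longrightarrow> X i \<in> P \<rightarrow>\<^sub>M param_measure"
  using X_indep by (auto simp: indep_vars_def)

lemma X_params: "i < N \<Longrightarrow> \<omega> \<in> space P \<Longrightarrow> X i \<omega> \<in> params"
  using measurable_space[OF X_measurable] by (simp add: space_PiM)

lemma centered_coord_moderate: "j < n \<Longrightarrow> moderate (centered_coord j)"
  unfolding centered_coord_def[abs_def] by (rule moderate_ut_centered[OF sigma_pos])

lemma centered_coord_gv_mean: 
  assumes "j < n"
  shows "(\<integral>\<omega>. centered_coord j (gv \<omega>) \<partial>P) = 0"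
proof -
  have "(\<integral>\<omega>. centered_coord j (gv \<omega>) \<partial>P) = (\<integral>\<omega>. ip (ut \<sigma> (gv \<omega>)) (e j) \<partial>P) - (\<integral>\<omega>. cmean \<sigma> j \<partial>P)"
    unfolding centered_coord_def
    by (intro Bochner_Integration.integral_diff moderate_integrable moderate_ut sigma_pos assms integrable_const)
  then show ?thesis by (simp add: cmean_def prob_space)
qed

lemma centered_coord_X:
  assumes "i < N" "j < n"
  shows "(\<lambda>\<omega>. centered_coord j (X i \<omega>)) \<in> borel_measurable P" "integrable P (\<lambda>\<omega>. centered_coord j (X i \<omega>))" "(\<integral>\<omega>. centered_coord j (X i \<omega>) \<partial>P) = 0"
    "integrable P (\<lambda>\<omega>. centered_coord j (X i \<omega>) * centered_coord j (X i \<omega>))" "(\<integral>\<omega>. centered_coord j (X i \<omega>) * centered_coord j (X i \<omega>) \<partial>P) = cvar \<sigma> j"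
proof -
  note m = moderate_sample[OF centered_coord_moderate[OF assms(2)] X_measurable[OF assms(1)] X_distr[OF assms(1)]]
  note m2 = moderate_sample[OF moderate_mult[OF centered_coord_moderate[OF assms(2)] centered_coord_moderate[OF assms(2)]] X_measurable[OF assms(1)] X_distr[OF assms(1)]]
  show "integrable P (\<lambda>\<omega>. centered_coord j (X i \<omega>))" by (rule m)
  then show "(\<lambda>\<omega>. centered_coord j (X i \<omega>)) \<in> borel_measurable P" by (rule borel_measurable_integrable)
  show "(\<integral>\<omega>. centered_coord j (X i \<omega>) \<partial>P) = 0" using m(2) centered_coord_gv_mean[OF assms(2)] by simp
  show "integrable P (\<lambda>\<omega>. centered_coord j (X i \<omega>) * centered_coord j (X i \<omega>))" by (rule m2)
  show "(\<integral>\<omega>. centered_coord j (X i \<omega>) * centered_coord j (X i \<omega>) \<partial>P) = cvar \<sigma> j"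
    using m2(2) by (simp add: cvar_def centered_coord_def power2_eq_square)
qed

lemma centered_coord_X_uncorrelated:
  assumes "i < N" "l < N" "i \<noteq> l" "j < n"
  shows "(\<integral>\<omega>. centered_coord j (X i \<omega>) * centered_coord j (X l \<omega>) \<partial>P) = 0"
proof -
  have "indep_vars (\<lambda>_. borel) (\<lambda>k \<omega>. centered_coord j (X k \<omega>)) {i, l}"
    by (rule indep_vars_compose2[OF indep_vars_subset[OF X_indep]])
      (use assms moderate_measurable[OF centered_coord_moderate[OF assms(4)]] in auto)
  then have "(\<integral>\<omega>. (\<Prod>k\<in>{i, l}. centered_coord j (X k \<omega>)) \<partial>P) = (\<Prod>k\<in>{i, l}. \<integral>\<omega>. centered_coord j (X k \<omega>) \<partial>P)"
    by (rule indep_vars_lebesgue_integral[rotated]) (auto intro!: centered_coord_X(2) assms)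
  then show ?thesis using assms(3) centered_coord_X(3)[OF assms(1,4)] by simp
qed

lemma centered_coord_X_mult_integrable:
  assumes "i < N" "l < N" "j < n" "k < n"
  shows "integrable P (\<lambda>\<omega>. centered_coord j (X i \<omega>) * centered_coord k (X l \<omega>))"
  by (rule integrable_mult_of_squares) (rule centered_coord_X assms)+

lemma dev_measurable: "j < n \<Longrightarrow> dev j \<in> borel_measurable P"
  unfolding dev_def[abs_def] by (intro borel_measurable_divide borel_measurable_sum borel_measurable_const centered_coord_X) auto

lemma dev_integrable: "j < n \<Longrightarrow> integrable P (dev j)"
  unfolding dev_def[abs_def] by (intro integrable_divide Bochner_Integration.integrable_sum centered_coord_X) auto

lemma dev_mean: "j < n \<Longrightarrow> (\<integral>\<omega>. dev j \<omega> \<partial>P) = 0"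
proof -
  assume j: "j < n"
  have "(\<integral>\<omega>. (\<Sum>i<N. centered_coord j (X i \<omega>)) \<partial>P) = (\<Sum>i<N. \<integral>\<omega>. centered_coord j (X i \<omega>) \<partial>P)"
    by (intro Bochner_Integration.integral_sum centered_coord_X j) simp
  also have "\<dots> = 0" by (intro sum.neutral ballI centered_coord_X(3) j) simp
  finally show ?thesis unfolding dev_def by simp
qed

lemma dev_mult: "dev i \<omega> * dev j \<omega> = (\<Sum>a<N. \<Sum>b<N. centered_coord i (X a \<omega>) * centered_coord j (X b \<omega>)) / (real N)\<^sup>2"
  unfolding dev_def sum_product[symmetric] by (simp add: power2_eq_square)

lemma dev_mult_integrable: "i < n \<Longrightarrow> j < n \<Longrightarrow> integrable P (\<lambda>\<omega>. dev i \<omega> * dev j \<omega>)"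
  unfolding dev_mult
  by (intro integrable_divide Bochner_Integration.integrable_sum centered_coord_X_mult_integrable) auto

text \<open>Of the \<open>N\<^sup>2\<close> products of samples the mixed ones have mean zero by
  independence. The \<open>N\<close> diagonal ones remain, while averaging divides by
  \<open>N\<^sup>2\<close>.\<close>

lemma cov_diag:
  assumes "j < n"
  shows "cov j j = cvar \<sigma> j / real N"
proof -
  have "(\<integral>\<omega>. (\<Sum>a<N. \<Sum>b<N. centered_coord j (X a \<omega>) * centered_coord j (X b \<omega>)) \<partial>P) = (\<Sum>a<N. \<integral>\<omega>. (\<Sum>b<N. centered_coord j (X a \<omega>) * centered_coord j (X b \<omega>)) \<partial>P)"
    by (intro Bochner_Integration.integral_sum Bochner_Integration.integrable_sum centered_coord_X_mult_integrable assms) auto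
  also have "\<dots> = (\<Sum>a<N. \<Sum>b<N. \<integral>\<omega>. centered_coord j (X a \<omega>) * centered_coord j (X b \<omega>) \<partial>P)"
    by (intro sum.cong refl Bochner_Integration.integral_sum centered_coord_X_mult_integrable assms) auto
  also have "\<dots> = (\<Sum>a<N. \<Sum>b<N. if b = a then cvar \<sigma> j else 0)"
    using centered_coord_X(5) centered_coord_X_uncorrelated assms by (intro sum.cong refl) auto
  also have "\<dots> = (\<Sum>a<N. cvar \<sigma> j)"
    by (intro sum.cong refl) simp
  finally have "(\<integral>\<omega>. (\<Sum>a<N. \<Sum>b<N. centered_coord j (X a \<omega>) * centered_coord j (X b \<omega>)) \<partial>P) = real N * cvar \<sigma> j" by simp
  then show ?thesis using N_pos by (simp add: cov_def dev_mult power2_eq_square)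
qed

text \<open>By unbiasedness the mean field of model I has the coordinates
  \<open>cmean \<sigma> j\<close>, so subtracting it leaves averages of centered
  coordinates.\<close>

lemma err_expand:
  assumes "\<omega> \<in> space P"
  shows "err \<omega> = (\<lambda>x. \<Sum>j<n. dev j \<omega> * e j x)"
proof
  fix x
  have ut: "ut \<sigma> (X i \<omega>) x = (\<Sum>j<n. centered_coord j (X i \<omega>) * e j x) + (\<Sum>j<n. cmean \<sigma> j * e j x)" if "i < N" for i
  proof -
    have "ut \<sigma> (X i \<omega>) x = (\<Sum>j<n. ip (ut \<sigma> (X i \<omega>)) (e j) * e j x)"
      by (rule e_expand[OF ut_mem[OF sigma_pos X_params[OF that assms]]])
    then show ?thesis by (simp add: centered_coord_def left_diff_distrib sum_subtractf)
  qed
  have "est \<omega> x = (\<Sum>i<N. (\<Sum>j<n. centered_coord j (X i \<omega>) * e j x) + (\<Sum>j<n. cmean \<sigma> j * e j x)) / real N"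
    unfolding E_IS_def by (intro arg_cong2[where f="(/)"] sum.cong refl ut) simp
  also have "\<dots> = (\<Sum>i<N. \<Sum>j<n. centered_coord j (X i \<omega>) * e j x) / real N + (\<Sum>j<n. cmean \<sigma> j * e j x)"
    using N_pos by (simp add: sum.distrib add_divide_distrib)
  also have "(\<Sum>i<N. \<Sum>j<n. centered_coord j (X i \<omega>) * e j x) / real N = (\<Sum>j<n. dev j \<omega> * e j x)"
    by (subst sum.swap) (simp add: dev_def sum_divide_distrib sum_distrib_right)
  finally show "err \<omega> x = (\<Sum>j<n. dev j \<omega> * e j x)"
    unfolding mean_field_expand(2)[OF sigma_pos] by simp
qed

lemma err_mem: "\<omega> \<in> space P \<Longrightarrow> err \<omega> \<in> V"
  unfolding err_expand by (rule e_sum_mem)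

lemma mean_field_mem: "mean_field P M \<xi> (uI \<sigma>) \<in> V"
proof -
  have "mean_field P M \<xi> (uI \<sigma>) = (\<lambda>x. \<Sum>j<n. cmean \<sigma> j * e j x)"
    using mean_field_expand(2)[OF sigma_pos] by (rule ext)
  then show ?thesis using e_sum_mem by simp
qed

lemma est_mem: 
  assumes "\<omega> \<in> space P"
  shows "est \<omega> \<in> V"
proof -
  have "est \<omega> = (\<lambda>x. 1 * err \<omega> x + 1 * mean_field P M \<xi> (uI \<sigma>) x)" by auto
  then show ?thesis using fe_lincomb[OF err_mem[OF assms] mean_field_mem, of 1 1] by simp
qed

lemma ip_err_err: "\<omega> \<in> space P \<Longrightarrow> ip (err \<omega>) (err \<omega>) = (\<Sum>j<n. dev j \<omega> * dev j \<omega>)"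
proof -
  assume \<omega>: "\<omega> \<in> space P"
  have "ip (err \<omega>) (err \<omega>) = (\<Sum>j<n. ip (err \<omega>) (e j) * ip (err \<omega>) (e j))"
    by (rule parseval[OF err_mem[OF \<omega>] err_mem[OF \<omega>]])
  also have "\<dots> = (\<Sum>j<n. dev j \<omega> * dev j \<omega>)"
    unfolding err_expand[OF \<omega>] by (intro sum.cong refl) (simp only: ip_e lessThan_iff)
  finally show ?thesis .
qed

lemma H10_norm_err: "\<omega> \<in> space P \<Longrightarrow> (H10_norm D (err \<omega>))\<^sup>2 = (\<Sum>j<n. dev j \<omega> * dev j \<omega>)"
  unfolding H10_norm_square[OF err_mem] by (rule ip_err_err)

lemma H10_norm_err_integrable: "integrable P (\<lambda>\<omega>. (H10_norm D (err \<omega>))\<^sup>2)"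
proof -
  have "integrable P (\<lambda>\<omega>. \<Sum>j<n. dev j \<omega> * dev j \<omega>)"
    by (intro Bochner_Integration.integrable_sum dev_mult_integrable) auto
  then show ?thesis
    by (rule Bochner_Integration.integrable_cong[OF refl, THEN iffD2, rotated]) (rule H10_norm_err)
qed

lemma L2_H10_norm_err: "(L2_H10_norm P D err)\<^sup>2 = (\<Sum>j<n. cov j j)"
proof -
  have "(\<integral>\<omega>. (H10_norm D (err \<omega>))\<^sup>2 \<partial>P) = (\<integral>\<omega>. (\<Sum>j<n. dev j \<omega> * dev j \<omega>) \<partial>P)"
    by (intro Bochner_Integration.integral_cong refl H10_norm_err)
  also have "\<dots> = (\<Sum>j<n. cov j j)"
    unfolding cov_def by (intro Bochner_Integration.integral_sum dev_mult_integrable) auto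
  finally have eq: "(\<integral>\<omega>. (H10_norm D (err \<omega>))\<^sup>2 \<partial>P) = (\<Sum>j<n. cov j j)" .
  have "0 \<le> (\<integral>\<omega>. (H10_norm D (err \<omega>))\<^sup>2 \<partial>P)" by (intro integral_nonneg_AE AE_I2) simp
  then show ?thesis unfolding L2_H10_norm_def eq by simp
qed

text \<open>Off the skeleton the gradient of the error is a finite combination of the basis
  gradients with coefficients \<open>dev j \<omega>\<close>. Its pairing with a fixed
  \<open>v\<close> is therefore linear in the measurable \<open>dev j\<close>.\<close>

lemma err_L2_H10: "err \<in> L2_H10 P D"
  unfolding L2_H10_def
proof (intro CollectI conjI ballI)
  show "err \<omega> \<in> H10 D" if "\<omega> \<in> space P" for \<omega> by (rule fe_H10[OF err_mem[OF that]])
  show "integrable P (\<lambda>\<omega>. (H10_norm D (err \<omega>))\<^sup>2)" by (rule H10_norm_err_integrable)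
  fix v assume v: "v \<in> H10 D"
  let ?g = "weak_grad D v"
  have i: "integrable (lebesgue_on D) (\<lambda>x. classical_grad (e j) x \<bullet> ?g x)" if "j < n" for j
    by (rule square_integrable_on_inner[OF fe_sq(2)[OF e_mem[OF that]] weak_grad_square_integrable[OF v]])
  have "(\<integral>x. weak_grad D (err \<omega>) x \<bullet> ?g x \<partial>lebesgue_on D)
      = (\<Sum>j<n. dev j \<omega> * (\<integral>x. classical_grad (e j) x \<bullet> ?g x \<partial>lebesgue_on D))" if \<omega>: "\<omega> \<in> space P" for \<omega>
  proof -
    have ii: "integrable (lebesgue_on D) (\<lambda>x. dev j \<omega> * (classical_grad (e j) x \<bullet> ?g x))" if "j < n" for j
      using i[OF that] by (rule integrable_mult_right)
    have "(\<integral>x. weak_grad D (err \<omega>) x \<bullet> ?g x \<partial>lebesgue_on D)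
      = (\<integral>x. (\<Sum>j<n. dev j \<omega> * (classical_grad (e j) x \<bullet> ?g x)) \<partial>lebesgue_on D)"
    proof (rule integral_cong_AE)
      show "(\<lambda>x. weak_grad D (err \<omega>) x \<bullet> ?g x) \<in> borel_measurable (lebesgue_on D)"
        unfolding fe_weak_grad[OF err_mem[OF \<omega>]]
        by (rule borel_measurable_integrable[OF square_integrable_on_inner[OF fe_sq(2)[OF err_mem[OF \<omega>]] weak_grad_square_integrable[OF v]]])
      show "(\<lambda>x. \<Sum>j<n. dev j \<omega> * (classical_grad (e j) x \<bullet> ?g x)) \<in> borel_measurable (lebesgue_on D)"
        by (intro borel_measurable_sum borel_measurable_integrable ii) simp
      show "AE x in lebesgue_on D. weak_grad D (err \<omega>) x \<bullet> ?g x = (\<Sum>j<n. dev j \<omega> * (classical_grad (e j) x \<bullet> ?g x))"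
      proof (rule AE_off_skeleton)
        fix x assume x: "x \<in> D - skeleton"
        have "weak_grad D (err \<omega>) x = (\<Sum>j<n. dev j \<omega> *\<^sub>R classical_grad (e j) x)"
          unfolding fe_weak_grad[OF err_mem[OF \<omega>]] unfolding err_expand[OF \<omega>]
          by (rule fe_grad_sum[OF _ x]) (rule e_mem, simp)
        then show "weak_grad D (err \<omega>) x \<bullet> ?g x = (\<Sum>j<n. dev j \<omega> * (classical_grad (e j) x \<bullet> ?g x))"
          by (simp add: inner_sum_left)
      qed
    qed
    also have "\<dots> = (\<Sum>j<n. \<integral>x. dev j \<omega> * (classical_grad (e j) x \<bullet> ?g x) \<partial>lebesgue_on D)"
      by (rule Bochner_Integration.integral_sum) (rule ii, simp)
    finally show ?thesis by simp
  qed
  moreover have "(\<lambda>\<omega>. \<Sum>j<n. dev j \<omega> * (\<integral>x. classical_grad (e j) x \<bullet> ?g x \<partial>lebesgue_on D)) \<in> borel_measurable P"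
    by (intro borel_measurable_sum borel_measurable_times borel_measurable_const dev_measurable) simp
  ultimately show "(\<lambda>\<omega>. \<integral>x. weak_grad D (err \<omega>) x \<bullet> ?g x \<partial>lebesgue_on D) \<in> borel_measurable P"
    by (subst measurable_cong)
qed

section \<open>Pointwise variances and their integrals\<close>

lemma est_expand:
  assumes "\<omega> \<in> space P"
  shows "est \<omega> x = (\<Sum>j<n. dev j \<omega> * e j x) + mean_field P M \<xi> (uI \<sigma>) x"
  using fun_cong[OF err_expand[OF assms], of x] by simp

text \<open>Values of the estimator and components of its gradient are both affine in the
  \<open>dev j\<close> with deterministic coefficients, so one formula yields \<open>Var\<close> and
  \<open>Var_grad\<close>.\<close>

lemma variance_affine_dev:
  assumes Z: "\<And>\<omega>. \<omega> \<in> space P \<Longrightarrow> Z \<omega> = (\<Sum>j<n. dev j \<omega> * a j) + c"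
  shows "(\<integral>\<omega>. (Z \<omega> - (\<integral>\<omega>'. Z \<omega>' \<partial>P))\<^sup>2 \<partial>P) = (\<Sum>i<n. \<Sum>j<n. cov i j * (a i * a j))"
proof -
  have i: "integrable P (\<lambda>\<omega>. \<Sum>j<n. dev j \<omega> * a j)"
    by (intro Bochner_Integration.integrable_sum integrable_mult_left dev_integrable) simp
  have "(\<integral>\<omega>. Z \<omega> \<partial>P) = (\<integral>\<omega>. (\<Sum>j<n. dev j \<omega> * a j) + c \<partial>P)"
    by (rule Bochner_Integration.integral_cong[OF refl Z])
  also have "\<dots> = (\<integral>\<omega>. (\<Sum>j<n. dev j \<omega> * a j) \<partial>P) + (\<integral>\<omega>. c \<partial>P)"
    by (rule Bochner_Integration.integral_add[OF i integrable_const])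
  also have "(\<integral>\<omega>. (\<Sum>j<n. dev j \<omega> * a j) \<partial>P) = (\<Sum>j<n. \<integral>\<omega>. dev j \<omega> * a j \<partial>P)"
    by (intro Bochner_Integration.integral_sum integrable_mult_left dev_integrable) simp
  also have "\<dots> = 0" by (intro sum.neutral ballI) (simp add: dev_mean)
  finally have mZ: "(\<integral>\<omega>. Z \<omega> \<partial>P) = c" by (simp add: prob_space)
  have "(\<integral>\<omega>. (Z \<omega> - (\<integral>\<omega>'. Z \<omega>' \<partial>P))\<^sup>2 \<partial>P) = (\<integral>\<omega>. (\<Sum>i<n. \<Sum>j<n. (dev i \<omega> * dev j \<omega>) * (a i * a j)) \<partial>P)"
    unfolding mZ
    by (rule Bochner_Integration.integral_cong[OF refl]) (simp only: Z add_diff_cancel_right' square_sum_eq)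
  also have "\<dots> = (\<Sum>i<n. \<integral>\<omega>. (\<Sum>j<n. (dev i \<omega> * dev j \<omega>) * (a i * a j)) \<partial>P)"
    by (intro Bochner_Integration.integral_sum Bochner_Integration.integrable_sum integrable_mult_left dev_mult_integrable) auto
  also have "\<dots> = (\<Sum>i<n. \<Sum>j<n. \<integral>\<omega>. (dev i \<omega> * dev j \<omega>) * (a i * a j) \<partial>P)"
    by (intro sum.cong refl Bochner_Integration.integral_sum integrable_mult_left dev_mult_integrable) auto
  finally show ?thesis by (simp add: cov_def)
qed

lemma Var_est: "Var P est x = (\<Sum>i<n. \<Sum>j<n. cov i j * (e i x * e j x))"
  unfolding Var_def by (rule variance_affine_dev) (rule est_expand)

lemma weak_grad_est:
  assumes "\<omega> \<in> space P" and x: "x \<in> D - skeleton"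
  shows "weak_grad D (est \<omega>) x = (\<Sum>j<n. dev j \<omega> *\<^sub>R classical_grad (e j) x) + classical_grad (mean_field P M \<xi> (uI \<sigma>)) x"
proof -
  have "est \<omega> = (\<lambda>x. 1 * err \<omega> x + 1 * mean_field P M \<xi> (uI \<sigma>) x)" by auto
  then have "weak_grad D (est \<omega>) x = classical_grad (\<lambda>x. 1 * err \<omega> x + 1 * mean_field P M \<xi> (uI \<sigma>) x) x"
    using fe_weak_grad[OF est_mem[OF assms(1)]] by simp
  also have "\<dots> = 1 *\<^sub>R classical_grad (err \<omega>) x + 1 *\<^sub>R classical_grad (mean_field P M \<xi> (uI \<sigma>)) x"
    by (rule fe_grad_lincomb[OF err_mem[OF assms(1)] mean_field_mem x])
  also have "classical_grad (err \<omega>) x = (\<Sum>j<n. dev j \<omega> *\<^sub>R classical_grad (e j) x)"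
    unfolding err_expand[OF assms(1)] by (rule fe_grad_sum[OF _ x]) (rule e_mem, simp)
  finally show ?thesis by simp
qed

lemma Var_grad_est:
  assumes x: "x \<in> D - skeleton"
  shows "Var_grad P D est x = (\<Sum>i<n. \<Sum>j<n. cov i j * (classical_grad (e i) x \<bullet> classical_grad (e j) x))"
proof -
  let ?G = "\<lambda>j. classical_grad (e j) x"
  have "Var P (\<lambda>\<omega> x. weak_grad D (est \<omega>) x \<bullet> b) x = (\<Sum>i<n. \<Sum>j<n. cov i j * ((?G i \<bullet> b) * (?G j \<bullet> b)))" for b
    unfolding Var_def
  proof (rule variance_affine_dev)
    show "weak_grad D (est \<omega>) x \<bullet> b = (\<Sum>j<n. dev j \<omega> * (?G j \<bullet> b)) + classical_grad (mean_field P M \<xi> (uI \<sigma>)) x \<bullet> b"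
      if "\<omega> \<in> space P" for \<omega>
      unfolding weak_grad_est[OF that x] by (simp add: inner_add_left inner_sum_left)
  qed
  then have "Var_grad P D est x = (\<Sum>b\<in>Basis. \<Sum>i<n. \<Sum>j<n. cov i j * ((?G i \<bullet> b) * (?G j \<bullet> b)))"
    unfolding Var_grad_def by simp
  also have "\<dots> = (\<Sum>i<n. \<Sum>j<n. \<Sum>b\<in>Basis. cov i j * ((?G i \<bullet> b) * (?G j \<bullet> b)))"
    by (subst sum.swap) (intro sum.cong refl sum.swap)
  also have "\<dots> = (\<Sum>i<n. \<Sum>j<n. cov i j * (?G i \<bullet> ?G j))"
    by (intro sum.cong refl) (simp only: euclidean_inner[of "?G _" "?G _"] sum_distrib_left)
  finally show ?thesis .
qed

lemma e_mult_integrable: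
  assumes "i < n" "j < n"
  shows "integrable (lebesgue_on D) (\<lambda>x. e i x * e j x)"
  using square_integrable_on_inner[OF fe_sq(1)[OF e_mem[OF assms(1)]] fe_sq(1)[OF e_mem[OF assms(2)]]] by simp

lemma e_grad_integrable:
  assumes "i < n" "j < n"
  shows "integrable (lebesgue_on D) (\<lambda>x. classical_grad (e i) x \<bullet> classical_grad (e j) x)"
  by (intro square_integrable_on_inner fe_sq e_mem assms)

lemma Var_est_integrable: "integrable (lebesgue_on D) (Var P est)"
  unfolding Var_est[abs_def]
  by (intro Bochner_Integration.integrable_sum integrable_mult_right e_mult_integrable) auto

lemma integral_Var_est: "(\<integral>x. Var P est x \<partial>lebesgue_on D) = (\<Sum>i<n. \<Sum>j<n. cov i j * (\<integral>x. e i x * e j x \<partial>lebesgue_on D))"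
proof -
  have "(\<integral>x. Var P est x \<partial>lebesgue_on D) = (\<Sum>i<n. \<integral>x. (\<Sum>j<n. cov i j * (e i x * e j x)) \<partial>lebesgue_on D)"
    unfolding Var_est
    by (intro Bochner_Integration.integral_sum Bochner_Integration.integrable_sum integrable_mult_right e_mult_integrable) auto
  also have "\<dots> = (\<Sum>i<n. \<Sum>j<n. \<integral>x. cov i j * (e i x * e j x) \<partial>lebesgue_on D)"
    by (intro sum.cong refl Bochner_Integration.integral_sum integrable_mult_right e_mult_integrable) auto
  finally show ?thesis by simp
qed

text \<open>The formula for \<open>Var_grad\<close> is available off the skeleton, so measurability
  comes from completeness. Integration replaces the products of gradients by
  \<open>ip (e i) (e j)\<close>, and orthonormality leaves the trace of \<open>cov\<close>, which is
  also the value in \<open>L2_H10_norm_err\<close>.\<close>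

lemma Var_grad_est_integral:
  "integrable (lebesgue_on D) (Var_grad P D est)"
  "(\<integral>x. Var_grad P D est x \<partial>lebesgue_on D) = (\<Sum>j<n. cov j j)"
proof -
  let ?R = "\<lambda>x. \<Sum>i<n. \<Sum>j<n. cov i j * (classical_grad (e i) x \<bullet> classical_grad (e j) x)"
  have R: "integrable (lebesgue_on D) ?R"
    by (intro Bochner_Integration.integrable_sum integrable_mult_right e_grad_integrable) auto
  have ae: "AE x in lebesgue_on D. ?R x = Var_grad P D est x"
    by (rule AE_off_skeleton) (rule Var_grad_est[symmetric])
  have m: "Var_grad P D est \<in> borel_measurable (lebesgue_on D)"
    by (rule measurable_AE_eq[OF borel_measurable_integrable[OF R] ae])
  show "integrable (lebesgue_on D) (Var_grad P D est)"
    by (rule integrable_cong_AE_imp[OF R m ae])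
  have "(\<integral>x. Var_grad P D est x \<partial>lebesgue_on D) = (\<integral>x. ?R x \<partial>lebesgue_on D)"
    by (rule integral_cong_AE[OF m borel_measurable_integrable[OF R]]) (use ae in \<open>eventually_elim, simp\<close>)
  also have "\<dots> = (\<Sum>i<n. \<integral>x. (\<Sum>j<n. cov i j * (classical_grad (e i) x \<bullet> classical_grad (e j) x)) \<partial>lebesgue_on D)"
    by (intro Bochner_Integration.integral_sum Bochner_Integration.integrable_sum integrable_mult_right e_grad_integrable) auto
  also have "\<dots> = (\<Sum>i<n. \<Sum>j<n. \<integral>x. cov i j * (classical_grad (e i) x \<bullet> classical_grad (e j) x) \<partial>lebesgue_on D)"
    by (intro sum.cong refl Bochner_Integration.integral_sum integrable_mult_right e_grad_integrable) auto
  also have "\<dots> = (\<Sum>i<n. \<Sum>j<n. if j = i then cov i i else 0)"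
    using e_orth by (intro sum.cong refl) (auto simp: wip_def)
  also have "\<dots> = (\<Sum>j<n. cov j j)" by (intro sum.cong refl) simp
  finally show "(\<integral>x. Var_grad P D est x \<partial>lebesgue_on D) = (\<Sum>j<n. cov j j)" .
qed

section \<open>The error in the L2 norm\<close>

lemma L2_norm_err:
  assumes "\<omega> \<in> space P"
  shows "(L2_norm D (err \<omega>))\<^sup>2 = (\<integral>x. (err \<omega> x)\<^sup>2 \<partial>lebesgue_on D)"
    "(L2_norm D (err \<omega>))\<^sup>2 = (\<Sum>i<n. \<Sum>j<n. (dev i \<omega> * dev j \<omega>) * (\<integral>x. e i x * e j x \<partial>lebesgue_on D))"
proof -
  have "0 \<le> (\<integral>x. (err \<omega> x)\<^sup>2 \<partial>lebesgue_on D)" by (intro integral_nonneg_AE AE_I2) simp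
  then show 1: "(L2_norm D (err \<omega>))\<^sup>2 = (\<integral>x. (err \<omega> x)\<^sup>2 \<partial>lebesgue_on D)" by (simp add: L2_norm_def)
  have "(\<integral>x. (err \<omega> x)\<^sup>2 \<partial>lebesgue_on D) = (\<integral>x. (\<Sum>i<n. \<Sum>j<n. (dev i \<omega> * dev j \<omega>) * (e i x * e j x)) \<partial>lebesgue_on D)"
    by (simp only: fun_cong[OF err_expand[OF assms]] square_sum_eq)
  also have "\<dots> = (\<Sum>i<n. \<integral>x. (\<Sum>j<n. (dev i \<omega> * dev j \<omega>) * (e i x * e j x)) \<partial>lebesgue_on D)"
    by (intro Bochner_Integration.integral_sum Bochner_Integration.integrable_sum integrable_mult_right e_mult_integrable) auto
  also have "\<dots> = (\<Sum>i<n. \<Sum>j<n. \<integral>x. (dev i \<omega> * dev j \<omega>) * (e i x * e j x) \<partial>lebesgue_on D)"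
    by (intro sum.cong refl Bochner_Integration.integral_sum integrable_mult_right e_mult_integrable) auto
  finally show "(L2_norm D (err \<omega>))\<^sup>2 = (\<Sum>i<n. \<Sum>j<n. (dev i \<omega> * dev j \<omega>) * (\<integral>x. e i x * e j x \<partial>lebesgue_on D))"
    unfolding 1 by simp
qed

lemma L2_norm_err_integral:
  "integrable P (\<lambda>\<omega>. (L2_norm D (err \<omega>))\<^sup>2)"
  "(\<integral>\<omega>. (L2_norm D (err \<omega>))\<^sup>2 \<partial>P) = (\<integral>x. Var P est x \<partial>lebesgue_on D)"
proof -
  let ?E = "\<lambda>i j. \<integral>x. e i x * e j x \<partial>lebesgue_on D"
  have "integrable P (\<lambda>\<omega>. \<Sum>i<n. \<Sum>j<n. (dev i \<omega> * dev j \<omega>) * ?E i j)"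
    by (intro Bochner_Integration.integrable_sum integrable_mult_left dev_mult_integrable) auto
  then show "integrable P (\<lambda>\<omega>. (L2_norm D (err \<omega>))\<^sup>2)"
    by (rule Bochner_Integration.integrable_cong[OF refl, THEN iffD2, rotated]) (rule L2_norm_err)
  have "(\<integral>\<omega>. (L2_norm D (err \<omega>))\<^sup>2 \<partial>P) = (\<integral>\<omega>. (\<Sum>i<n. \<Sum>j<n. (dev i \<omega> * dev j \<omega>) * ?E i j) \<partial>P)"
    by (rule Bochner_Integration.integral_cong[OF refl]) (rule L2_norm_err)
  also have "\<dots> = (\<Sum>i<n. \<integral>\<omega>. (\<Sum>j<n. (dev i \<omega> * dev j \<omega>) * ?E i j) \<partial>P)"
    by (intro Bochner_Integration.integral_sum Bochner_Integration.integrable_sum integrable_mult_left dev_mult_integrable) auto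
  also have "\<dots> = (\<Sum>i<n. \<Sum>j<n. \<integral>\<omega>. (dev i \<omega> * dev j \<omega>) * ?E i j \<partial>P)"
    by (intro sum.cong refl Bochner_Integration.integral_sum integrable_mult_left dev_mult_integrable) auto
  also have "\<dots> = (\<integral>x. Var P est x \<partial>lebesgue_on D)"
    unfolding integral_Var_est by (simp add: cov_def)
  finally show "(\<integral>\<omega>. (L2_norm D (err \<omega>))\<^sup>2 \<partial>P) = (\<integral>x. Var P est x \<partial>lebesgue_on D)" .
qed

lemma L2_L2_norm_err: "(L2_L2_norm P D err)\<^sup>2 = (\<integral>x. Var P est x \<partial>lebesgue_on D)"
proof -
  have "0 \<le> (\<integral>\<omega>. (L2_norm D (err \<omega>))\<^sup>2 \<partial>P)" by (intro integral_nonneg_AE AE_I2) simp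
  then show ?thesis unfolding L2_L2_norm_def L2_norm_err_integral(2) by simp
qed

text \<open>The basis is orthonormal for gradients and not for L2, so the integrated variance is not
  simply the trace of \<open>cov\<close>. The rate reaches it through the Poincare inequality,
  applied to each realisation of the error.\<close>

lemma Var_est_poincare:
  assumes C: "C > 0" "\<And>v. v \<in> V \<Longrightarrow> (\<integral>x. (v x)\<^sup>2 \<partial>lebesgue_on D) \<le> C * ip v v"
  shows "(\<integral>x. Var P est x \<partial>lebesgue_on D) \<le> C * (\<Sum>j<n. cov j j)"
proof -
  have "(\<integral>\<omega>. (L2_norm D (err \<omega>))\<^sup>2 \<partial>P) \<le> (\<integral>\<omega>. C * (H10_norm D (err \<omega>))\<^sup>2 \<partial>P)"
  proof (rule integral_mono[OF L2_norm_err_integral(1) integrable_mult_right[OF H10_norm_err_integrable]])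
    fix \<omega> assume \<omega>: "\<omega> \<in> space P"
    show "(L2_norm D (err \<omega>))\<^sup>2 \<le> C * (H10_norm D (err \<omega>))\<^sup>2"
      unfolding L2_norm_err(1)[OF \<omega>] H10_norm_square[OF err_mem[OF \<omega>]] by (rule C(2)[OF err_mem[OF \<omega>]])
  qed
  also have "\<dots> = C * (L2_H10_norm P D err)\<^sup>2"
  proof -
    have "0 \<le> (\<integral>\<omega>. (H10_norm D (err \<omega>))\<^sup>2 \<partial>P)" by (intro integral_nonneg_AE AE_I2) simp
    then show ?thesis by (simp add: L2_H10_norm_def)
  qed
  finally show ?thesis unfolding L2_norm_err_integral(2) L2_H10_norm_err .
qed

lemma est_square_integrable: "integrable P (\<lambda>\<omega>. (est \<omega> x)\<^sup>2)"
proof -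
  let ?c = "mean_field P M \<xi> (uI \<sigma>) x"
  let ?S = "\<lambda>\<omega>. \<Sum>j<n. dev j \<omega> * e j x"
  have "integrable P (\<lambda>\<omega>. (\<Sum>i<n. \<Sum>j<n. (dev i \<omega> * dev j \<omega>) * (e i x * e j x)) + (2 * ?c * ?S \<omega> + ?c\<^sup>2))"
    by (intro Bochner_Integration.integrable_add Bochner_Integration.integrable_sum integrable_mult_left
        integrable_mult_right dev_mult_integrable dev_integrable integrable_const) auto
  then show ?thesis
  proof (rule Bochner_Integration.integrable_cong[OF refl, THEN iffD2, rotated])
    fix \<omega> assume \<omega>: "\<omega> \<in> space P"
    have "(est \<omega> x)\<^sup>2 = (?S \<omega>)\<^sup>2 + (2 * ?c * ?S \<omega> + ?c\<^sup>2)"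
      unfolding est_expand[OF \<omega>] power2_sum by simp
    then show "(est \<omega> x)\<^sup>2 = (\<Sum>i<n. \<Sum>j<n. (dev i \<omega> * dev j \<omega>) * (e i x * e j x)) + (2 * ?c * ?S \<omega> + ?c\<^sup>2)"
      unfolding square_sum_eq .
  qed
qed

end

text \<open>With the gradient norm on \<open>H10 D\<close> the identity concerns the variance of the
  gradient; with the L2 norm it concerns the variance of the values. Both readings are given, with
  the integrability that makes them meaningful, and the rate is shown for both. The constant
  \<open>C\<close> is chosen before \<sigma>, \<open>N\<close> and the samples.\<close>

theorem lemma6:
  fixes D :: "'a::euclidean_space set"
    and \<T> :: "'a set set"
    and f :: "'a \<Rightarrow> real"
    and P :: "'w measure"
    and \<xi> :: "nat \<Rightarrow> 'w \<Rightarrow> real"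
    and K :: "'a \<Rightarrow> 'a \<Rightarrow> real"
    and G :: "'a \<Rightarrow> 'w \<Rightarrow> real"
    and lam :: "nat \<Rightarrow> real"
    and \<phi> :: "nat \<Rightarrow> 'a \<Rightarrow> real"
    and M p q :: nat
    and uI :: "real \<Rightarrow> (nat \<Rightarrow> real) \<Rightarrow> 'a \<Rightarrow> real"
    and uII :: "real \<Rightarrow> (nat \<Rightarrow> nat) \<Rightarrow> 'a \<Rightarrow> real"
  assumes domain: "open D" "connected D" "bounded D" "D \<noteq> {}"
    and mesh: "regular_triangulation D \<T>"
    and force: "square_integrable_on D f"
    and prob: "gaussian_space P \<xi>"
    and process: "stationary_gaussian_process P D K G"
    and KL: "karhunen_loeve P \<xi> D K G lam \<phi>"
    and model_I: "\<And>\<sigma>. 0 < \<sigma> \<Longrightarrow> model_I_solution D (fe_space D \<T> q) f M lam \<phi> \<sigma> (uI \<sigma>)"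
    and model_II: "\<And>\<sigma>. 0 < \<sigma> \<Longrightarrow> model_II_solution D (fe_space D \<T> q) f M p lam \<phi> \<sigma> (uII \<sigma>)"
  shows
    "(\<forall>\<sigma>>0. \<forall>N\<ge>1. \<forall>X. independent_samples P M \<xi> N X \<longrightarrow>
       (let est = E_IS M p N X (uI \<sigma>) (uII \<sigma>);
            err = (\<lambda>\<omega> x. est \<omega> x - mean_field P M \<xi> (uI \<sigma>) x)
        in err \<in> L2_H10 P D \<and>
           (\<forall>x\<in>D. integrable P (\<lambda>\<omega>. uI \<sigma> (gaussian_vector M \<xi> \<omega>) x) \<and>
                   integrable P (\<lambda>\<omega>. (est \<omega> x)\<^sup>2)) \<and>
           integrable (lebesgue_on D) (Var P est) \<and>
           integrable (lebesgue_on D) (Var_grad P D est) \<and>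
           (L2_H10_norm P D err)\<^sup>2 = (\<integral>x. Var_grad P D est x \<partial>lebesgue_on D) \<and>
           (L2_L2_norm P D err)\<^sup>2 = (\<integral>x. Var P est x \<partial>lebesgue_on D))) \<and>
     (p \<ge> 1 \<longrightarrow>
       (\<exists>C. \<forall>\<^sub>F \<sigma> in at_right 0. \<forall>N\<ge>1. \<forall>X. independent_samples P M \<xi> N X \<longrightarrow>
         (let est = E_IS M p N X (uI \<sigma>) (uII \<sigma>);
              err = (\<lambda>\<omega> x. est \<omega> x - mean_field P M \<xi> (uI \<sigma>) x)
          in (L2_H10_norm P D err)\<^sup>2 \<le> C * \<sigma> ^ 4 / real N \<and>
             (\<integral>x. Var P est x \<partial>lebesgue_on D) \<le> C * \<sigma> ^ 4 / real N)))"
proof -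
  interpret finite_elements D \<T> q
    by unfold_locales (use domain mesh in auto)
  \<comment> \<open>The basis depends on the mesh and on \<open>q\<close> but not on \<sigma>,
    \<open>N\<close> or the samples, so constants obtained in its coordinates can be uniform in
    them.\<close>
  obtain n e where "fe_basis D \<T> q n e" using fe_basis_exists by blast
  then interpret fe_basis D \<T> q n e .
  \<comment> \<open>One term of a series of nonnegative terms with sum 1 is at most 1.\<close>
  have phi_bound: "\<bar>sqrt (lam k) * \<phi> k x\<bar> \<le> 1" if x: "x \<in> D" for k x
  proof -
    have nn: "0 \<le> lam i" for i using KL by (simp add: karhunen_loeve_def)
    have s: "(\<lambda>i. lam i * (\<phi> i x)\<^sup>2) sums 1" using KL x by (simp add: karhunen_loeve_def)
    have "(\<Sum>i\<in>{k}. lam i * (\<phi> i x)\<^sup>2) \<le> (\<Sum>i. lam i * (\<phi> i x)\<^sup>2)"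
      by (rule sum_le_suminf) (use s nn in \<open>auto simp: sums_iff\<close>)
    then have "lam k * (\<phi> k x)\<^sup>2 \<le> 1" using s by (simp add: sums_iff)
    then have "(sqrt (lam k) * \<phi> k x)\<^sup>2 \<le> 1" using nn by (simp add: power_mult_distrib)
    then show ?thesis by (simp add: abs_square_le_1)
  qed
  have phi_measurable: "\<phi> k \<in> borel_measurable (lebesgue_on D)" for k
    using KL by (auto simp: karhunen_loeve_def square_integrable_on_def)
  interpret model_problem D \<T> q n e f lam \<phi> M p uI uII
    by unfold_locales (use phi_measurable phi_bound model_I model_II in auto)
  interpret prob_space P using prob by (simp add: gaussian_space_def)
  interpret random_problem D \<T> q n e f lam \<phi> M p uI uII P \<xi>
    by unfold_locales (use prob in \<open>auto simp: gaussian_space_def\<close>)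
  have sp: "sampled_problem D \<T> q n e f lam \<phi> M p uI uII P \<xi> \<sigma> N X"
    if "0 < \<sigma>" "1 \<le> N" "independent_samples P M \<xi> N X" for \<sigma> N X
    by unfold_locales (use that in auto)
  show ?thesis
  proof (intro conjI allI impI)
    fix \<sigma> :: real and N :: nat and X
    assume a: "0 < \<sigma>" "1 \<le> N" "independent_samples P M \<xi> N X"
    interpret sampled_problem D \<T> q n e f lam \<phi> M p uI uII P \<xi> \<sigma> N X by (rule sp[OF a])
    show "let est = E_IS M p N X (uI \<sigma>) (uII \<sigma>);
            err = (\<lambda>\<omega> x. est \<omega> x - mean_field P M \<xi> (uI \<sigma>) x)
        in err \<in> L2_H10 P D \<and>
           (\<forall>x\<in>D. integrable P (\<lambda>\<omega>. uI \<sigma> (gaussian_vector M \<xi> \<omega>) x) \<and>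
                   integrable P (\<lambda>\<omega>. (est \<omega> x)\<^sup>2)) \<and>
           integrable (lebesgue_on D) (Var P est) \<and>
           integrable (lebesgue_on D) (Var_grad P D est) \<and>
           (L2_H10_norm P D err)\<^sup>2 = (\<integral>x. Var_grad P D est x \<partial>lebesgue_on D) \<and>
           (L2_L2_norm P D err)\<^sup>2 = (\<integral>x. Var P est x \<partial>lebesgue_on D)"
      unfolding Let_def L2_H10_norm_err Var_grad_est_integral(2) L2_L2_norm_err
      by (intro conjI ballI refl err_L2_H10 mean_field_expand(1) a est_square_integrable
          Var_est_integrable Var_grad_est_integral(1))
  next
    assume "1 \<le> p"
    then obtain B where B: "B \<ge> 0" "\<And>\<sigma>. 0 < \<sigma> \<Longrightarrow> \<sigma> \<le> 1 \<Longrightarrow> (\<Sum>j<n. cvar \<sigma> j) \<le> B * \<sigma> ^ 4"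
      using cvar_bound by blast
    obtain CP where CP: "CP > 0" "\<And>v. v \<in> fe_space D \<T> q \<Longrightarrow> (\<integral>x. (v x)\<^sup>2 \<partial>lebesgue_on D) \<le> CP * ip v v"
      using fe_poincare by blast
    \<comment> \<open>The entry 1 serves the gradient norm, the Poincare constant \<open>CP\<close>
      the integrated variance of the values.\<close>
    define C where "C = max 1 CP * B"
    have "\<forall>N\<ge>1. \<forall>X. independent_samples P M \<xi> N X \<longrightarrow>
         (let est = E_IS M p N X (uI \<sigma>) (uII \<sigma>);
              err = (\<lambda>\<omega> x. est \<omega> x - mean_field P M \<xi> (uI \<sigma>) x)
          in (L2_H10_norm P D err)\<^sup>2 \<le> C * \<sigma> ^ 4 / real N \<and>
             (\<integral>x. Var P est x \<partial>lebesgue_on D) \<le> C * \<sigma> ^ 4 / real N)" if \<sigma>: "0 < \<sigma>" "\<sigma> \<le> 1" for \<sigma>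
    proof (intro allI impI)
      fix N :: nat and X
      assume a: "1 \<le> N" "independent_samples P M \<xi> N X"
      interpret sampled_problem D \<T> q n e f lam \<phi> M p uI uII P \<xi> \<sigma> N X by (rule sp[OF \<sigma>(1) a])
      have "(\<Sum>j<n. cov j j) = (\<Sum>j<n. cvar \<sigma> j) / real N"
        by (simp add: cov_diag sum_divide_distrib)
      also have "\<dots> \<le> B * \<sigma> ^ 4 / real N"
        using B(2)[OF \<sigma>] by (intro divide_right_mono) auto
      finally have c: "(\<Sum>j<n. cov j j) \<le> B * \<sigma> ^ 4 / real N" .
      have b0: "0 \<le> B * \<sigma> ^ 4 / real N" using B(1) \<sigma> by simp
      have "1 * (B * \<sigma> ^ 4 / real N) \<le> max 1 CP * (B * \<sigma> ^ 4 / real N)"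
        "CP * (B * \<sigma> ^ 4 / real N) \<le> max 1 CP * (B * \<sigma> ^ 4 / real N)"
        using b0 by (intro mult_right_mono; simp)+
      moreover have "CP * (\<Sum>j<n. cov j j) \<le> CP * (B * \<sigma> ^ 4 / real N)"
        using c CP(1) by (intro mult_left_mono) auto
      moreover have "max 1 CP * (B * \<sigma> ^ 4 / real N) = C * \<sigma> ^ 4 / real N" by (simp add: C_def)
      ultimately have "(\<Sum>j<n. cov j j) \<le> C * \<sigma> ^ 4 / real N" "CP * (\<Sum>j<n. cov j j) \<le> C * \<sigma> ^ 4 / real N"
        using c by linarith+
      then show "let est = E_IS M p N X (uI \<sigma>) (uII \<sigma>);
              err = (\<lambda>\<omega> x. est \<omega> x - mean_field P M \<xi> (uI \<sigma>) x)
          in (L2_H10_norm P D err)\<^sup>2 \<le> C * \<sigma> ^ 4 / real N \<and>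
             (\<integral>x. Var P est x \<partial>lebesgue_on D) \<le> C * \<sigma> ^ 4 / real N"
        unfolding Let_def L2_H10_norm_err using Var_est_poincare[OF CP] by linarith
    qed
    moreover have "\<forall>\<^sub>F \<sigma> in at_right (0::real). 0 < \<sigma> \<and> \<sigma> \<le> 1"
      unfolding eventually_at_right_field by (intro exI[of _ 1]) auto
    ultimately show "\<exists>C. \<forall>\<^sub>F \<sigma> in at_right 0. \<forall>N\<ge>1. \<forall>X. independent_samples P M \<xi> N X \<longrightarrow>
         (let est = E_IS M p N X (uI \<sigma>) (uII \<sigma>);
              err = (\<lambda>\<omega> x. est \<omega> x - mean_field P M \<xi> (uI \<sigma>) x)
          in (L2_H10_norm P D err)\<^sup>2 \<le> C * \<sigma> ^ 4 / real N \<and>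
             (\<integral>x. Var P est x \<partial>lebesgue_on D) \<le> C * \<sigma> ^ 4 / real N)"
      by (intro exI[of _ C]) (auto elim: eventually_mono)
  qed
qed

end
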